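(* Let $(G,\phi,\tau,c)$ be an extended QM symmetry class with $G$ a compact Lie group. Let $\mathcal{RTP}_Z(G,\phi,\tau,c)$ be the quotient of the commutative monoid $\mathcal{TP}_Z(G,\phi,\tau,c)$ of topological phases of finite dimensional gapped systems with this extended QM symmetry class by the submonoid of classes of topologically trivial systems. Then there is an isomorphism $$\mathcal{RTP}_Z(G,\phi,\tau,c)\cong{}^{\phi}K_G^{\tau,c}.$$
   Context: $\mathbb T\subset\mathbb C$ is the unit circle group. An extended QM symmetry class $(G,\phi,\tau,c)$ consists of a Lie group $G$, continuous homomorphisms $\phi,c\colon G\to\{\pm1\}$ and a $\phi$-twisted extension $1\to\mathbb T\to G^\tau\to G\to1$, i.e. a group extension with $\tilde gz=z^{\phi(g)}\tilde g$ for $\tilde g$ over $g$. We write $\phi(g),c(g)$ also for $g\in G^\tau$. A $(\phi,\tau,c)$-twisted representation of $G$ is a $\mathbb Z/2$-graded complex vector space $E$ with a continuous homomorphism $\rho\colon G^\tau\to\mathrm{Aut}_{\mathbb R}(E)$ such that $\rho(g)$ is complex linear if $\phi(g)=1$ and antilinear if $\phi(g)=-1$, is even if $c(g)=1$ and odd if $c(g)=-1$, and $\mathbb T$ acts by scalar multiplication. $\mathrm{Rep}_s^{(\phi,\tau,c)}(G)$ is the commutative monoid under $\oplus$ of isomorphism classes of finite dimensional such representations; $\mathrm{Triv}_s^{(\phi,\tau,c)}(G)$ is the submonoid of those for which there is an odd $\mathbb C$-linear automorphism $P$ with $P\rho(g)=c(g)\rho(g)P$ for all $g\in G^\tau$;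 ${}^{\phi}K_G^{\tau,c}=\mathrm{Rep}_s^{(\phi,\tau,c)}(G)/\mathrm{Triv}_s^{(\phi,\tau,c)}(G)$. The quotient of a commutative monoid $M$ by a submonoid $N$ is $M$ modulo $m\sim m'$ iff $m+n=m'+n'$ for some $n,n'\in N$. A finite dimensional gapped system with extended QM symmetry class $(G,\phi,\tau,c)$ is a triple $(\mathcal H,H,\rho)$: a finite dimensional complex Hilbert space $\mathcal H$, an invertible self-adjoint operator $H$ on $\mathcal H$, and a continuous homomorphism $\rho$ from $G^\tau$ to the group of unitary and antiunitary operators on $\mathcal H$, with $\rho(g)$ unitary or antiunitary according to $\phi(g)=\pm1$, $\mathbb T$ acting by scalars, and $\rho(g)H=c(g)H\rho(g)$. $\mathcal H$ is $\mathbb Z/2$-graded by the positive (even) and negative (odd) spectral subspaces of $H$. Two systems are in the same topological phase if they are isomorphic to the two ends of a continuous family of such systems parametrized by $[0,1]$ (a hermitian vector bundle over $[0,1]$ with continuous families of operators $H_t$ and representations $\rho_t$). $\mathcal{TP}_Z(G,\phi,\tau,c)$ is the set of topological phases, a commutative monoid under direct sum. A system is topologically trivial if there is an odd ($\mathbb C$-linear) automorphism $P\colon\mathcal H\to\mathcal H$ with $P\rho(g)=c(g)\rho(g)P$ for all $g\in G^\tau$. *)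

theory Defs
  imports
    "HOL-Analysis.Analysis"
    "HOL-Algebra.Sym_Groups"
    "HOL-Library.Function_Algebras"
begin

section \<open>Topological groups and Lie groups\<close>

record 'g topgroup = "'g monoid" +
  gtop :: "'g topology"

definition topological_group :: "('g, 'm) topgroup_scheme \<Rightarrow> bool" where
  "topological_group G \<longleftrightarrow>
     group G \<and> topspace (gtop G) = carrier G \<and>
     continuous_map (prod_topology (gtop G) (gtop G)) (gtop G) (\<lambda>(x, y). x \<otimes>\<^bsub>G\<^esub> y) \<and>
     continuous_map (gtop G) (gtop G) (\<lambda>x. inv\<^bsub>G\<^esub> x)"

text \<open>
  \<^term>\<open>C_diff r n D f\<close>: the function \<^term>\<open>f\<close> is of class \<open>C\<^sup>r\<close> on \<^term>\<open>D\<close>, where \<^term>\<open>D\<close> is open in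
  \<^term>\<open>Euclidean_space n\<close>; that is, all iterated partial derivatives up to order \<^term>\<open>r\<close>
  exist and are continuous. A natural number as dimension (rather than a type of class
  \<open>euclidean_space\<close>) is needed because finite groups are Lie groups of dimension zero.
\<close>

fun C_diff :: "nat \<Rightarrow> nat \<Rightarrow> (nat \<Rightarrow> real) set \<Rightarrow> ((nat \<Rightarrow> real) \<Rightarrow> real) \<Rightarrow> bool" where
  "C_diff 0 n D f \<longleftrightarrow> continuous_map (subtopology (Euclidean_space n) D) euclideanreal f"
| "C_diff (Suc r) n D f \<longleftrightarrow>
     continuous_map (subtopology (Euclidean_space n) D) euclideanreal f \<and>
     (\<forall>i<n. \<exists>f'. (\<forall>x\<in>D. ((\<lambda>t. f (x(i := t))) has_real_derivative f' x) (at (x i))) \<and>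
                 C_diff r n D f')"

definition smooth_map :: "nat \<Rightarrow> nat \<Rightarrow> (nat \<Rightarrow> real) set \<Rightarrow> ((nat \<Rightarrow> real) \<Rightarrow> (nat \<Rightarrow> real)) \<Rightarrow> bool" where
  "smooth_map n m D f \<longleftrightarrow> (\<forall>k<m. \<forall>r. C_diff r n D (\<lambda>x. f x k))"

record 'g liegroup = "'g topgroup" +
  gdim :: nat
  gatlas :: "('g set \<times> ('g \<Rightarrow> nat \<Rightarrow> real)) set"

definition smooth_atlas ::
    "'g topology \<Rightarrow> nat \<Rightarrow> ('g set \<times> ('g \<Rightarrow> nat \<Rightarrow> real)) set \<Rightarrow> bool" where
  "smooth_atlas T n A \<longleftrightarrow>
     (\<Union>(U, \<phi>)\<in>A. U) = topspace T \<and>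
     (\<forall>(U, \<phi>)\<in>A. openin T U \<and> openin (Euclidean_space n) (\<phi> ` U) \<and>
        homeomorphic_map (subtopology T U) (subtopology (Euclidean_space n) (\<phi> ` U)) \<phi>) \<and>
     (\<forall>(U, \<phi>)\<in>A. \<forall>(V, \<psi>)\<in>A.
        smooth_map n n (\<phi> ` (U \<inter> V)) (\<lambda>x. \<psi> (inv_into U \<phi> x)))"

text \<open>The two halves of a point of \<open>\<real>\<^sup>n\<^sup>+\<^sup>n = \<real>\<^sup>n \<times> \<real>\<^sup>n\<close>.\<close>

definition fst_half :: "nat \<Rightarrow> (nat \<Rightarrow> real) \<Rightarrow> nat \<Rightarrow> real" where
  "fst_half n z = (\<lambda>i. if i < n then z i else 0)"

definition snd_half :: "nat \<Rightarrow> (nat \<Rightarrow> real) \<Rightarrow> nat \<Rightarrow> real" where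
  "snd_half n z = (\<lambda>i. if i < n then z (n + i) else 0)"

definition lie_group :: "('g, 'm) liegroup_scheme \<Rightarrow> bool" where
  "lie_group G \<longleftrightarrow>
     topological_group G \<and> Hausdorff_space (gtop G) \<and> second_countable (gtop G) \<and>
     smooth_atlas (gtop G) (gdim G) (gatlas G) \<and>
     (\<forall>(U, \<phi>)\<in>gatlas G. \<forall>(V, \<psi>)\<in>gatlas G. \<forall>(W, \<omega>)\<in>gatlas G.
        let n = gdim G;
            m = (\<lambda>z. inv_into U \<phi> (fst_half n z) \<otimes>\<^bsub>G\<^esub> inv_into V \<psi> (snd_half n z))
        in smooth_map (n + n) n
             {z \<in> topspace (Euclidean_space (n + n)).
                fst_half n z \<in> \<phi> ` U \<and> snd_half n z \<in> \<psi> ` V \<and> m z \<in> W}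
             (\<lambda>z. \<omega> (m z))) \<and>
     (\<forall>(U, \<phi>)\<in>gatlas G. \<forall>(V, \<psi>)\<in>gatlas G.
        smooth_map (gdim G) (gdim G) (\<phi> ` {x \<in> U. inv\<^bsub>G\<^esub> x \<in> V})
          (\<lambda>x. \<psi> (inv\<^bsub>G\<^esub> (inv_into U \<phi> x))))"

section \<open>Extended QM symmetry classes\<close>

definition circle_group :: "complex monoid" where
  "circle_group = \<lparr>carrier = sphere 0 1, mult = (*), one = 1\<rparr>"

record ('g, 'h) qm_class =
  qbase :: "'g liegroup"
  qphi :: "'g \<Rightarrow> int"
  qc :: "'g \<Rightarrow> int"
  qext :: "'h topgroup"
  qincl :: "complex \<Rightarrow> 'h"
  qproj :: "'h \<Rightarrow> 'g"

text \<open>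
  The extension is one of topological groups: the circle is a topological subgroup of the
  extension and the base is the topological quotient. The group \<^term>\<open>sign_img\<close> is \<open>{1, -1}\<close>.
\<close>

definition extended_qm_class :: "('g, 'h) qm_class \<Rightarrow> bool" where
  "extended_qm_class Q \<longleftrightarrow>
     lie_group (qbase Q) \<and>
     qphi Q \<in> hom (qbase Q) sign_img \<and>
     continuous_map (gtop (qbase Q)) (discrete_topology {-1, 1}) (qphi Q) \<and>
     qc Q \<in> hom (qbase Q) sign_img \<and>
     continuous_map (gtop (qbase Q)) (discrete_topology {-1, 1}) (qc Q) \<and>
     topological_group (qext Q) \<and>
     qincl Q \<in> hom circle_group (qext Q) \<and>
     embedding_map (top_of_set (sphere 0 1)) (gtop (qext Q)) (qincl Q) \<and>
     qproj Q \<in> hom (qext Q) (qbase Q) \<and>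
     quotient_map (gtop (qext Q)) (gtop (qbase Q)) (qproj Q) \<and>
     qincl Q ` carrier circle_group = kernel (qext Q) (qbase Q) (qproj Q) \<and>
     (\<forall>g\<in>carrier (qext Q). \<forall>z\<in>carrier circle_group.
        g \<otimes>\<^bsub>qext Q\<^esub> qincl Q z = qincl Q (z powi qphi Q (qproj Q g)) \<otimes>\<^bsub>qext Q\<^esub> g)"

definition qphi_ext :: "('g, 'h) qm_class \<Rightarrow> 'h \<Rightarrow> int" where
  "qphi_ext Q g = qphi Q (qproj Q g)"

definition qc_ext :: "('g, 'h) qm_class \<Rightarrow> 'h \<Rightarrow> int" where
  "qc_ext Q g = qc Q (qproj Q g)"

section \<open>Finite dimensional complex vector spaces\<close>

text \<open>
  Isomorphism classes have to be taken within one type. The vector spaces considered are all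
  finite dimensional subspaces of the space of complex sequences; every finite dimensional
  complex vector space is isomorphic to such a subspace. The product topology on sequences
  induces on a finite dimensional subspace its usual topology.
\<close>

type_synonym vec = "nat \<Rightarrow> complex"

definition cscale :: "complex \<Rightarrow> vec \<Rightarrow> vec" where
  "cscale a v = (\<lambda>i. a * v i)"

global_interpretation cseq: vector_space cscale
  by unfold_locales (auto simp: cscale_def fun_eq_iff algebra_simps)

definition fd_space :: "vec set \<Rightarrow> bool" where
  "fd_space V \<longleftrightarrow> (\<exists>B. finite B \<and> V = cseq.span B)"

definition clinear_on :: "vec set \<Rightarrow> vec set \<Rightarrow> (vec \<Rightarrow> vec) \<Rightarrow> bool" where
  "clinear_on V W f \<longleftrightarrow> f \<in> V \<rightarrow> W \<and>
     (\<forall>v\<in>V. \<forall>w\<in>V. f (v + w) = f v + f w) \<and> (\<forall>a. \<forall>v\<in>V. f (cscale a v) = cscale a (f v))"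

definition antilinear_on :: "vec set \<Rightarrow> vec set \<Rightarrow> (vec \<Rightarrow> vec) \<Rightarrow> bool" where
  "antilinear_on V W f \<longleftrightarrow> f \<in> V \<rightarrow> W \<and>
     (\<forall>v\<in>V. \<forall>w\<in>V. f (v + w) = f v + f w) \<and> (\<forall>a. \<forall>v\<in>V. f (cscale a v) = cscale (cnj a) (f v))"

definition linear_iso_on :: "vec set \<Rightarrow> vec set \<Rightarrow> (vec \<Rightarrow> vec) \<Rightarrow> bool" where
  "linear_iso_on V W f \<longleftrightarrow> clinear_on V W f \<and> bij_betw f V W"

definition inner_product_on :: "vec set \<Rightarrow> (vec \<Rightarrow> vec \<Rightarrow> complex) \<Rightarrow> bool" where
  "inner_product_on V ip \<longleftrightarrow>
     (\<forall>u\<in>V. \<forall>v\<in>V. \<forall>w\<in>V. ip u (v + w) = ip u v + ip u w) \<and>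
     (\<forall>a. \<forall>u\<in>V. \<forall>v\<in>V. ip u (cscale a v) = a * ip u v) \<and>
     (\<forall>u\<in>V. \<forall>v\<in>V. ip v u = cnj (ip u v)) \<and>
     (\<forall>v\<in>V. v \<noteq> 0 \<longrightarrow> Re (ip v v) > 0)"

definition graded_by :: "vec set \<Rightarrow> vec set \<Rightarrow> vec set \<Rightarrow> bool" where
  "graded_by V A B \<longleftrightarrow> cseq.subspace A \<and> cseq.subspace B \<and> A \<inter> B = {0} \<and> V = {a + b |a b. a \<in> A \<and> b \<in> B}"

text \<open>
  The external direct sum, realized in the same type by interleaving sequences:
  \<open>(v, w) \<mapsto> v \<boxplus> w\<close> is a linear isomorphism from pairs of sequences to sequences.
\<close>

definition interleave :: "vec \<Rightarrow> vec \<Rightarrow> vec" (infixl \<open>\<boxplus>\<close> 65) where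
  "v \<boxplus> w = (\<lambda>i. if even i then v (i div 2) else w (i div 2))"

definition part1 :: "vec \<Rightarrow> vec" where "part1 x = (\<lambda>i. x (2 * i))"

definition part2 :: "vec \<Rightarrow> vec" where "part2 x = (\<lambda>i. x (2 * i + 1))"

definition space_sum :: "vec set \<Rightarrow> vec set \<Rightarrow> vec set" where
  "space_sum V W = {v \<boxplus> w |v w. v \<in> V \<and> w \<in> W}"

definition op_sum :: "(vec \<Rightarrow> vec) \<Rightarrow> (vec \<Rightarrow> vec) \<Rightarrow> vec \<Rightarrow> vec" where
  "op_sum f g x = f (part1 x) \<boxplus> g (part2 x)"

section \<open>Monoids of classes\<close>

definition class_monoid :: "'a set \<Rightarrow> ('a \<Rightarrow> 'a \<Rightarrow> 'a) \<Rightarrow> 'a \<Rightarrow> ('a \<times> 'a) set \<Rightarrow> 'a set monoid" where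
  "class_monoid X add e r =
     \<lparr>carrier = X // r,
      mult = (\<lambda>A B. r `` {add a b |a b. a \<in> A \<and> b \<in> B}),
      one = r `` {e}\<rparr>"

definition quotient_monoid :: "('a, 'm) monoid_scheme \<Rightarrow> 'a set \<Rightarrow> 'a set monoid" where
  "quotient_monoid M N = class_monoid (carrier M) (mult M) (one M)
     {(m, m'). m \<in> carrier M \<and> m' \<in> carrier M \<and>
        (\<exists>n\<in>N. \<exists>n'\<in>N. m \<otimes>\<^bsub>M\<^esub> n = m' \<otimes>\<^bsub>M\<^esub> n')}"

section \<open>Twisted representations\<close>

text \<open>
  Continuity of \<open>\<rho>\<close> as a map to the real linear automorphisms of \<open>V\<close>: since \<open>V\<close> has finite
  dimension, the topology of that group is the topology of pointwise convergence.
\<close>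

definition twisted_action :: "('g, 'h) qm_class \<Rightarrow> vec set \<Rightarrow> ('h \<Rightarrow> vec \<Rightarrow> vec) \<Rightarrow> bool" where
  "twisted_action Q V \<rho> \<longleftrightarrow>
     (\<forall>g\<in>carrier (qext Q). bij_betw (\<rho> g) V V \<and>
        (qphi_ext Q g = 1 \<longrightarrow> clinear_on V V (\<rho> g)) \<and>
        (qphi_ext Q g = -1 \<longrightarrow> antilinear_on V V (\<rho> g))) \<and>
     (\<forall>g\<in>carrier (qext Q). \<forall>h\<in>carrier (qext Q). \<forall>v\<in>V. \<rho> (g \<otimes>\<^bsub>qext Q\<^esub> h) v = \<rho> g (\<rho> h v)) \<and>
     (\<forall>v\<in>V. continuous_map (gtop (qext Q)) (top_of_set V) (\<lambda>g. \<rho> g v)) \<and>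
     (\<forall>z\<in>carrier circle_group. \<forall>v\<in>V. \<rho> (qincl Q z) v = cscale z v)"

record 'h graded_rep =
  rspace :: "vec set"
  reven :: "vec set"
  rodd :: "vec set"
  ract :: "'h \<Rightarrow> vec \<Rightarrow> vec"

definition twisted_rep :: "('g, 'h) qm_class \<Rightarrow> 'h graded_rep \<Rightarrow> bool" where
  "twisted_rep Q E \<longleftrightarrow>
     fd_space (rspace E) \<and> graded_by (rspace E) (reven E) (rodd E) \<and>
     twisted_action Q (rspace E) (ract E) \<and>
     (\<forall>g\<in>carrier (qext Q).
        (qc_ext Q g = 1 \<longrightarrow> ract E g \<in> reven E \<rightarrow> reven E \<and> ract E g \<in> rodd E \<rightarrow> rodd E) \<and>
        (qc_ext Q g = -1 \<longrightarrow> ract E g \<in> reven E \<rightarrow> rodd E \<and> ract E g \<in> rodd E \<rightarrow> reven E))"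

definition rep_iso :: "('g, 'h) qm_class \<Rightarrow> 'h graded_rep \<Rightarrow> 'h graded_rep \<Rightarrow> bool" where
  "rep_iso Q E F \<longleftrightarrow> (\<exists>f. linear_iso_on (rspace E) (rspace F) f \<and>
     f \<in> reven E \<rightarrow> reven F \<and> f \<in> rodd E \<rightarrow> rodd F \<and>
     (\<forall>g\<in>carrier (qext Q). \<forall>v\<in>rspace E. f (ract E g v) = ract F g (f v)))"

definition rep_sum :: "'h graded_rep \<Rightarrow> 'h graded_rep \<Rightarrow> 'h graded_rep" where
  "rep_sum E F =
     \<lparr>rspace = space_sum (rspace E) (rspace F),
      reven = space_sum (reven E) (reven F),
      rodd = space_sum (rodd E) (rodd F),
      ract = (\<lambda>g. op_sum (ract E g) (ract F g))\<rparr>"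

definition zero_rep :: "'h graded_rep" where
  "zero_rep = \<lparr>rspace = {0}, reven = {0}, rodd = {0}, ract = (\<lambda>g v. v)\<rparr>"

definition odd_symmetry ::
    "('g, 'h) qm_class \<Rightarrow> vec set \<Rightarrow> vec set \<Rightarrow> vec set \<Rightarrow> ('h \<Rightarrow> vec \<Rightarrow> vec) \<Rightarrow> (vec \<Rightarrow> vec) \<Rightarrow> bool" where
  "odd_symmetry Q V A B \<rho> P \<longleftrightarrow> linear_iso_on V V P \<and> P \<in> A \<rightarrow> B \<and> P \<in> B \<rightarrow> A \<and>
     (\<forall>g\<in>carrier (qext Q). \<forall>v\<in>V. P (\<rho> g v) = cscale (of_int (qc_ext Q g)) (\<rho> g (P v)))"

definition rep_trivial :: "('g, 'h) qm_class \<Rightarrow> 'h graded_rep \<Rightarrow> bool" where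
  "rep_trivial Q E \<longleftrightarrow> (\<exists>P. odd_symmetry Q (rspace E) (reven E) (rodd E) (ract E) P)"

definition rep_rel :: "('g, 'h) qm_class \<Rightarrow> ('h graded_rep \<times> 'h graded_rep) set" where
  "rep_rel Q = {(E, F). twisted_rep Q E \<and> twisted_rep Q F \<and> rep_iso Q E F}"

definition Rep_s :: "('g, 'h) qm_class \<Rightarrow> 'h graded_rep set monoid" where
  "Rep_s Q = class_monoid {E. twisted_rep Q E} rep_sum zero_rep (rep_rel Q)"

definition Triv_s :: "('g, 'h) qm_class \<Rightarrow> 'h graded_rep set set" where
  "Triv_s Q = {rep_rel Q `` {E} |E. twisted_rep Q E \<and> rep_trivial Q E}"

definition twisted_K :: "('g, 'h) qm_class \<Rightarrow> 'h graded_rep set set monoid" where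
  "twisted_K Q = quotient_monoid (Rep_s Q) (Triv_s Q)"

section \<open>Gapped systems and topological phases\<close>

record 'h gapped =
  sspace :: "vec set"
  sinner :: "vec \<Rightarrow> vec \<Rightarrow> complex"
  sham :: "vec \<Rightarrow> vec"
  sact :: "'h \<Rightarrow> vec \<Rightarrow> vec"

definition gapped_system :: "('g, 'h) qm_class \<Rightarrow> 'h gapped \<Rightarrow> bool" where
  "gapped_system Q S \<longleftrightarrow>
     fd_space (sspace S) \<and> inner_product_on (sspace S) (sinner S) \<and>
     linear_iso_on (sspace S) (sspace S) (sham S) \<and>
     (\<forall>v\<in>sspace S. \<forall>w\<in>sspace S. sinner S (sham S v) w = sinner S v (sham S w)) \<and>
     twisted_action Q (sspace S) (sact S) \<and>
     (\<forall>g\<in>carrier (qext Q). \<forall>v\<in>sspace S. \<forall>w\<in>sspace S.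
        (qphi_ext Q g = 1 \<longrightarrow> sinner S (sact S g v) (sact S g w) = sinner S v w) \<and>
        (qphi_ext Q g = -1 \<longrightarrow> sinner S (sact S g v) (sact S g w) = cnj (sinner S v w))) \<and>
     (\<forall>g\<in>carrier (qext Q). \<forall>v\<in>sspace S.
        sact S g (sham S v) = cscale (of_int (qc_ext Q g)) (sham S (sact S g v)))"

text \<open>In finite dimension, a spectral subspace is the span of the corresponding eigenvectors.\<close>

definition pos_space :: "'h gapped \<Rightarrow> vec set" where
  "pos_space S = cseq.span {v \<in> sspace S. \<exists>l::real. l > 0 \<and> sham S v = cscale (of_real l) v}"

definition neg_space :: "'h gapped \<Rightarrow> vec set" where
  "neg_space S = cseq.span {v \<in> sspace S. \<exists>l::real. l < 0 \<and> sham S v = cscale (of_real l) v}"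

definition system_iso :: "('g, 'h) qm_class \<Rightarrow> 'h gapped \<Rightarrow> 'h gapped \<Rightarrow> bool" where
  "system_iso Q S T \<longleftrightarrow> (\<exists>f. linear_iso_on (sspace S) (sspace T) f \<and>
     (\<forall>v\<in>sspace S. \<forall>w\<in>sspace S. sinner T (f v) (f w) = sinner S v w) \<and>
     (\<forall>v\<in>sspace S. f (sham S v) = sham T (f v)) \<and>
     (\<forall>g\<in>carrier (qext Q). \<forall>v\<in>sspace S. f (sact S g v) = sact T g (f v)))"

text \<open>
  A hermitian vector bundle over \<open>[0,1]\<close> with fibres \<^term>\<open>V\<close>, fibre metrics \<^term>\<open>ip\<close> and
  total space topology \<^term>\<open>T\<close>.
\<close>

definition hermitian_bundle ::
    "(real \<Rightarrow> vec set) \<Rightarrow> (real \<Rightarrow> vec \<Rightarrow> vec \<Rightarrow> complex) \<Rightarrow> (real \<times> vec) topology \<Rightarrow> bool" where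
  "hermitian_bundle V ip T \<longleftrightarrow>
     (\<forall>t\<in>{0..1}. fd_space (V t) \<and> inner_product_on (V t) (ip t)) \<and>
     topspace T = Sigma {0..1} V \<and>
     continuous_map T (top_of_set {0..1}) fst \<and>
     (\<forall>t\<in>{0..1}. \<exists>U W \<Phi>. openin (top_of_set {0..1}) U \<and> t \<in> U \<and> fd_space W \<and>
        (\<forall>s\<in>U. linear_iso_on W (V s) (\<Phi> s)) \<and>
        homeomorphic_map (prod_topology (top_of_set U) (top_of_set W)) (subtopology T (Sigma U V))
          (\<lambda>(s, w). (s, \<Phi> s w))) \<and>
     continuous_map (subtopology (prod_topology T T) {(x, y). fst x = fst y}) euclidean
       (\<lambda>(x, y). ip (fst x) (snd x) (snd y))"

definition system_family ::
    "('g, 'h) qm_class \<Rightarrow> (real \<Rightarrow> 'h gapped) \<Rightarrow> (real \<times> vec) topology \<Rightarrow> bool" where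
  "system_family Q F T \<longleftrightarrow>
     (\<forall>t\<in>{0..1}. gapped_system Q (F t)) \<and>
     hermitian_bundle (\<lambda>t. sspace (F t)) (\<lambda>t. sinner (F t)) T \<and>
     continuous_map T T (\<lambda>(t, v). (t, sham (F t) v)) \<and>
     continuous_map (prod_topology (gtop (qext Q)) T) T (\<lambda>(g, (t, v)). (t, sact (F t) g v))"

definition same_phase :: "('g, 'h) qm_class \<Rightarrow> 'h gapped \<Rightarrow> 'h gapped \<Rightarrow> bool" where
  "same_phase Q S S' \<longleftrightarrow>
     (\<exists>F T. system_family Q F T \<and> system_iso Q S (F 0) \<and> system_iso Q S' (F 1))"

definition system_sum :: "'h gapped \<Rightarrow> 'h gapped \<Rightarrow> 'h gapped" where
  "system_sum S T =
     \<lparr>sspace = space_sum (sspace S) (sspace T),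
      sinner = (\<lambda>x y. sinner S (part1 x) (part1 y) + sinner T (part2 x) (part2 y)),
      sham = op_sum (sham S) (sham T),
      sact = (\<lambda>g. op_sum (sact S g) (sact T g))\<rparr>"

definition zero_system :: "'h gapped" where
  "zero_system = \<lparr>sspace = {0}, sinner = (\<lambda>v w. 0), sham = (\<lambda>v. v), sact = (\<lambda>g v. v)\<rparr>"

definition topologically_trivial :: "('g, 'h) qm_class \<Rightarrow> 'h gapped \<Rightarrow> bool" where
  "topologically_trivial Q S \<longleftrightarrow>
     (\<exists>P. odd_symmetry Q (sspace S) (pos_space S) (neg_space S) (sact S) P)"

definition phase_rel :: "('g, 'h) qm_class \<Rightarrow> ('h gapped \<times> 'h gapped) set" where
  "phase_rel Q = {(S, S'). gapped_system Q S \<and> gapped_system Q S' \<and> same_phase Q S S'}"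

definition TP_Z :: "('g, 'h) qm_class \<Rightarrow> 'h gapped set monoid" where
  "TP_Z Q = class_monoid {S. gapped_system Q S} system_sum zero_system (phase_rel Q)"

definition trivial_phases :: "('g, 'h) qm_class \<Rightarrow> 'h gapped set set" where
  "trivial_phases Q = {phase_rel Q `` {S} |S. gapped_system Q S \<and> topologically_trivial Q S}"

definition RTP_Z :: "('g, 'h) qm_class \<Rightarrow> 'h gapped set set monoid" where
  "RTP_Z Q = quotient_monoid (TP_Z Q) (trivial_phases Q)"

end

theory Submission
  imports Defs
begin

text \<open>
  A gapped system is sent to its space with the action, graded by the spectral subspaces of the
  Hamiltonian. This map is additive, it matches topologically trivial systems with trivial
  representations by definition, and so everything rests on two facts: every twisted
  representation arises, and two systems are in the same phase if and only if their
  representations are isomorphic.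

  Both need averaging over the compact group \<open>G\<^sup>\<tau>\<close>. A form can be replaced by an invariant one
  that is bounded by the values of the original along its orbit, because a strictly convex
  invariant function on the compact convex set of all such forms has a unique minimizer.
  Applied to an inner product this gives the first fact, with the grading operator as Hamiltonian.
  Applied to a trivialization of a family near a parameter it gives a nondegenerate invariant
  pairing of nearby representations, so that their isomorphism class is locally constant.
  Conversely, systems on the same representation are connected by flattening the Hamiltonians
  and interpolating the inner products.
\<close>

subsection \<open>Finite dimensional spaces of sequences\<close>

text \<open>Spectral subspaces at nearby parameters of a family are never compared through
  continuous spectral projections. Only the continuity of the Hamiltonian, of the action and of the
  fibre metric enters, by way of two continuous real functions: the energy of a vector, and the
  pairing of its orbit with a vector projected at the fixed parameter. This is why averaging has to
  keep pointwise positivity along orbits, and why it acts on forms rather than on maps: an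
  antilinear group element conjugates the values of an invariant form, which leaves real parts
  alone, so lower bounds on real parts make sense for linear and antilinear elements alike. The
  Riesz representation turns an invariant form back into an intertwiner. The correspondence is
  arranged to hold on the nose: a twisted representation is equal, not just isomorphic, to the one
  underlying a suitable system, and the two direct sums are formed by the same interleaving. The
  monoids of phases and of representations are thus isomorphic before any quotient is taken.\<close>

lemma sum_fun_apply: "(\<Sum>i\<in>I. f i) x = (\<Sum>i\<in>I. f i x)"
  by (induction I rule: infinite_finite_induct) auto

lemma cscale_apply: "cscale a v i = a * v i"
  by (simp add: cscale_def)

lemma fd_space_subspace: "fd_space V \<Longrightarrow> cseq.subspace V"
  by (auto simp: fd_space_def)

text \<open>This is a basis in reduced row echelon form with pivot positions \<open>I\<close>. The
  coordinates of a vector are then its own entries at the pivots. These are continuous for the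
  product topology, so continuity questions on a finite dimensional space reduce to single
  entries.\<close>

definition reduced_basis :: "vec set \<Rightarrow> nat set \<Rightarrow> (nat \<Rightarrow> vec) \<Rightarrow> bool" where
  "reduced_basis V I b \<longleftrightarrow> cseq.subspace V \<and> finite I \<and> (\<forall>i\<in>I. b i \<in> V) \<and>
     (\<forall>i\<in>I. \<forall>j\<in>I. b i j = (if i = j then 1 else 0)) \<and>
     (\<forall>v\<in>V. v = (\<Sum>i\<in>I. cscale (v i) (b i)))"

text \<open>Gaussian elimination, one spanning vector at a time.\<close>

lemma reduced_basis_exists:
  assumes "fd_space V"
  shows "\<exists>I b. reduced_basis V I b"
proof -
  obtain B where "finite B" "V = cseq.span B"
    using assms fd_space_def by auto
  then show ?thesis
  proof (induction B arbitrary: V)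
    case empty
    then show ?case
      by (intro exI[of _ "{}"] exI[of _ undefined]) (auto simp: reduced_basis_def)
  next
    case (insert x B)
    obtain I b where Ib: "reduced_basis (cseq.span B) I b"
      using insert.IH[OF refl] by auto
    have fin: "finite I" and bB: "\<And>i. i \<in> I \<Longrightarrow> b i \<in> cseq.span B"
      and delta: "\<And>i j. i \<in> I \<Longrightarrow> j \<in> I \<Longrightarrow> b i j = (if i = j then 1 else 0)"
      and ex: "\<And>v. v \<in> cseq.span B \<Longrightarrow> v = (\<Sum>i\<in>I. cscale (v i) (b i))"
      using Ib unfolding reduced_basis_def by blast+
    \<comment> \<open>The new vector with its entries at the old pivots cleared; it vanishes exactly
      when \<open>x\<close> adds nothing to the span.\<close>
    define y where "y = x - (\<Sum>i\<in>I. cscale (x i) (b i))"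
    have sumB: "(\<Sum>i\<in>I. cscale (a i) (b i)) \<in> cseq.span B" for a
      by (intro cseq.span_sum cseq.span_scale bB)
    have yI: "y j = 0" if "j \<in> I" for j
    proof -
      have "(\<Sum>i\<in>I. x i * b i j) = (\<Sum>i\<in>I. if i = j then x i else 0)"
        by (intro sum.cong) (auto simp: delta that)
      then show ?thesis using that fin by (simp add: y_def sum_fun_apply cscale_apply)
    qed
    have spV: "V = {v. \<exists>k. v - cscale k y \<in> cseq.span B}"
    proof -
      have "v - cscale k x \<in> cseq.span B \<longleftrightarrow> v - cscale k y \<in> cseq.span B" for v k
      proof -
        have "v - cscale k y = (v - cscale k x) + cscale k (\<Sum>i\<in>I. cscale (x i) (b i))"
          by (simp add: y_def cseq.scale_right_diff_distrib)
        then show ?thesis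
          using cseq.span_add_eq2[OF cseq.span_scale[OF sumB], of "v - cscale k x" k x] by argo
      qed
      then show ?thesis using insert.prems by (simp add: cseq.span_insert)
    qed
    have subV: "cseq.subspace V" using insert.prems by simp
    have BV: "cseq.span B \<subseteq> V" using insert.prems by (simp add: cseq.span_mono subset_insertI)
    show ?case
    proof (cases "y = 0")
      case True
      then have "V = cseq.span B" using spV by auto
      then show ?thesis using Ib by auto
    next
      case False
      then obtain k where k: "y k \<noteq> 0" by (auto simp: cscale_apply fun_eq_iff cscale_apply)
      have kI: "k \<notin> I" using yI k by auto
      define z where "z = cscale (1 / y k) y"
      have zk: "z k = 1" using k by (simp add: z_def cscale_apply)
      have zI: "z j = 0" if "j \<in> I" for j using that by (simp add: z_def cscale_apply yI)
      have yz: "y = cscale (y k) z" using k by (simp add: z_def fun_eq_iff cscale_apply)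
      \<comment> \<open>Any nonzero entry of \<open>y\<close> may serve as the new pivot
        \<open>k\<close>. The old basis vectors are cleared there with the normalized vector
        \<open>z\<close>.\<close>
      define b' where "b' i = (if i = k then z else b i - cscale (b i k) z)" for i
      have yV: "y \<in> V" unfolding spV by (auto intro!: exI[of _ 1] cseq.span_zero)
      have zV: "z \<in> V" unfolding z_def using yV subV cseq.subspace_scale by blast
      have "reduced_basis V (insert k I) b'"
        unfolding reduced_basis_def
      proof (intro conjI ballI)
        show "cseq.subspace V" by fact
        show "finite (insert k I)" using fin by simp
        show "b' i \<in> V" if "i \<in> insert k I" for i
          unfolding b'_def using that zV bB BV subV
          by (auto intro!: cseq.subspace_diff cseq.subspace_scale)
        show "b' i j = (if i = j then 1 else 0)" if "i \<in> insert k I" "j \<in> insert k I" for i j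
          using that kI by (auto simp: b'_def zk zI delta cscale_apply)
        fix v assume "v \<in> V"
        then obtain a where a: "v - cscale a y \<in> cseq.span B" using spV by auto
        define u where "u = v - cscale a y"
        have "u \<in> cseq.span B" using a u_def by simp
        note u = ex[OF this]
        have v: "v = u + cscale (a * y k) z"
          using yz unfolding u_def by (metis cseq.scale_scale diff_add_cancel)
        have vi: "v i = u i" if "i \<in> I" for i using v zI[OF that] by (simp add: cscale_apply)
        have vk: "v k = u k + a * y k" using arg_cong[OF v, of "\<lambda>f. f k"] by (simp add: zk cscale_apply)
        have uk: "u k = (\<Sum>i\<in>I. u i * b i k)"
          using arg_cong[OF u, of "\<lambda>f. f k"] by (simp add: sum_fun_apply cscale_apply)
        show "v = (\<Sum>i\<in>insert k I. cscale (v i) (b' i))"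
        proof
          fix j
          have uj: "u j = (\<Sum>i\<in>I. u i * b i j)"
            using arg_cong[OF u, of "\<lambda>f. f j"] by (simp add: sum_fun_apply cscale_apply)
          have vj: "v j = u j + a * y k * z j"
            using arg_cong[OF v, of "\<lambda>f. f j"] by (simp add: cscale_apply)
          have "(\<Sum>i\<in>insert k I. cscale (v i) (b' i)) j = v k * z j + (\<Sum>i\<in>I. v i * b' i j)"
            using kI fin by (simp add: sum_fun_apply cscale_apply b'_def)
          also have "(\<Sum>i\<in>I. v i * b' i j) = (\<Sum>i\<in>I. u i * b i j - u i * b i k * z j)"
            using kI by (intro sum.cong) (auto simp: vi b'_def cscale_apply algebra_simps)
          also have "\<dots> = u j - u k * z j"
            unfolding sum_subtractf uj[symmetric] by (simp add: uk sum_distrib_right)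
          finally show "v j = (\<Sum>i\<in>insert k I. cscale (v i) (b' i)) j"
            using vj by (simp add: vk algebra_simps)
        qed
      qed
      then show ?thesis by blast
    qed
  qed
qed

lemma reduced_basisD:
  assumes "reduced_basis V I b"
  shows "cseq.subspace V" "finite I" "\<And>i. i \<in> I \<Longrightarrow> b i \<in> V"
    "\<And>i j. i \<in> I \<Longrightarrow> j \<in> I \<Longrightarrow> b i j = (if i = j then 1 else 0)"
    "\<And>v. v \<in> V \<Longrightarrow> v = (\<Sum>i\<in>I. cscale (v i) (b i))"
    "\<And>a. (\<Sum>i\<in>I. cscale (a i) (b i)) \<in> V"
    "\<And>a j. j \<in> I \<Longrightarrow> (\<Sum>i\<in>I. cscale (a i) (b i)) j = a j"
proof -
  show S: "cseq.subspace V" "finite I" and bV: "\<And>i. i \<in> I \<Longrightarrow> b i \<in> V"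
    and *: "\<And>i j. i \<in> I \<Longrightarrow> j \<in> I \<Longrightarrow> b i j = (if i = j then 1 else 0)"
    and "\<And>v. v \<in> V \<Longrightarrow> v = (\<Sum>i\<in>I. cscale (v i) (b i))"
    using assms unfolding reduced_basis_def by blast+
  show "\<And>a. (\<Sum>i\<in>I. cscale (a i) (b i)) \<in> V"
    by (intro cseq.subspace_sum cseq.subspace_scale S bV)
  fix a j assume j: "j \<in> I"
  have "(\<Sum>i\<in>I. a i * b i j) = (\<Sum>i\<in>I. if i = j then a i else 0)"
    by (intro sum.cong) (auto simp: * j)
  then show "(\<Sum>i\<in>I. cscale (a i) (b i)) j = a j"
    using j S by (simp add: sum_fun_apply cscale_apply)
qed

text \<open>A maximal independent subset of \<open>U\<close> is finite, because the size of
  independent sets in the span of a finite set is bounded.\<close>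

lemma fd_space_subset:
  assumes "fd_space V" "cseq.subspace U" "U \<subseteq> V"
  shows "fd_space U"
proof -
  obtain T where T: "finite T" "V = cseq.span T" using assms(1) fd_space_def by auto
  obtain B where B: "B \<subseteq> U" "cseq.independent B" "U \<subseteq> cseq.span B"
    using cseq.maximal_independent_subset[of U] by blast
  have "finite B" using cseq.independent_span_bound[OF T(1) B(2)] B assms T by auto
  moreover have "U = cseq.span B"
    using B assms(2) cseq.span_minimal by blast
  ultimately show ?thesis unfolding fd_space_def by blast
qed

subsection \<open>Linear maps on subspaces\<close>

lemma clinear_onD:
  assumes "clinear_on V W f"
  shows "\<And>v. v \<in> V \<Longrightarrow> f v \<in> W" "\<And>v w. v \<in> V \<Longrightarrow> w \<in> V \<Longrightarrow> f (v + w) = f v + f w"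
    "\<And>a v. v \<in> V \<Longrightarrow> f (cscale a v) = cscale a (f v)"
  using assms by (auto simp: clinear_on_def)

lemma antilinear_onD:
  assumes "antilinear_on V W f"
  shows "\<And>v. v \<in> V \<Longrightarrow> f v \<in> W" "\<And>v w. v \<in> V \<Longrightarrow> w \<in> V \<Longrightarrow> f (v + w) = f v + f w"
    "\<And>a v. v \<in> V \<Longrightarrow> f (cscale a v) = cscale (cnj a) (f v)"
  using assms by (auto simp: antilinear_on_def)

lemma subspaceD:
  assumes "cseq.subspace V"
  shows "0 \<in> V" "\<And>v w. v \<in> V \<Longrightarrow> w \<in> V \<Longrightarrow> v + w \<in> V" "\<And>a v. v \<in> V \<Longrightarrow> cscale a v \<in> V"
    "\<And>v w. v \<in> V \<Longrightarrow> w \<in> V \<Longrightarrow> v - w \<in> V"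
  using assms by (auto intro: cseq.subspace_0 cseq.subspace_add cseq.subspace_scale cseq.subspace_diff)

lemma clinear_on_0:
  assumes "clinear_on V W f" "cseq.subspace V" shows "f 0 = 0"
  using clinear_onD(3)[OF assms(1), of 0 0] subspaceD(1)[OF assms(2)] by simp

lemma clinear_on_diff:
  assumes "clinear_on V W f" "cseq.subspace V" "v \<in> V" "w \<in> V" shows "f (v - w) = f v - f w"
proof -
  have "f v = f (v - w) + f w"
    using clinear_onD(2)[OF assms(1), of "v - w" w] subspaceD(4)[OF assms(2)] assms by simp
  then show ?thesis by (metis add_diff_cancel_right')
qed

lemma clinear_on_inj:
  assumes "clinear_on V W f" "cseq.subspace V" "\<And>v. v \<in> V \<Longrightarrow> f v = 0 \<Longrightarrow> v = 0"
  shows "inj_on f V"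
proof (rule inj_onI)
  fix v w assume *: "v \<in> V" "w \<in> V" "f v = f w"
  then have "f (v - w) = 0" using clinear_on_diff[OF assms(1,2)] by simp
  then have "v - w = 0" using assms(3) subspaceD(4)[OF assms(2)] * by blast
  then show "v = w" by simp
qed

lemma clinear_on_sum:
  assumes f: "clinear_on V W f" and V: "cseq.subspace V" and "\<And>i. i \<in> I \<Longrightarrow> v i \<in> V"
  shows "f (\<Sum>i\<in>I. cscale (a i) (v i)) = (\<Sum>i\<in>I. cscale (a i) (f (v i)))"
  using assms(3)
proof (induction I rule: infinite_finite_induct)
  case (insert x F)
  have "(\<Sum>i\<in>F. cscale (a i) (v i)) \<in> V"
    using insert.prems V by (intro cseq.subspace_sum cseq.subspace_scale) auto
  then show ?case
    using insert V by (simp add: clinear_onD[OF f] subspaceD del: plus_fun_apply)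
qed (simp_all add: clinear_on_0[OF f V])

lemma clinear_on_compose:
  "clinear_on U V f \<Longrightarrow> clinear_on V W g \<Longrightarrow> clinear_on U W (\<lambda>v. g (f v))"
  by (auto simp: clinear_on_def Pi_iff)

lemma clinear_on_inv_into:
  assumes "linear_iso_on V W f" "cseq.subspace V"
  shows "linear_iso_on W V (inv_into V f)"
proof -
  have f: "clinear_on V W f" and bij: "bij_betw f V W"
    using assms by (auto simp: linear_iso_on_def)
  let ?g = "inv_into V f"
  have bij': "bij_betw ?g W V" using bij by (rule bij_betw_inv_into)
  have gf: "?g (f v) = v" if "v \<in> V" for v using bij that by (simp add: bij_betw_inv_into_left)
  have fg: "f (?g w) = w" "?g w \<in> V" if "w \<in> W" for w
    using bij that by (auto simp: bij_betw_inv_into_right intro: bij_betwE[OF bij', rule_format])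
  have "?g (v + w) = ?g v + ?g w" if "v \<in> W" "w \<in> W" for v w
    using gf[of "?g v + ?g w"] clinear_onD[OF f] fg that subspaceD[OF assms(2)] by simp
  moreover have "?g (cscale a v) = cscale a (?g v)" if "v \<in> W" for v a
    using gf[of "cscale a (?g v)"] clinear_onD[OF f] fg that subspaceD[OF assms(2)] by simp
  ultimately show ?thesis using bij' fg by (auto simp: linear_iso_on_def clinear_on_def)
qed

lemma linear_iso_on_compose:
  "linear_iso_on U V f \<Longrightarrow> linear_iso_on V W g \<Longrightarrow> linear_iso_on U W (\<lambda>v. g (f v))"
  unfolding linear_iso_on_def using clinear_on_compose bij_betw_trans[of f U V g W]
  by (auto simp: comp_def)

text \<open>Dimension count: the images of a basis are independent by injectivity, so a vector
  \<open>y\<close> outside the image would give one more independent vector than the basis has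
  elements.\<close>

lemma clinear_on_inj_surj:
  assumes V: "fd_space V" and f: "clinear_on V V f" and inj: "inj_on f V"
  shows "f ` V = V"
proof (rule ccontr)
  assume "f ` V \<noteq> V"
  then obtain y where y: "y \<in> V" "y \<notin> f ` V" using clinear_onD(1)[OF f] by auto
  have subV: "cseq.subspace V" using V by (rule fd_space_subspace)
  obtain I b where Ib: "reduced_basis V I b" using reduced_basis_exists[OF V] by auto
  note R = reduced_basisD[OF Ib]
  have fsub: "cseq.subspace (f ` V)"
  proof (rule cseq.subspaceI)
    show "0 \<in> f ` V" using clinear_on_0[OF f subV] subspaceD(1)[OF subV] by (metis imageI)
    fix x y assume "x \<in> f ` V" "y \<in> f ` V"
    then obtain v w where "v \<in> V" "w \<in> V" "x = f v" "y = f w" by auto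
    then show "x + y \<in> f ` V"
      using clinear_onD(2)[OF f, of v w] subspaceD(2)[OF subV, of v w] by (metis imageI)
  next
    fix c x assume "x \<in> f ` V"
    then obtain v where "v \<in> V" "x = f v" by auto
    then show "cscale c x \<in> f ` V"
      using clinear_onD(3)[OF f, of v c] subspaceD(3)[OF subV, of v c] by (metis imageI)
  qed
  define B where "B = (\<lambda>i. f (b i)) ` I"
  have injb: "inj_on (\<lambda>i. f (b i)) I"
  proof (rule inj_onI)
    fix i j assume ij: "i \<in> I" "j \<in> I" "f (b i) = f (b j)"
    then have "b i = b j" using inj R(3) by (auto dest: inj_onD)
    then have "b i i = b j i" by simp
    then show "i = j" using ij R(4) by (auto split: if_splits)
  qed
  have ind: "cseq.independent B"
    unfolding B_def
  proof (rule cseq.independent_if_scalars_zero)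
    show "finite ((\<lambda>i. f (b i)) ` I)" using R by simp
    fix c x assume s: "(\<Sum>x\<in>(\<lambda>i. f (b i)) ` I. cscale (c x) x) = 0" and x: "x \<in> (\<lambda>i. f (b i)) ` I"
    have "f (\<Sum>i\<in>I. cscale (c (f (b i))) (b i)) = 0"
      using s clinear_on_sum[OF f subV, of I b "\<lambda>i. c (f (b i))"] R(3) by (simp add: sum.reindex[OF injb])
    then have "(\<Sum>i\<in>I. cscale (c (f (b i))) (b i)) = 0"
      using inj_onD[OF inj, of "(\<Sum>i\<in>I. cscale (c (f (b i))) (b i))" 0] R(6)
        clinear_on_0[OF f subV] subspaceD(1)[OF subV] by simp
    moreover obtain i where i: "i \<in> I" "x = f (b i)" using x by auto
    ultimately show "c x = 0" using R(7)[OF i(1), of "\<lambda>i. c (f (b i))"] by simp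
  qed
  have "cseq.span B \<subseteq> f ` V"
    using fsub R(3) by (intro cseq.span_minimal) (auto simp: B_def)
  then have "cseq.independent (insert y B)" using y ind cseq.independent_insertI by blast
  moreover have "insert y B \<subseteq> cseq.span (b ` I)"
  proof -
    have "v \<in> cseq.span (b ` I)" if "v \<in> V" for v
      by (subst R(5)[OF that]) (intro cseq.span_sum cseq.span_scale cseq.span_base imageI)
    moreover have "insert y B \<subseteq> V" using y R(3) clinear_onD[OF f] by (auto simp: B_def)
    ultimately show ?thesis by blast
  qed
  ultimately have "card (insert y B) \<le> card (b ` I)"
    using cseq.independent_span_bound[of "b ` I" "insert y B"] R(2) by auto
  moreover have "y \<notin> B" using y R(3) by (auto simp: B_def)
  moreover have "card B = card I" unfolding B_def using injb by (rule card_image)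
  moreover have "card (b ` I) \<le> card I" using R(2) by (rule card_image_le)
  moreover have "finite B" using R(2) by (simp add: B_def)
  ultimately show False by simp
qed

subsection \<open>Continuity\<close>

lemma continuous_map_vec_iff:
  fixes f :: "'a \<Rightarrow> vec"
  shows "continuous_map X euclidean f \<longleftrightarrow> (\<forall>i. continuous_map X euclidean (\<lambda>x. f x i))"
  unfolding euclidean_product_topology[symmetric] continuous_map_componentwise_UNIV ..

lemma continuous_map_complex_mult:
  fixes f g :: "'a \<Rightarrow> complex"
  shows "continuous_map X euclidean f \<Longrightarrow> continuous_map X euclidean g \<Longrightarrow>
    continuous_map X euclidean (\<lambda>x. f x * g x)"
  by (simp add: continuous_map_atin tendsto_mult)

lemma continuous_map_cnj:
  "continuous_map X euclidean f \<Longrightarrow> continuous_map X euclidean (\<lambda>x. cnj (f x))"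
  by (simp add: continuous_map_atin tendsto_cnj)

lemma continuous_map_Re:
  "continuous_map X euclidean f \<Longrightarrow> continuous_map X euclidean (\<lambda>x. Re (f x))"
  by (simp add: continuous_map_atin tendsto_Re)

lemma continuous_map_Im:
  "continuous_map X euclidean f \<Longrightarrow> continuous_map X euclidean (\<lambda>x. Im (f x))"
  by (simp add: continuous_map_atin tendsto_Im)

lemma continuous_map_complex_of_real:
  "continuous_map X euclidean f \<Longrightarrow> continuous_map X euclidean (\<lambda>x. complex_of_real (f x))"
  by (simp add: continuous_map_atin tendsto_of_real)

lemma continuous_map_vec_add:
  fixes f g :: "'a \<Rightarrow> vec"
  shows "continuous_map X euclidean f \<Longrightarrow> continuous_map X euclidean g \<Longrightarrow>
    continuous_map X euclidean (\<lambda>x. f x + g x)"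
  by (simp add: continuous_map_vec_iff continuous_map_add)

lemma continuous_map_cscale:
  "continuous_map X euclidean a \<Longrightarrow> continuous_map X euclidean f \<Longrightarrow>
    continuous_map X euclidean (\<lambda>x. cscale (a x) (f x))"
  by (simp add: continuous_map_vec_iff cscale_apply continuous_map_complex_mult)

lemma continuous_map_vec_sum:
  fixes f :: "'a \<Rightarrow> 'i \<Rightarrow> vec"
  assumes "\<And>i. i \<in> I \<Longrightarrow> continuous_map X euclidean (\<lambda>x. f x i)"
  shows "continuous_map X euclidean (\<lambda>x. sum (f x) I)"
  using assms
  by (induction I rule: infinite_finite_induct)
    (simp_all add: continuous_map_vec_add del: plus_fun_apply)

lemma continuous_map_vec_apply:
  "continuous_map X (top_of_set V) f \<Longrightarrow> continuous_map X euclidean (\<lambda>x. (f x :: vec) i)"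
  using continuous_map_vec_iff by (auto simp: continuous_map_in_subtopology)

text \<open>Both linear and antilinear maps are real linear, so that the action of a group element
  and its dependence on the group element can be treated without distinguishing the two cases.\<close>

definition real_linear_on :: "vec set \<Rightarrow> (vec \<Rightarrow> vec) \<Rightarrow> bool" where
  "real_linear_on V f \<longleftrightarrow> (\<forall>v\<in>V. \<forall>w\<in>V. f (v + w) = f v + f w) \<and>
     (\<forall>r::real. \<forall>v\<in>V. f (cscale (of_real r) v) = cscale (of_real r) (f v))"

lemma clinear_on_real_linear: "clinear_on V W f \<Longrightarrow> real_linear_on V f"
  by (simp add: clinear_on_def real_linear_on_def)

lemma antilinear_on_real_linear: "antilinear_on V W f \<Longrightarrow> real_linear_on V f"
  by (simp add: antilinear_on_def real_linear_on_def)

text \<open>The vectors \<open>b i\<close> together with their multiples by \<open>\<i>\<close> form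
  a real basis, with the real and imaginary parts of the pivot entries as real coordinates.\<close>

lemma real_linear_on_expand:
  assumes b: "reduced_basis V I b" and f: "real_linear_on V f" and v: "v \<in> V"
  shows "f v = (\<Sum>i\<in>I. cscale (of_real (Re (v i))) (f (b i)) +
    cscale (of_real (Im (v i))) (f (cscale \<i> (b i))))"
proof -
  note R = reduced_basisD[OF b]
  note S = subspaceD[OF R(1)]
  have f1: "f (v + w) = f v + f w" if "v \<in> V" "w \<in> V" for v w
    using f that by (auto simp: real_linear_on_def)
  have f2: "f (cscale (of_real r) v) = cscale (of_real r) (f v)" if "v \<in> V" for v r
    using f that by (auto simp: real_linear_on_def)
  have f0: "f 0 = 0" using f2[OF S(1), of 0] by simp
  have sum: "f (\<Sum>i\<in>J. g i) = (\<Sum>i\<in>J. f (g i))" if "\<And>i. i \<in> J \<Longrightarrow> g i \<in> V" for g and J :: "nat set"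
    using that
  proof (induction J rule: infinite_finite_induct)
    case (insert x F)
    then have "sum g F \<in> V" using R(1) by (intro cseq.subspace_sum) auto
    with insert show ?case by (simp add: f1 del: plus_fun_apply)
  qed (simp_all add: f0)
  have e: "cscale a w = cscale (of_real (Re a)) w + cscale (of_real (Im a)) (cscale \<i> w)" for a w
    by (subst complex_eq) (simp add: fun_eq_iff cscale_apply algebra_simps)
  have "f v = f (\<Sum>i\<in>I. cscale (of_real (Re (v i))) (b i) + cscale (of_real (Im (v i))) (cscale \<i> (b i)))"
    by (subst R(5)[OF v], subst e) (rule refl)
  also have "\<dots> = (\<Sum>i\<in>I. f (cscale (of_real (Re (v i))) (b i) +
      cscale (of_real (Im (v i))) (cscale \<i> (b i))))"
    by (intro sum S R)
  also have "\<dots> = (\<Sum>i\<in>I. cscale (of_real (Re (v i))) (f (b i)) +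
    cscale (of_real (Im (v i))) (f (cscale \<i> (b i))))"
  proof (rule sum.cong[OF refl])
    fix i assume "i \<in> I"
    then have "b i \<in> V" "cscale \<i> (b i) \<in> V" using R S by auto
    then show "f (cscale (of_real (Re (v i))) (b i) + cscale (of_real (Im (v i))) (cscale \<i> (b i))) =
       cscale (of_real (Re (v i))) (f (b i)) + cscale (of_real (Im (v i))) (f (cscale \<i> (b i)))"
      using S f1 f2 by presburger
  qed
  finally show ?thesis .
qed

text \<open>Separate continuity becomes joint continuity, because the values are combinations of
  finitely many values of \<open>f x\<close> at fixed vectors, with entries of \<open>a x\<close> as
  coefficients. It is applied to group actions, where linear and antilinear maps occur in one
  family.\<close>

lemma continuous_map_real_linear_family:
  assumes V: "fd_space V" and f: "\<And>x. x \<in> topspace X \<Longrightarrow> real_linear_on V (f x)"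
    and c: "\<And>v. v \<in> V \<Longrightarrow> continuous_map X euclidean (\<lambda>x. f x v)"
    and a: "continuous_map X (top_of_set V) a"
  shows "continuous_map X euclidean (\<lambda>x. f x (a x))"
proof -
  obtain I b where b: "reduced_basis V I b" using reduced_basis_exists[OF V] by auto
  note R = reduced_basisD[OF b]
  have aV: "a x \<in> V" if "x \<in> topspace X" for x
    using a that by (auto simp: continuous_map_in_subtopology)
  show ?thesis
  proof (rule continuous_map_eq)
    show "continuous_map X euclidean (\<lambda>x. \<Sum>i\<in>I. cscale (of_real (Re (a x i))) (f x (b i)) +
      cscale (of_real (Im (a x i))) (f x (cscale \<i> (b i))))"
      by (intro continuous_map_vec_sum continuous_map_vec_add continuous_map_cscale
          continuous_map_complex_of_real continuous_map_Re continuous_map_Im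
          continuous_map_vec_apply[OF a] c R subspaceD[OF R(1)])
  qed (rule real_linear_on_expand[OF b f aV, symmetric])
qed

lemma continuous_map_clinear:
  assumes V: "fd_space V" and f: "clinear_on V W f" and a: "continuous_map X (top_of_set V) a"
  shows "continuous_map X (top_of_set W) (\<lambda>x. f (a x))"
proof -
  have "a x \<in> V" if "x \<in> topspace X" for x
    using a that by (auto simp: continuous_map_in_subtopology)
  moreover have "continuous_map X euclidean (\<lambda>x. f (a x))"
    using continuous_map_real_linear_family[OF V _ _ a, of "\<lambda>_. f"] clinear_on_real_linear[OF f] by auto
  ultimately show ?thesis using clinear_onD(1)[OF f] by (auto simp: continuous_map_in_subtopology)
qed

subsection \<open>Sesquilinear forms\<close>

text \<open>The two slots may live on different spaces, since an invariant form on \<open>V\<close>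
  and \<open>W\<close> will be converted into an intertwiner from \<open>V\<close> to
  \<open>W\<close>.\<close>

definition sesquilinear_on :: "vec set \<Rightarrow> vec set \<Rightarrow> (vec \<Rightarrow> vec \<Rightarrow> complex) \<Rightarrow> bool" where
  "sesquilinear_on V W h \<longleftrightarrow>
     (\<forall>u\<in>V. \<forall>v\<in>V. \<forall>w\<in>W. h (u + v) w = h u w + h v w) \<and>
     (\<forall>a. \<forall>v\<in>V. \<forall>w\<in>W. h (cscale a v) w = cnj a * h v w) \<and>
     (\<forall>v\<in>V. \<forall>w\<in>W. \<forall>x\<in>W. h v (w + x) = h v w + h v x) \<and>
     (\<forall>a. \<forall>v\<in>V. \<forall>w\<in>W. h v (cscale a w) = a * h v w)"

lemma sesquilinear_onD:
  assumes "sesquilinear_on V W h"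
  shows "\<And>u v w. u \<in> V \<Longrightarrow> v \<in> V \<Longrightarrow> w \<in> W \<Longrightarrow> h (u + v) w = h u w + h v w"
    "\<And>a v w. v \<in> V \<Longrightarrow> w \<in> W \<Longrightarrow> h (cscale a v) w = cnj a * h v w"
    "\<And>v w x. v \<in> V \<Longrightarrow> w \<in> W \<Longrightarrow> x \<in> W \<Longrightarrow> h v (w + x) = h v w + h v x"
    "\<And>a v w. v \<in> V \<Longrightarrow> w \<in> W \<Longrightarrow> h v (cscale a w) = a * h v w"
  using assms unfolding sesquilinear_on_def by blast+

lemma sesquilinear_on_0:
  assumes h: "sesquilinear_on V W h" and "cseq.subspace V" "cseq.subspace W"
  shows "v \<in> V \<Longrightarrow> h v 0 = 0" "w \<in> W \<Longrightarrow> h 0 w = 0"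
  using sesquilinear_onD(4)[OF h, where v=v and w=0 and a=0]
    sesquilinear_onD(2)[OF h, where v=0 and w=w and a=0] subspaceD(1)[OF assms(2)] subspaceD(1)[OF assms(3)] by auto

lemma sesquilinear_on_diff:
  assumes h: "sesquilinear_on V W h" and V: "cseq.subspace V" and W: "cseq.subspace W"
  shows "u \<in> V \<Longrightarrow> v \<in> V \<Longrightarrow> w \<in> W \<Longrightarrow> h (u - v) w = h u w - h v w"
    "v \<in> V \<Longrightarrow> w \<in> W \<Longrightarrow> x \<in> W \<Longrightarrow> h v (w - x) = h v w - h v x"
  using sesquilinear_onD(1)[OF h, where u="u - v" and v=v and w=w] sesquilinear_onD(3)[OF h, where v=v and w="w - x" and x=x]
    subspaceD(4)[OF V] subspaceD(4)[OF W] by auto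

lemma sesquilinear_on_sum:
  assumes h: "sesquilinear_on V W h" and V: "cseq.subspace V" and W: "cseq.subspace W"
  shows "w \<in> W \<Longrightarrow> (\<And>i. i \<in> I \<Longrightarrow> b i \<in> V) \<Longrightarrow>
      h (\<Sum>i\<in>I. cscale (a i) (b i)) w = (\<Sum>i\<in>I. cnj (a i) * h (b i) w)"
    and "v \<in> V \<Longrightarrow> (\<And>j. j \<in> J \<Longrightarrow> c j \<in> W) \<Longrightarrow>
      h v (\<Sum>j\<in>J. cscale (a j) (c j)) = (\<Sum>j\<in>J. a j * h v (c j))"
proof -
  assume w: "w \<in> W" and b: "\<And>i. i \<in> I \<Longrightarrow> b i \<in> V"
  show "h (\<Sum>i\<in>I. cscale (a i) (b i)) w = (\<Sum>i\<in>I. cnj (a i) * h (b i) w)"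
    using b
  proof (induction I rule: infinite_finite_induct)
    case (insert x F)
    have "(\<Sum>i\<in>F. cscale (a i) (b i)) \<in> V"
      using insert.prems V by (intro cseq.subspace_sum cseq.subspace_scale) auto
    with insert w show ?case by (simp add: sesquilinear_onD[OF h] subspaceD[OF V] del: plus_fun_apply)
  qed (use sesquilinear_on_0[OF h V W] w in simp_all)
next
  assume v: "v \<in> V" and c: "\<And>j. j \<in> J \<Longrightarrow> c j \<in> W"
  show "h v (\<Sum>j\<in>J. cscale (a j) (c j)) = (\<Sum>j\<in>J. a j * h v (c j))"
    using c
  proof (induction J rule: infinite_finite_induct)
    case (insert x F)
    have "(\<Sum>i\<in>F. cscale (a i) (c i)) \<in> W"
      using insert.prems W by (intro cseq.subspace_sum cseq.subspace_scale) auto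
    with insert v show ?case by (simp add: sesquilinear_onD[OF h] subspaceD[OF W] del: plus_fun_apply)
  qed (use sesquilinear_on_0[OF h V W] v in simp_all)
qed

lemma sesquilinear_on_expand:
  assumes h: "sesquilinear_on V W h" and b: "reduced_basis V I b" and c: "reduced_basis W J c"
    and v: "v \<in> V" and w: "w \<in> W"
  shows "h v w = (\<Sum>i\<in>I. \<Sum>j\<in>J. cnj (v i) * (w j * h (b i) (c j)))"
proof -
  note B = reduced_basisD[OF b] and C = reduced_basisD[OF c]
  have "h v w = (\<Sum>i\<in>I. cnj (v i) * h (b i) w)"
    using sesquilinear_on_sum(1)[OF h B(1) C(1) w, where I=I and b=b and a=v] B(3) B(5)[OF v] by simp
  also have "\<dots> = (\<Sum>i\<in>I. cnj (v i) * (\<Sum>j\<in>J. w j * h (b i) (c j)))"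
    using sesquilinear_on_sum(2)[OF h B(1) C(1), where J=J and c=c and a=w] B(3) C(3) C(5)[OF w] by simp
  finally show ?thesis by (simp add: sum_distrib_left)
qed

lemma continuous_map_sesquilinear:
  assumes V: "fd_space V" and W: "fd_space W" and h: "sesquilinear_on V W h"
    and v: "continuous_map X (top_of_set V) v" and w: "continuous_map X (top_of_set W) w"
  shows "continuous_map X euclidean (\<lambda>x. h (v x) (w x))"
proof -
  obtain I b J c where b: "reduced_basis V I b" and c: "reduced_basis W J c"
    using reduced_basis_exists V W by metis
  have vV: "v x \<in> V" "w x \<in> W" if "x \<in> topspace X" for x
    using v w that by (auto simp: continuous_map_in_subtopology)
  show ?thesis
  proof (rule continuous_map_eq)
    show "continuous_map X euclidean (\<lambda>x. \<Sum>i\<in>I. \<Sum>j\<in>J. cnj (v x i) * (w x j * h (b i) (c j)))"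
      by (intro continuous_map_sum continuous_map_complex_mult continuous_map_cnj
          continuous_map_vec_apply[OF v] continuous_map_vec_apply[OF w] continuous_map_const[THEN iffD2]
          reduced_basisD(2)[OF b] reduced_basisD(2)[OF c]) simp
  qed (use sesquilinear_on_expand[OF h b c vV] in simp)
qed

subsection \<open>The unit sphere\<close>

text \<open>The norm is taken from the pivot entries and not from an inner product, so that one
  sphere in a model fibre serves all fibres over a trivializing neighbourhood.\<close>

definition unit_sphere :: "vec set \<Rightarrow> nat set \<Rightarrow> vec set" where
  "unit_sphere V I = {v \<in> V. (\<Sum>i\<in>I. (cmod (v i))\<^sup>2) = 1}"

text \<open>Coordinate vectors of norm one, extended by zero outside \<open>I\<close>, form a closed
  subset of a product of discs and points, which is compact by Tychonoff. The sphere is the image of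
  that set under the continuous map \<open>\<Theta>\<close>.\<close>

lemma compact_unit_sphere:
  assumes b: "reduced_basis V I b"
  shows "compactin (top_of_set V) (unit_sphere V I)"
proof -
  note R = reduced_basisD[OF b]
  define K where "K = {c :: vec. (\<forall>i. i \<notin> I \<longrightarrow> c i = 0) \<and> (\<Sum>i\<in>I. (cmod (c i))\<^sup>2) = 1}"
  define P where "P = PiE UNIV (\<lambda>i. if i \<in> I then cball 0 1 else {0 :: complex})"
  have "compactin (product_topology (\<lambda>i. euclidean) UNIV) P"
    unfolding P_def compactin_PiE by auto
  then have "compact P" by (simp add: euclidean_product_topology)
  moreover have "closed K"
  proof -
    have ap: "continuous_on UNIV (\<lambda>c. (c :: vec) i)" for i
      by (rule continuous_on_product_then_coordinatewise) (rule continuous_on_id)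
    have "K = (\<Inter>i\<in>-I. {c. c i = 0}) \<inter> {c. (\<Sum>i\<in>I. (cmod (c i))\<^sup>2) = 1}" by (auto simp: K_def)
    also have "closed \<dots>"
      by (intro closed_Int closed_INT ballI closed_Collect_eq continuous_intros ap)
    finally show ?thesis .
  qed
  moreover have "K \<subseteq> P"
  proof
    fix c assume c: "c \<in> K"
    have "cmod (c i) \<le> 1" if "i \<in> I" for i
    proof -
      have "(cmod (c i))\<^sup>2 \<le> (\<Sum>i\<in>I. (cmod (c i))\<^sup>2)"
        using that R(2) by (intro member_le_sum) auto
      then show ?thesis using c by (simp add: K_def power_le_one_iff abs_square_le_1)
    qed
    then show "c \<in> P" using c by (auto simp: P_def K_def)
  qed
  ultimately have "compact K" using compact_Int_closed[of P K] by (simp add: Int_absorb1)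
  define \<Theta> where "\<Theta> c = (\<Sum>i\<in>I. cscale (c i) (b i))" for c :: vec
  have \<Theta>: "\<Theta> c \<in> V" "\<And>j. j \<in> I \<Longrightarrow> \<Theta> c j = c j" for c
    unfolding \<Theta>_def by (rule R)+
  have "unit_sphere V I = \<Theta> ` K"
  proof (intro equalityI subsetI)
    fix v assume v: "v \<in> unit_sphere V I"
    let ?c = "\<lambda>i. if i \<in> I then v i else 0"
    have "v = \<Theta> ?c" using R(5)[of v] v by (simp add: \<Theta>_def unit_sphere_def)
    moreover have "?c \<in> K" using v by (simp add: K_def unit_sphere_def)
    ultimately show "v \<in> \<Theta> ` K" by blast
  next
    fix v assume "v \<in> \<Theta> ` K"
    then show "v \<in> unit_sphere V I" using \<Theta> by (auto simp: K_def unit_sphere_def)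
  qed
  moreover have "continuous_on K \<Theta>"
  proof -
    have "continuous_map (top_of_set K) euclidean (\<lambda>c. c i)" for i
      using continuous_on_product_then_coordinatewise[OF continuous_on_id] by simp
    then have "continuous_map (top_of_set K) euclidean \<Theta>"
      unfolding \<Theta>_def by (intro continuous_map_vec_sum continuous_map_cscale) auto
    then show ?thesis by simp
  qed
  ultimately have "compact (unit_sphere V I)" using \<open>compact K\<close> compact_continuous_image by metis
  then show ?thesis by (auto simp: compactin_subtopology unit_sphere_def)
qed

lemma reduced_basis_nonzero:
  assumes b: "reduced_basis V I b" and v: "v \<in> V" "v \<noteq> 0"
  shows "\<exists>i\<in>I. v i \<noteq> 0"
proof (rule ccontr)
  assume "\<not> ?thesis"
  then have "(\<Sum>i\<in>I. cscale (v i) (b i)) = 0" by (intro sum.neutral) auto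
  then show False using reduced_basisD(5)[OF b v(1)] v(2) by simp
qed

lemma unit_sphere_scale:
  assumes b: "reduced_basis V I b" and v: "v \<in> V" "v \<noteq> 0"
  obtains r :: real and u where "r > 0" "u \<in> unit_sphere V I" "v = cscale (of_real r) u"
proof -
  note R = reduced_basisD[OF b]
  define s where "s = (\<Sum>i\<in>I. (cmod (v i))\<^sup>2)"
  have s: "s > 0" unfolding s_def using R(2) reduced_basis_nonzero[OF b v] by (auto intro!: sum_pos2)
  define u where "u = cscale (of_real (1 / sqrt s)) v"
  have "(\<Sum>i\<in>I. (cmod (u i))\<^sup>2) = (\<Sum>i\<in>I. (cmod (v i))\<^sup>2 / s)"
    using s by (intro sum.cong refl) (auto simp: u_def cscale_apply norm_divide power_divide)
  also have "\<dots> = 1" using s by (simp add: s_def flip: sum_divide_distrib)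
  finally have "u \<in> unit_sphere V I"
    using v subspaceD(3)[OF R(1)] by (simp add: unit_sphere_def u_def)
  moreover have "v = cscale (of_real (sqrt s)) u" using s by (simp add: u_def)
  ultimately show ?thesis using s that[of "sqrt s" u] by simp
qed

lemma unit_sphere_nonzero:
  assumes "u \<in> unit_sphere V I" shows "u \<noteq> 0" "u \<in> V"
  using assms by (auto simp: unit_sphere_def)

subsection \<open>Inner products\<close>

lemma inner_product_onD:
  assumes "inner_product_on V ip" "cseq.subspace V"
  shows "sesquilinear_on V V ip" "\<And>u v. u \<in> V \<Longrightarrow> v \<in> V \<Longrightarrow> ip v u = cnj (ip u v)"
    "\<And>v. v \<in> V \<Longrightarrow> v \<noteq> 0 \<Longrightarrow> Re (ip v v) > 0"
    "\<And>v. v \<in> V \<Longrightarrow> Re (ip v v) = 0 \<Longrightarrow> v = 0"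
proof -
  note A = assms(1)[unfolded inner_product_on_def]
  note a = A[THEN conjunct1, rule_format]
    and m = A[THEN conjunct2, THEN conjunct1, rule_format]
    and s = A[THEN conjunct2, THEN conjunct2, THEN conjunct1, rule_format]
    and p = A[THEN conjunct2, THEN conjunct2, THEN conjunct2, rule_format]
  show "\<And>u v. u \<in> V \<Longrightarrow> v \<in> V \<Longrightarrow> ip v u = cnj (ip u v)"
    and "\<And>v. v \<in> V \<Longrightarrow> v \<noteq> 0 \<Longrightarrow> Re (ip v v) > 0" by fact+
  show "\<And>v. v \<in> V \<Longrightarrow> Re (ip v v) = 0 \<Longrightarrow> v = 0" using p by (metis less_irrefl)
  show "sesquilinear_on V V ip"
    unfolding sesquilinear_on_def
  proof (intro conjI ballI allI)
    fix u v w assume *: "u \<in> V" "v \<in> V" "w \<in> V"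
    then have uv: "u + v \<in> V" using subspaceD[OF assms(2)] by auto
    show "ip (u + v) w = ip u w + ip v w"
      using a[OF *(3) *(1) *(2)] s[OF *(3) uv] s[OF *(3) *(1)] s[OF *(3) *(2)] by simp
    show "ip u (v + w) = ip u v + ip u w" using a * by blast
  next
    fix c v w assume *: "v \<in> V" "w \<in> V"
    then have cv: "cscale c v \<in> V" using subspaceD[OF assms(2)] by auto
    show "ip (cscale c v) w = cnj c * ip v w"
      using m[OF *(2) *(1), of c] s[OF *(2) cv] s[OF *(2) *(1)] by simp
    show "ip v (cscale c w) = c * ip v w" using m * by blast
  qed
qed

lemma inner_product_on_subset:
  assumes "inner_product_on V ip" and U: "U \<subseteq> V"
  shows "inner_product_on U ip"
proof -
  note A = assms(1)[unfolded inner_product_on_def]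
  note A' = A[THEN conjunct1, rule_format] A[THEN conjunct2, THEN conjunct1, rule_format]
    A[THEN conjunct2, THEN conjunct2, THEN conjunct1, rule_format]
    A[THEN conjunct2, THEN conjunct2, THEN conjunct2, rule_format]
  show ?thesis
    unfolding inner_product_on_def
    by (intro conjI ballI allI impI; rule A'; (rule subsetD[OF U])?; assumption)
qed

lemma clinear_on_subset:
  "clinear_on V W f \<Longrightarrow> U \<subseteq> V \<Longrightarrow> (\<And>v. v \<in> U \<Longrightarrow> f v \<in> U') \<Longrightarrow> clinear_on U U' f"
  unfolding clinear_on_def by (simp add: subset_iff)

lemma inner_product_unique:
  assumes ip: "inner_product_on V ip" and V: "cseq.subspace V"
    and "u \<in> V" "u' \<in> V" "\<And>w. w \<in> V \<Longrightarrow> ip w u = ip w u'"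
  shows "u = u'"
proof -
  have d: "u - u' \<in> V" using assms(3,4) by (rule subspaceD(4)[OF V])
  then have "ip (u - u') (u - u') = 0"
    using assms(3-5) sesquilinear_on_diff(2)[OF inner_product_onD(1)[OF ip V] V V] by simp
  then have "u - u' = 0" using inner_product_onD(4)[OF ip V d] by simp
  then show ?thesis by simp
qed

text \<open>The map \<open>T\<close> sends \<open>v\<close> to the vector with coordinates
  \<open>ip (b i) v\<close>. A vector in its kernel is orthogonal to a basis and hence to itself, so
  \<open>T\<close> is injective, therefore onto, and the linear system for \<open>u\<close> has a
  solution.\<close>

lemma riesz_representation:
  assumes V: "fd_space V" and ip: "inner_product_on V ip"
    and g: "\<And>v w. v \<in> V \<Longrightarrow> w \<in> V \<Longrightarrow> g (v + w) = g v + g w"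
      "\<And>a v. v \<in> V \<Longrightarrow> g (cscale a v) = cnj a * g v"
  shows "\<exists>u\<in>V. \<forall>w\<in>V. ip w u = g w"
proof -
  have S: "cseq.subspace V" using V by (rule fd_space_subspace)
  obtain I b where b: "reduced_basis V I b" using reduced_basis_exists[OF V] by auto
  note R = reduced_basisD[OF b]
  note sq = inner_product_onD(1)[OF ip S]
  \<comment> \<open>The functional is disguised as a sesquilinear form, in order to reuse the
    expansion of forms in a basis. Evaluating the second slot at the constant sequence 1 gives back
    \<open>g\<close>.\<close>
  have g1: "sesquilinear_on V UNIV (\<lambda>v x. g v * x (0::nat))"
    unfolding sesquilinear_on_def by (auto simp: g cscale_apply algebra_simps)
  have expand: "g w = (\<Sum>i\<in>I. cnj (w i) * g (b i))" if w: "w \<in> V" for w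
    using sesquilinear_on_sum(1)[OF g1 S cseq.subspace_UNIV, where w="1" and I=I and b=b and a=w] R(3) R(5)[OF w]
    by simp
  have ipexpand: "ip w u = (\<Sum>i\<in>I. cnj (w i) * ip (b i) u)" if w: "w \<in> V" and u: "u \<in> V" for w u
    using sesquilinear_on_sum(1)[OF sq S S, where w="u" and I=I and b=b and a=w] R(3) R(5)[OF w] u
    by simp
  define T where "T v = (\<Sum>i\<in>I. cscale (ip (b i) v) (b i))" for v
  have TV: "T v \<in> V" and Ti: "\<And>i. i \<in> I \<Longrightarrow> T v i = ip (b i) v" for v
    unfolding T_def by (rule R | assumption)+
  have T: "clinear_on V V T"
    unfolding clinear_on_def
    by (auto simp: TV T_def sesquilinear_onD[OF sq] R cseq.scale_left_distrib sum.distrib cseq.scale_sum_right)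
  have "inj_on T V"
  proof (rule clinear_on_inj[OF T S])
    fix v assume v: "v \<in> V" "T v = 0"
    then have "ip (b i) v = 0" if "i \<in> I" for i using Ti[OF that, of v] by simp
    then have "ip v v = 0" using ipexpand[OF v(1) v(1)] by simp
    then show "v = 0" using inner_product_onD(4)[OF ip S v(1)] by simp
  qed
  then have "T ` V = V" by (rule clinear_on_inj_surj[OF V T])
  then obtain u where u: "u \<in> V" "T u = (\<Sum>i\<in>I. cscale (g (b i)) (b i))" using R(6)[of "\<lambda>i. g (b i)"] by force
  have "ip (b i) u = g (b i)" if "i \<in> I" for i
    using Ti[OF that, of u] u(2) R(7)[OF that] by simp
  then have "ip w u = g w" if "w \<in> V" for w
    using expand[OF that] ipexpand[OF that u(1)] by simp
  then show ?thesis using u(1) by blast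
qed

text \<open>The Riesz vector in \<open>E\<close> of the functional \<open>\<lambda>w. ip w v\<close>
  is the orthogonal projection of \<open>v\<close>.\<close>

lemma orthogonal_decomposition:
  assumes V: "fd_space V" and ip: "inner_product_on V ip" and E: "cseq.subspace E" "E \<subseteq> V"
    and v: "v \<in> V"
  shows "\<exists>e\<in>E. \<forall>w\<in>E. ip w (v - e) = 0"
proof -
  have S: "cseq.subspace V" using V by (rule fd_space_subspace)
  note sq = inner_product_onD(1)[OF ip S]
  obtain e where "e \<in> E" "\<forall>w\<in>E. ip w e = ip w v"
    using riesz_representation[OF fd_space_subset[OF V E] inner_product_on_subset[OF ip E(2)], of "\<lambda>w. ip w v"]
      sesquilinear_onD[OF sq] v E(2) by (metis subsetD)
  then show ?thesis
    using sesquilinear_on_diff(2)[OF sq S S] v E(2) by (intro bexI[of _ e]) (auto simp: subset_iff)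
qed

subsection \<open>The spectral theorem\<close>

text \<open>This is the first-order condition at the minimum \<open>t = 0\<close>. If
  \<open>a\<close> were nonzero, \<open>t = - a / d\<close> with
  \<open>d = \<bar>c\<bar> + 1\<close> would make the expression negative, because at that point the
  linear term outweighs the quadratic one.\<close>

lemma quadratic_nonneg_imp_zero:
  fixes a c :: real
  assumes "\<And>t. 2 * t * a + t\<^sup>2 * c \<ge> 0"
  shows "a = 0"
proof (rule ccontr)
  assume "a \<noteq> 0"
  define d where "d = \<bar>c\<bar> + 1"
  have d: "d > 0" "c < d" by (auto simp: d_def)
  have "2 * (- a / d) * a + (- a / d)\<^sup>2 * c = (a\<^sup>2 / d\<^sup>2) * (c - 2 * d)"
    using d by (simp add: power2_eq_square field_simps)
  moreover have "\<dots> < 0"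
    using d \<open>a \<noteq> 0\<close> by (intro mult_pos_neg) auto
  ultimately show False using assms[of "- a / d"] by linarith
qed

text \<open>The minimum of the Rayleigh quotient is an eigenvalue.\<close>

lemma rayleigh_eigenvector:
  assumes V: "fd_space V" and ip: "inner_product_on V ip" and H: "clinear_on V V H"
    and sym: "\<And>v w. v \<in> V \<Longrightarrow> w \<in> V \<Longrightarrow> ip (H v) w = ip v (H w)" and ne: "V \<noteq> {0}"
  obtains v and l :: real where "v \<in> V" "v \<noteq> 0" "H v = cscale (of_real l) v"
    "\<And>u. u \<in> V \<Longrightarrow> Re (ip u (H u)) \<ge> l * Re (ip u u)"
proof -
  have S: "cseq.subspace V" using V by (rule fd_space_subspace)
  note sq = inner_product_onD(1)[OF ip S]
  note sqD = sesquilinear_onD[OF sq] and SD = subspaceD[OF S] and HD = clinear_onD[OF H]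
  obtain I b where b: "reduced_basis V I b" using reduced_basis_exists[OF V] by auto
  let ?S = "unit_sphere V I"
  have SV: "?S \<subseteq> V" by (auto simp: unit_sphere_def)
  have comp: "compact ?S" using compact_unit_sphere[OF b] by (simp add: compactin_subtopology)
  obtain w where "w \<in> V" "w \<noteq> 0" using ne SD(1) by blast
  then have "?S \<noteq> {}" using unit_sphere_scale[OF b] by (metis empty_iff)
  have pos: "Re (ip u u) > 0" if "u \<in> ?S" for u
    using inner_product_onD(3)[OF ip S] unit_sphere_nonzero[OF that] by blast
  have id: "continuous_map (top_of_set ?S) (top_of_set V) (\<lambda>u. u)"
    using SV by (auto simp: continuous_map_in_subtopology)
  have "continuous_map (top_of_set ?S) euclidean (\<lambda>u. Re (ip u (H u)))"
    "continuous_map (top_of_set ?S) euclidean (\<lambda>u. Re (ip u u))"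
    by (intro continuous_map_Re continuous_map_sesquilinear[OF V V sq] continuous_map_clinear[OF V H] id)+
  then have "continuous_on ?S (\<lambda>u. Re (ip u (H u)) / Re (ip u u))"
    using pos by (intro continuous_on_divide) force+
  from continuous_attains_inf[OF comp \<open>?S \<noteq> {}\<close> this]
  obtain v where v: "v \<in> ?S"
    and min: "\<And>u. u \<in> ?S \<Longrightarrow> Re (ip v (H v)) / Re (ip v v) \<le> Re (ip u (H u)) / Re (ip u u)" by blast
  define l where "l = Re (ip v (H v)) / Re (ip v v)"
  have vV: "v \<in> V" "v \<noteq> 0" using unit_sphere_nonzero[OF v] by auto
  have lv: "Re (ip v (H v)) = l * Re (ip v v)" using pos[OF v] by (simp add: l_def)
  have ge: "Re (ip u (H u)) \<ge> l * Re (ip u u)" if u: "u \<in> V" for u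
  proof (cases "u = 0")
    case True
    then show ?thesis using sesquilinear_on_0[OF sq S S] clinear_on_0[OF H S] SD(1) by simp
  next
    case False
    obtain r s where rs: "r > 0" "s \<in> ?S" "u = cscale (of_real r) s"
      by (rule unit_sphere_scale[OF b u False])
    have s: "s \<in> V" "H s \<in> V" using rs SV HD by auto
    have "l * Re (ip s s) \<le> Re (ip s (H s))"
      using min[OF rs(2)] pos[OF rs(2)] by (simp add: l_def pos_le_divide_eq)
    then have "r\<^sup>2 * (l * Re (ip s s)) \<le> r\<^sup>2 * Re (ip s (H s))" by (simp add: mult_left_mono)
    moreover have "Re (ip u u) = r\<^sup>2 * Re (ip s s)" "Re (ip u (H u)) = r\<^sup>2 * Re (ip s (H s))"
      using rs(3) s SD by (simp_all add: sqD HD power2_eq_square)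
    ultimately show ?thesis by (simp add: algebra_simps)
  qed
  \<comment> \<open>The residual of the eigenvalue equation. Moving the minimizer \<open>v\<close>
    by \<open>t\<close> times \<open>w\<close> changes the nonnegative quantity
    \<open>Re (ip u (H u)) - l * Re (ip u u)\<close> from zero to a quadratic in \<open>t\<close>
    with linear coefficient \<open>2 * Re (ip w w)\<close>, so the residual vanishes.\<close>
  define w where "w = H v - cscale (of_real l) v"
  have w: "w \<in> V" unfolding w_def using vV HD SD by auto
  have Hv: "H v \<in> V" "H w \<in> V" "cscale (of_real l) v \<in> V" using vV w HD SD by auto
  have wHv: "Re (ip w (H v)) = l * Re (ip w v) + Re (ip w w)"
    using sesquilinear_on_diff(2)[OF sq S S w Hv(1) Hv(3)] vV w sqD(4)[OF w vV(1)] by (simp add: w_def)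
  have "Re (ip v (H w)) = Re (ip w (H v))"
    using arg_cong[OF sym[OF vV(1) w], of Re]
      arg_cong[OF inner_product_onD(2)[OF ip S w Hv(1)], of Re] by simp
  moreover have "Re (ip v w) = Re (ip w v)" using inner_product_onD(2)[OF ip S w vV(1)] by simp
  moreover note wHv
  ultimately have eq: "Re (ip (v + cscale (of_real t) w) (H (v + cscale (of_real t) w)))
      - l * Re (ip (v + cscale (of_real t) w) (v + cscale (of_real t) w))
    = 2 * t * Re (ip w w) + t\<^sup>2 * (Re (ip w (H w)) - l * Re (ip w w))" for t
    using vV w Hv SD lv by (simp add: sqD HD power2_eq_square algebra_simps del: plus_fun_apply)
  have "v + cscale (of_real t) w \<in> V" for t :: real using vV w SD by blast
  from ge[OF this] have "2 * t * Re (ip w w) + t\<^sup>2 * (Re (ip w (H w)) - l * Re (ip w w)) \<ge> 0" for t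
    using eq[of t] by (metis diff_ge_0_iff_ge)
  then have "Re (ip w w) = 0" by (rule quadratic_nonneg_imp_zero)
  then have "w = 0" using inner_product_onD(4)[OF ip S w] by simp
  then have "H v = cscale (of_real l) v" by (simp add: w_def)
  then show ?thesis using that vV ge by blast
qed

section \<open>Spans of eigenvectors selected by a condition on the eigenvalue\<close>

definition eig_span :: "vec set \<Rightarrow> (vec \<Rightarrow> vec) \<Rightarrow> (real \<Rightarrow> bool) \<Rightarrow> vec set" where
  "eig_span V H P = cseq.span {v \<in> V. \<exists>l::real. P l \<and> H v = cscale (of_real l) v}"

text \<open>The twist \<open>\<theta>\<close> of the scalars covers antilinear maps.\<close>

lemma eig_span_map:
  assumes V: "cseq.subspace V" and mem: "\<And>v. v \<in> V \<Longrightarrow> f v \<in> W"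
    and add: "\<And>v w. v \<in> V \<Longrightarrow> w \<in> V \<Longrightarrow> f (v + w) = f v + f w"
    and scale: "\<And>a v. v \<in> V \<Longrightarrow> f (cscale a v) = cscale (\<theta> a) (f v)"
    and \<theta>: "\<And>r::real. \<theta> (of_real r) = of_real r"
    and H: "\<And>v. v \<in> V \<Longrightarrow> H' (f v) = cscale (of_real k) (f (H v))"
    and PR: "\<And>l. P l \<Longrightarrow> R (k * l)" and v: "v \<in> eig_span V H P"
  shows "f v \<in> eig_span W H' R"
proof -
  let ?E = "eig_span W H' R"
  have E: "cseq.subspace ?E" by (simp add: eig_span_def)
  have f0: "f 0 = 0" using scale[OF subspaceD(1)[OF V], of 0] \<theta>[of 0] by simp
  have "eig_span V H P \<subseteq> {v \<in> V. f v \<in> ?E}"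
  proof (subst eig_span_def, rule cseq.span_minimal)
    show "{v \<in> V. \<exists>l. P l \<and> H v = cscale (of_real l) v} \<subseteq> {v \<in> V. f v \<in> ?E}"
    proof clarify
      fix v l assume v: "v \<in> V" and l: "P l" "H v = cscale (of_real l) v"
      have "H' (f v) = cscale (of_real (k * l)) (f v)" using H[OF v] scale[OF v] l(2) \<theta> by simp
      then show "f v \<in> ?E"
        unfolding eig_span_def using mem[OF v] PR[OF l(1)] by (intro cseq.span_base) blast
    qed
    show "cseq.subspace {v \<in> V. f v \<in> ?E}"
      using subspaceD[OF V] subspaceD[OF E] add scale f0 by (intro cseq.subspaceI) auto
  qed
  then show ?thesis using v by blast
qed

lemma eig_span_clinear:
  assumes f: "clinear_on V W f" and V: "cseq.subspace V"
    and H: "\<And>v. v \<in> V \<Longrightarrow> f (H v) = H' (f v)" and v: "v \<in> eig_span V H P"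
  shows "f v \<in> eig_span W H' P"
  by (rule eig_span_map[OF V clinear_onD[OF f], where k = 1]) (use H v in auto)

locale selfadjoint =
  fixes V :: "vec set" and ip :: "vec \<Rightarrow> vec \<Rightarrow> complex" and H :: "vec \<Rightarrow> vec"
  assumes fd: "fd_space V" and ip: "inner_product_on V ip" and H: "clinear_on V V H"
    and sym: "\<And>v w. v \<in> V \<Longrightarrow> w \<in> V \<Longrightarrow> ip (H v) w = ip v (H w)"
begin

lemma subV: "cseq.subspace V" using fd by (rule fd_space_subspace)
lemmas SD = subspaceD[OF subV] and HD = clinear_onD[OF H] and sq = inner_product_onD(1)[OF ip subV]
lemmas sqD = sesquilinear_onD[OF sq]

lemma eig_span_subset: "cseq.subspace (eig_span V H P)" "eig_span V H P \<subseteq> V"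
  unfolding eig_span_def by (auto intro: subsetD[OF cseq.span_minimal[OF _ subV], rotated])

lemma fd_eig_span: "fd_space (eig_span V H P)"
  by (rule fd_space_subset[OF fd eig_span_subset])

lemma eig_spanI: "v \<in> V \<Longrightarrow> P l \<Longrightarrow> H v = cscale (of_real l) v \<Longrightarrow> v \<in> eig_span V H P"
  unfolding eig_span_def by (rule cseq.span_base) blast

lemma eig_span_invariant:
  assumes "v \<in> eig_span V H P" shows "H v \<in> eig_span V H P"
  by (rule eig_span_clinear[OF H subV refl assms])

text \<open>Symmetry of \<open>H\<close> makes eigenvectors for different real eigenvalues
  orthogonal; orthogonality passes to the spans in one slot at a time.\<close>

lemma eig_span_orthogonal:
  assumes PQ: "\<And>l m. P l \<Longrightarrow> R m \<Longrightarrow> l \<noteq> m" and v: "v \<in> eig_span V H P" and w: "w \<in> eig_span V H R"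
  shows "ip v w = 0"
proof -
  let ?A = "\<lambda>P. {v \<in> V. \<exists>l::real. P l \<and> H v = cscale (of_real l) v}"
  have *: "ip x y = 0" if x: "x \<in> ?A P" and y: "y \<in> ?A R" for x y
  proof -
    obtain l m where lm: "P l" "H x = cscale (of_real l) x" "R m" "H y = cscale (of_real m) y"
      and V: "x \<in> V" "y \<in> V" using x y by blast
    have "of_real l * ip x y = of_real m * ip x y" using sym[OF V] lm V by (simp add: sqD)
    then show ?thesis using PQ[OF lm(1,3)] by simp
  qed
  have **: "ip x y = 0" if x: "x \<in> ?A P" and y: "y \<in> eig_span V H R" for x y
  proof -
    have "cseq.subspace {y \<in> V. ip x y = 0}"
      using x SD by (intro cseq.subspaceI) (auto simp: sqD sesquilinear_on_0[OF sq subV subV])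
    then have "eig_span V H R \<subseteq> {y \<in> V. ip x y = 0}"
      unfolding eig_span_def using *[OF x] by (intro cseq.span_minimal) auto
    then show ?thesis using y by blast
  qed
  have wV: "w \<in> V" using w eig_span_subset(2) by blast
  then have "cseq.subspace {x \<in> V. ip x w = 0}"
    using SD by (intro cseq.subspaceI) (auto simp: sqD sesquilinear_on_0[OF sq subV subV])
  then have "eig_span V H P \<subseteq> {x \<in> V. ip x w = 0}"
    unfolding eig_span_def[of V H P] using **[OF _ w] by (intro cseq.span_minimal) auto
  then show ?thesis using v by blast
qed

text \<open>The orthogonal complement \<open>U\<close> of the span of all eigenvectors is invariant
  under \<open>H\<close>. If it were nonzero it would contain an eigenvector, which would be
  orthogonal to itself.\<close>

lemma eig_span_all: "eig_span V H (\<lambda>_. True) = V"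
proof -
  let ?E = "eig_span V H (\<lambda>_. True)"
  define U where "U = {r \<in> V. \<forall>w\<in>?E. ip w r = 0}"
  note E = eig_span_subset[of "\<lambda>_. True"]
  have EV: "w \<in> V" if "w \<in> ?E" for w using that E by blast
  have U: "cseq.subspace U"
    unfolding U_def using SD EV
    by (intro cseq.subspaceI) (auto simp: sqD sesquilinear_on_0[OF sq subV subV])
  have UV: "U \<subseteq> V" by (auto simp: U_def)
  have "U = {0}"
  proof (rule ccontr)
    assume ne: "U \<noteq> {0}"
    have "H r \<in> U" if "r \<in> U" for r
      using that eig_span_invariant EV by (auto simp: U_def HD simp flip: sym)
    then have HU: "clinear_on U U H" by (rule clinear_on_subset[OF H UV])
    obtain x l where x: "x \<in> U" "x \<noteq> 0" "H x = cscale (of_real l) x"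
      by (rule rayleigh_eigenvector[OF fd_space_subset[OF fd U UV] inner_product_on_subset[OF ip UV] HU _ ne])
        (use sym UV in \<open>auto simp: subset_iff\<close>)
    then have "x \<in> ?E" using UV by (intro eig_spanI) auto
    then have "ip x x = 0" using x(1) by (simp add: U_def)
    then show False using inner_product_onD(4)[OF ip subV, of x] x UV by auto
  qed
  have "v \<in> ?E" if v: "v \<in> V" for v
  proof -
    obtain e where e: "e \<in> ?E" "\<forall>w\<in>?E. ip w (v - e) = 0"
      using orthogonal_decomposition[OF fd ip E v] by blast
    then have "v - e \<in> U" using v EV SD by (auto simp: U_def)
    then show ?thesis using e \<open>U = {0}\<close> by simp
  qed
  then show ?thesis using E by blast
qed

text \<open>An element of the span is a sum of eigenvectors for several eigenvalues, so its sign is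
  not immediate. The minimum of the Rayleigh quotient on the span is again an eigenvalue; were it
  not positive, its eigenvector would also lie in a span orthogonal to this one and so be orthogonal
  to itself.\<close>

lemma eig_span_pos:
  assumes v: "v \<in> eig_span V H (\<lambda>l. l > 0)" "v \<noteq> 0"
  shows "Re (ip v (H v)) > 0"
proof -
  let ?E = "eig_span V H (\<lambda>l. l > 0)"
  note E = eig_span_subset[of "\<lambda>l. l > 0"]
  have EV: "w \<in> V" if "w \<in> ?E" for w using that E by blast
  have HE: "clinear_on ?E ?E H"
    using eig_span_invariant by (rule clinear_on_subset[OF H E(2)])
  obtain x l where x: "x \<in> ?E" "x \<noteq> 0" "H x = cscale (of_real l) x"
    and min: "\<And>u. u \<in> ?E \<Longrightarrow> Re (ip u (H u)) \<ge> l * Re (ip u u)"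
    by (rule rayleigh_eigenvector[OF fd_eig_span inner_product_on_subset[OF ip E(2)] HE])
      (use sym EV v in auto)
  have "l > 0"
  proof (rule ccontr)
    assume "\<not> l > 0"
    then have "x \<in> eig_span V H (\<lambda>l. \<not> l > 0)" using x EV by (intro eig_spanI) auto
    then have "ip x x = 0" using eig_span_orthogonal[of "\<lambda>l. l > 0" "\<lambda>l. \<not> l > 0" x x] x(1) by blast
    then show False using inner_product_onD(4)[OF ip subV EV[OF x(1)]] x by simp
  qed
  then have "0 < l * Re (ip v v)" using inner_product_onD(3)[OF ip subV EV[OF v(1)] v(2)] by simp
  then show ?thesis using min[OF v(1)] by simp
qed

text \<open>The positive case applied to the negative of \<open>H\<close>.\<close>

lemma eig_span_neg:
  assumes v: "v \<in> eig_span V H (\<lambda>l. l < 0)" "v \<noteq> 0"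
  shows "Re (ip v (H v)) < 0"
proof -
  have vV: "v \<in> V" using v eig_span_subset by blast
  let ?H = "\<lambda>v. cscale (-1) (H v)"
  interpret N: selfadjoint V ip ?H
  proof
    show "clinear_on V V ?H"
      using HD cseq.subspace_neg[OF subV] by (auto simp: clinear_on_def cseq.scale_right_distrib mult.commute)
  qed (use fd ip sym HD in \<open>auto simp: sqD simp del: cseq.scale_minus_left\<close>)
  have "{v \<in> V. \<exists>l::real. l < 0 \<and> H v = cscale (of_real l) v} \<subseteq> {v \<in> V. \<exists>l::real. l > 0 \<and> ?H v = cscale (of_real l) v}"
    by safe (rule_tac x="-l" in exI, simp)
  then have "eig_span V H (\<lambda>l. l < 0) \<subseteq> eig_span V ?H (\<lambda>l. l > 0)"
    unfolding eig_span_def by (rule cseq.span_mono)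
  then have "Re (ip v (?H v)) > 0" using v N.eig_span_pos by blast
  then show ?thesis using vV HD by (simp add: sqD del: cseq.scale_minus_left)
qed

text \<open>The two spans meet only in zero, as the quadratic form of \<open>H\<close> is positive
  on one and negative on the other. They fill \<open>V\<close> because injectivity excludes the
  eigenvalue zero.\<close>

lemma eig_span_graded:
  assumes inj: "inj_on H V"
  shows "graded_by V (eig_span V H (\<lambda>l. l > 0)) (eig_span V H (\<lambda>l. l < 0))"
    (is "graded_by V ?A ?B")
  unfolding graded_by_def
proof (intro conjI)
  show "cseq.subspace ?A" "cseq.subspace ?B" by (rule eig_span_subset)+
  have "v = 0" if "v \<in> ?A" "v \<in> ?B" for v
    using eig_span_pos[OF that(1)] eig_span_neg[OF that(2)] by force
  then show "?A \<inter> ?B = {0}" using subspaceD(1) eig_span_subset(1) by blast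
  let ?S = "\<lambda>P. {v \<in> V. \<exists>l::real. P l \<and> H v = cscale (of_real l) v}"
  have "?S (\<lambda>_. True) \<subseteq> cseq.span (?S (\<lambda>l. l > 0) \<union> ?S (\<lambda>l. l < 0))"
  proof
    fix v assume "v \<in> ?S (\<lambda>_. True)"
    then obtain l where l: "v \<in> V" "H v = cscale (of_real l) v" by blast
    show "v \<in> cseq.span (?S (\<lambda>l. l > 0) \<union> ?S (\<lambda>l. l < 0))"
    proof (cases "l = 0")
      case True
      then have "H v = H 0" using l clinear_on_0[OF H subV] by simp
      then have "v = 0" using inj l SD(1) by (auto dest: inj_onD)
      then show ?thesis by (simp add: cseq.span_zero)
    next
      case False
      then have "l > 0 \<or> l < 0" by auto
      then show ?thesis using l by (intro cseq.span_base) blast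
    qed
  qed
  then have "cseq.span (?S (\<lambda>_. True)) \<subseteq> cseq.span (?S (\<lambda>l. l > 0) \<union> ?S (\<lambda>l. l < 0))"
    by (rule cseq.span_minimal[OF _ cseq.subspace_span])
  then have "V \<subseteq> cseq.span (?S (\<lambda>l. l > 0) \<union> ?S (\<lambda>l. l < 0))"
    using eig_span_all by (simp add: eig_span_def)
  also have "\<dots> = {a + b |a b. a \<in> ?A \<and> b \<in> ?B}" unfolding cseq.span_Un eig_span_def by simp
  finally show "V = {a + b |a b. a \<in> ?A \<and> b \<in> ?B}" using eig_span_subset(2) SD(2) by blast
qed

end

subsection \<open>Gradings\<close>

text \<open>The projection onto \<open>A\<close> along \<open>B\<close>. For \<open>v\<close> in a
  space graded by \<open>A\<close> and \<open>B\<close> the choice is unique.\<close>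

definition gproj :: "vec set \<Rightarrow> vec set \<Rightarrow> vec \<Rightarrow> vec" where
  "gproj A B v = (SOME a. a \<in> A \<and> v - a \<in> B)"

lemma graded_byD:
  assumes "graded_by V A B"
  shows "cseq.subspace A" "cseq.subspace B" "A \<inter> B = {0}" "A \<subseteq> V" "B \<subseteq> V"
    "\<And>a b. a \<in> A \<Longrightarrow> b \<in> B \<Longrightarrow> a + b \<in> V"
proof -
  show A: "cseq.subspace A" and B: "cseq.subspace B" and "A \<inter> B = {0}"
    using assms by (auto simp: graded_by_def)
  have V: "V = {a + b |a b. a \<in> A \<and> b \<in> B}" using assms by (auto simp: graded_by_def)
  show "A \<subseteq> V"
  proof
    fix a assume "a \<in> A"
    then show "a \<in> V" unfolding V using subspaceD(1)[OF B]
      by (intro CollectI exI[of _ a] exI[of _ 0]) simp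
  qed
  show "B \<subseteq> V"
  proof
    fix b assume "b \<in> B"
    then show "b \<in> V" unfolding V using subspaceD(1)[OF A]
      by (intro CollectI exI[of _ 0] exI[of _ b]) simp
  qed
  show "\<And>a b. a \<in> A \<Longrightarrow> b \<in> B \<Longrightarrow> a + b \<in> V" unfolding V by blast
qed

lemma graded_by_commute:
  assumes "graded_by V A B" shows "graded_by V B A"
proof -
  have "{a + b |a b. a \<in> A \<and> b \<in> B} = {b + a |b a. b \<in> B \<and> a \<in> A}"
    by (metis (no_types, opaque_lifting) add.commute)
  then show ?thesis using assms by (simp add: graded_by_def Int_commute)
qed

lemma gproj_mem:
  assumes g: "graded_by V A B" and v: "v \<in> V"
  shows "gproj A B v \<in> A" "v - gproj A B v \<in> B"
proof -
  obtain a b where "a \<in> A" "b \<in> B" "v = a + b" using assms by (auto simp: graded_by_def)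
  then have "a \<in> A \<and> v - a \<in> B" by simp
  then have "gproj A B v \<in> A \<and> v - gproj A B v \<in> B"
    unfolding gproj_def
    by (rule someI[of "\<lambda>a. a \<in> A \<and> v - a \<in> B"])
  then show "gproj A B v \<in> A" "v - gproj A B v \<in> B" by auto
qed

lemma graded_by_unique:
  assumes g: "graded_by V A B" and "a \<in> A" "a' \<in> A" "b \<in> B" "b' \<in> B" "a + b = a' + b'"
  shows "a = a'" "b = b'"
proof -
  note G = graded_byD[OF g]
  have "a - a' = b' - b" using assms(6) by (simp add: algebra_simps)
  moreover have "a - a' \<in> A" "b' - b \<in> B"
    using assms subspaceD(4)[OF G(1)] subspaceD(4)[OF G(2)] by auto
  ultimately have "a - a' = 0" using G(3) by (metis IntI singletonD)
  then show "a = a'" "b = b'" using assms(6) by auto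
qed

lemma gproj_add:
  assumes g: "graded_by V A B" and ab: "a \<in> A" "b \<in> B"
  shows "gproj A B (a + b) = a"
  using graded_by_unique(1)[OF g gproj_mem(1)[OF g] ab(1) gproj_mem(2)[OF g] ab(2)]
    graded_byD(6)[OF g ab] by simp

lemma gproj_id:
  assumes g: "graded_by V A B"
  shows "a \<in> A \<Longrightarrow> gproj A B a = a" "b \<in> B \<Longrightarrow> gproj A B b = 0"
  using gproj_add[OF g, of a 0] gproj_add[OF g, of 0 b] graded_byD[OF g] subspaceD(1) by auto

lemma gproj_commute:
  assumes g: "graded_by V A B" and v: "v \<in> V"
  shows "gproj B A v = v - gproj A B v"
  using gproj_add[OF graded_by_commute[OF g] gproj_mem(2)[OF g v] gproj_mem(1)[OF g v]] by simp

text \<open>Additivity is enough to push the decomposition of \<open>v\<close> forward, so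
  antilinear maps are covered. Odd maps are covered by listing the target grading in exchanged
  order.\<close>

lemma gproj_map:
  assumes g: "graded_by V A B" and g': "graded_by V' A' B'" and v: "v \<in> V"
    and add: "\<And>v w. v \<in> V \<Longrightarrow> w \<in> V \<Longrightarrow> f (v + w) = f v + f w"
    and A: "\<And>a. a \<in> A \<Longrightarrow> f a \<in> A'" and B: "\<And>b. b \<in> B \<Longrightarrow> f b \<in> B'"
  shows "gproj A' B' (f v) = f (gproj A B v)"
proof -
  have m: "gproj A B v \<in> A" "v - gproj A B v \<in> B" using gproj_mem[OF g v] by auto
  have "f v = f (gproj A B v) + f (v - gproj A B v)"
    using add[OF subsetD[OF graded_byD(4)[OF g] m(1)] subsetD[OF graded_byD(5)[OF g] m(2)]] by simp
  then show ?thesis using gproj_add[OF g' A[OF m(1)] B[OF m(2)]] by simp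
qed

lemma clinear_on_gproj:
  assumes g: "graded_by V A B"
  shows "clinear_on V A (gproj A B)"
proof -
  note A = subspaceD[OF graded_byD(1)[OF g]] and B = subspaceD[OF graded_byD(2)[OF g]]
  have "gproj A B (v + w) = gproj A B v + gproj A B w" if "v \<in> V" "w \<in> V" for v w
  proof -
    have "(v - gproj A B v) + (w - gproj A B w) \<in> B" "gproj A B v + gproj A B w \<in> A"
      by (intro A B gproj_mem[OF g] that)+
    moreover have "(gproj A B v + gproj A B w) + ((v - gproj A B v) + (w - gproj A B w)) = v + w"
      by (simp add: algebra_simps)
    ultimately show ?thesis using gproj_add[OF g] by metis
  qed
  moreover have "gproj A B (cscale a v) = cscale a (gproj A B v)" if "v \<in> V" for a v
  proof -
    have "cscale a (gproj A B v) \<in> A" "cscale a (v - gproj A B v) \<in> B"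
      by (intro A B gproj_mem[OF g] that)+
    moreover have "cscale a (gproj A B v) + cscale a (v - gproj A B v) = cscale a v"
      by (simp flip: cseq.scale_right_distrib)
    ultimately show ?thesis using gproj_add[OF g] by metis
  qed
  ultimately show ?thesis using gproj_mem[OF g] by (auto simp: clinear_on_def)
qed

text \<open>An element of \<open>A'\<close> splits into parts in \<open>A\<close> and
  \<open>B\<close>. Since these lie in \<open>A'\<close> and \<open>B'\<close>, uniqueness of the
  larger decomposition makes the second part zero. The lemma reduces an identification of gradings
  to two inclusions.\<close>

lemma graded_by_eq:
  assumes g: "graded_by V A B" and g': "graded_by V A' B'" and sub: "A \<subseteq> A'" "B \<subseteq> B'"
  shows "A' = A" "B' = B"
proof -
  have "A' \<subseteq> A" if g: "graded_by V A B" and g': "graded_by V A' B'" and "A \<subseteq> A'" "B \<subseteq> B'" for A B A' B'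
  proof
    fix v assume v: "v \<in> A'"
    then have "v \<in> V" using graded_byD(4)[OF g'] by blast
    note m = gproj_mem[OF g this]
    have "v = gproj A B v"
      using m that(3,4) v subspaceD(1)[OF graded_byD(2)[OF g']]
      by (intro graded_by_unique(1)[OF g', of v _ 0 "v - gproj A B v"]) auto
    then show "v \<in> A" using m(1) by simp
  qed
  from this[OF g g' sub] this[OF graded_by_commute[OF g] graded_by_commute[OF g'] sub(2,1)]
  show "A' = A" "B' = B" using sub by auto
qed

text \<open>The involution that is 1 on \<open>A\<close> and -1 on \<open>B\<close>. For the
  spectral subspaces of an invertible self-adjoint operator it is the sign of that operator, its
  flattening.\<close>

definition grading :: "vec set \<Rightarrow> vec set \<Rightarrow> vec \<Rightarrow> vec" where
  "grading A B v = gproj A B v - gproj B A v"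

lemma gproj_both:
  assumes g: "graded_by V A B" and v: "v \<in> V"
  shows "gproj A B v \<in> A" "gproj A B v \<in> V" "gproj B A v \<in> B" "gproj B A v \<in> V"
    "gproj A B v + gproj B A v = v"
  using gproj_mem[OF g v] gproj_mem[OF graded_by_commute[OF g] v] gproj_commute[OF g v]
    graded_byD(4,5)[OF g] by auto

lemma grading_hom:
  assumes g: "graded_by V A B"
  shows "a \<in> A \<Longrightarrow> grading A B a = a" "b \<in> B \<Longrightarrow> grading A B b = - b"
  using gproj_id[OF g] gproj_id[OF graded_by_commute[OF g]] by (simp_all add: grading_def)

lemma clinear_on_grading:
  assumes g: "graded_by V A B" and V: "cseq.subspace V"
  shows "clinear_on V V (grading A B)"
proof -
  note pD = clinear_onD[OF clinear_on_gproj[OF g]]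
    and nD = clinear_onD[OF clinear_on_gproj[OF graded_by_commute[OF g]]]
  have "grading A B v \<in> V" if "v \<in> V" for v
    unfolding grading_def using gproj_both[OF g that] subspaceD(4)[OF V] by blast
  then show ?thesis
    unfolding clinear_on_def by (auto simp: grading_def pD nD cseq.scale_right_diff_distrib)
qed

lemma grading_involution:
  assumes g: "graded_by V A B" and V: "cseq.subspace V" and v: "v \<in> V"
  shows "grading A B (grading A B v) = v"
proof -
  note p = gproj_both[OF g v]
  have "grading A B (grading A B v) = grading A B (gproj A B v) - grading A B (gproj B A v)"
    unfolding grading_def[of A B v] by (rule clinear_on_diff[OF clinear_on_grading[OF g V] V p(2,4)])
  then show ?thesis using p grading_hom[OF g] by simp
qed

text \<open>By orthogonality of \<open>A\<close> and \<open>B\<close>, both sides equal the pairing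
  of the \<open>A\<close>-parts minus the pairing of the \<open>B\<close>-parts.\<close>

lemma grading_symmetric:
  assumes g: "graded_by V A B" and V: "cseq.subspace V" and sq: "sesquilinear_on V V ip"
    and orth: "\<And>v w. v \<in> A \<and> w \<in> B \<or> v \<in> B \<and> w \<in> A \<Longrightarrow> ip v w = 0"
    and v: "v \<in> V" and w: "w \<in> V"
  shows "ip (grading A B v) w = ip v (grading A B w)"
proof -
  note d = sesquilinear_on_diff[OF sq V V] and sqD = sesquilinear_onD[OF sq]
    and pv = gproj_both[OF g v] and pw = gproj_both[OF g w]
  let ?p = "gproj A B" and ?n = "gproj B A"
  have "ip (?p v) w = ip (?p v) (?p w)" "ip (?n v) w = ip (?n v) (?n w)"
    using sqD(3)[OF pv(2) pw(2) pw(4)] sqD(3)[OF pv(4) pw(2) pw(4)] orth pv pw by simp_all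
  moreover have "ip v (?p w) = ip (?p v) (?p w)" "ip v (?n w) = ip (?n v) (?n w)"
    using sqD(1)[OF pv(2) pv(4) pw(2)] sqD(1)[OF pv(2) pv(4) pw(4)] orth pv pw by simp_all
  ultimately show ?thesis
    unfolding grading_def using d(1)[OF pv(2) pv(4) w] d(2)[OF v pw(2) pw(4)] by simp
qed

subsection \<open>The representation underlying a gapped system\<close>

definition rep_of :: "'h gapped \<Rightarrow> 'h graded_rep" where
  "rep_of S = \<lparr>rspace = sspace S, reven = pos_space S, rodd = neg_space S, ract = sact S\<rparr>"

lemma rep_of_simps [simp]:
  "rspace (rep_of S) = sspace S" "reven (rep_of S) = pos_space S" "rodd (rep_of S) = neg_space S"
  "ract (rep_of S) = sact S"
  by (simp_all add: rep_of_def)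

lemma pos_space_eig: "pos_space S = eig_span (sspace S) (sham S) (\<lambda>l. l > 0)"
  and neg_space_eig: "neg_space S = eig_span (sspace S) (sham S) (\<lambda>l. l < 0)"
  by (simp_all add: pos_space_def neg_space_def eig_span_def)

text \<open>The sign \<open>e\<close> is a number so that it can be multiplied: a group element
  \<open>x\<close> carries the space of sign \<open>e\<close> into that of sign
  \<open>gr x * e\<close>. Even and odd parts are then treated by one argument.\<close>

definition sgn_space :: "'h gapped \<Rightarrow> real \<Rightarrow> vec set" where
  "sgn_space S e = eig_span (sspace S) (sham S) (\<lambda>l. e * l > 0)"

lemma sgn_space_simps: "sgn_space S 1 = pos_space S" "sgn_space S (-1) = neg_space S"
  by (simp_all add: sgn_space_def pos_space_eig neg_space_eig)

definition sgn_proj :: "'h gapped \<Rightarrow> real \<Rightarrow> vec \<Rightarrow> vec" where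
  "sgn_proj S e = gproj (sgn_space S e) (sgn_space S (-e))"

subsection \<open>Twisted actions\<close>

text \<open>The effect on scalars of an element with sign \<open>s\<close>, where only the values 1
  and -1 matter. It lets linear and antilinear elements share their formulas.\<close>

definition twist :: "int \<Rightarrow> complex \<Rightarrow> complex" where
  "twist s a = (if s = 1 then a else cnj a)"

lemma twist_simps [simp]:
  "twist s (a + b) = twist s a + twist s b" "twist s (a * b) = twist s a * twist s b"
  "twist s (a - b) = twist s a - twist s b"
  "twist s (twist s a) = a" "twist s (of_real r) = of_real r" "cmod (twist s a) = cmod a"
  "twist s (cnj a) = cnj (twist s a)" "Re (twist s a) = Re a" "twist s 0 = 0" "twist s 1 = 1"
  "twist s (of_int k) = of_int k" "twist s (numeral n) = numeral n" "twist s (a / b) = twist s a / twist s b"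
  by (auto simp: twist_def)

locale qm =
  fixes Q :: "('g, 'h) qm_class"
  assumes ext: "extended_qm_class Q"
begin

abbreviation "Gt \<equiv> qext Q"
abbreviation "ph \<equiv> qphi_ext Q"
abbreviation "gr \<equiv> qc_ext Q"

lemma top_group: "topological_group Gt" and base_top_group: "topological_group (qbase Q)"
  using ext by (auto simp: extended_qm_class_def lie_group_def)

lemma group_Gt: "group Gt" and topspace_Gt [simp]: "topspace (gtop Gt) = carrier Gt"
  using top_group by (auto simp: topological_group_def)

lemma signs: "g \<in> carrier Gt \<Longrightarrow> ph g = 1 \<or> ph g = -1" "g \<in> carrier Gt \<Longrightarrow> gr g = 1 \<or> gr g = -1"
proof -
  assume g: "g \<in> carrier Gt"
  have "qproj Q g \<in> carrier (qbase Q)"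
    using ext g by (auto simp: extended_qm_class_def hom_def)
  moreover have "qphi Q \<in> hom (qbase Q) sign_img" "qc Q \<in> hom (qbase Q) sign_img"
    using ext by (auto simp: extended_qm_class_def)
  ultimately have "qphi Q (qproj Q g) \<in> carrier sign_img" "qc Q (qproj Q g) \<in> carrier sign_img"
    by (auto simp: hom_def)
  then show "ph g = 1 \<or> ph g = -1" "gr g = 1 \<or> gr g = -1"
    by (auto simp: sign_img_def qphi_ext_def qc_ext_def)
qed

lemma twisted_actionD:
  assumes "twisted_action Q V \<rho>"
  shows "\<And>g v. g \<in> carrier Gt \<Longrightarrow> v \<in> V \<Longrightarrow> \<rho> g v \<in> V"
    "\<And>g v w. g \<in> carrier Gt \<Longrightarrow> v \<in> V \<Longrightarrow> w \<in> V \<Longrightarrow> \<rho> g (v + w) = \<rho> g v + \<rho> g w"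
    "\<And>g a v. g \<in> carrier Gt \<Longrightarrow> v \<in> V \<Longrightarrow> \<rho> g (cscale a v) = cscale (twist (ph g) a) (\<rho> g v)"
    "\<And>g h v. g \<in> carrier Gt \<Longrightarrow> h \<in> carrier Gt \<Longrightarrow> v \<in> V \<Longrightarrow> \<rho> (g \<otimes>\<^bsub>Gt\<^esub> h) v = \<rho> g (\<rho> h v)"
    "\<And>g v. g \<in> carrier Gt \<Longrightarrow> v \<in> V \<Longrightarrow> \<rho> (inv\<^bsub>Gt\<^esub> g) (\<rho> g v) = v"
    "\<And>g v. g \<in> carrier Gt \<Longrightarrow> v \<in> V \<Longrightarrow> \<rho> g (\<rho> (inv\<^bsub>Gt\<^esub> g) v) = v"
    "\<And>g. g \<in> carrier Gt \<Longrightarrow> real_linear_on V (\<rho> g)"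
    "\<And>v. v \<in> V \<Longrightarrow> continuous_map (gtop Gt) (top_of_set V) (\<lambda>g. \<rho> g v)"
    "\<And>g. g \<in> carrier Gt \<Longrightarrow> bij_betw (\<rho> g) V V"
proof -
  interpret G: group Gt by (rule group_Gt)
  have lin: "ph g = 1 \<Longrightarrow> clinear_on V V (\<rho> g)" "ph g = -1 \<Longrightarrow> antilinear_on V V (\<rho> g)"
    if "g \<in> carrier Gt" for g
    using assms that by (auto simp: twisted_action_def)
  show mem: "\<rho> g v \<in> V" if g: "g \<in> carrier Gt" and "v \<in> V" for g v
    using lin[OF g] signs(1)[OF g] that clinear_onD(1) antilinear_onD(1) by metis
  show "\<rho> g (v + w) = \<rho> g v + \<rho> g w" if g: "g \<in> carrier Gt" and "v \<in> V" "w \<in> V" for g v w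
    using lin[OF g] signs(1)[OF g] that clinear_onD(2) antilinear_onD(2) by metis
  show "\<rho> g (cscale a v) = cscale (twist (ph g) a) (\<rho> g v)" if g: "g \<in> carrier Gt" and v: "v \<in> V" for g v a
  proof (cases "ph g = 1")
    case True
    then show ?thesis using clinear_onD(3)[OF lin(1)[OF g True] v] by (simp add: twist_def)
  next
    case False
    then have "ph g = -1" using signs(1)[OF g] by simp
    then show ?thesis using antilinear_onD(3)[OF lin(2)[OF g] v] by (simp add: twist_def)
  qed
  show "real_linear_on V (\<rho> g)" if g: "g \<in> carrier Gt" for g
    using lin[OF g] signs(1)[OF g] clinear_on_real_linear antilinear_on_real_linear by metis
  show mult: "\<rho> (g \<otimes>\<^bsub>Gt\<^esub> h) v = \<rho> g (\<rho> h v)" if "g \<in> carrier Gt" "h \<in> carrier Gt" "v \<in> V" for g h v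
    using assms that by (auto simp: twisted_action_def)
  show bij: "bij_betw (\<rho> g) V V" if "g \<in> carrier Gt" for g
    using assms that by (auto simp: twisted_action_def)
  \<comment> \<open>The identity of the group acts by an injective idempotent map.\<close>
  have one: "\<rho> \<one>\<^bsub>Gt\<^esub> v = v" if v: "v \<in> V" for v
  proof -
    have "\<rho> \<one>\<^bsub>Gt\<^esub> (\<rho> \<one>\<^bsub>Gt\<^esub> v) = \<rho> \<one>\<^bsub>Gt\<^esub> v" using mult[OF G.one_closed G.one_closed v] by simp
    then show ?thesis
      using bij_betw_imp_inj_on[OF bij[OF G.one_closed]] mem[OF G.one_closed v] v by (auto dest: inj_onD)
  qed
  show "\<rho> (inv\<^bsub>Gt\<^esub> g) (\<rho> g v) = v" if "g \<in> carrier Gt" "v \<in> V" for g v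
    using mult[of "inv\<^bsub>Gt\<^esub> g" g v] that one by (simp add: G.l_inv)
  show "\<rho> g (\<rho> (inv\<^bsub>Gt\<^esub> g) v) = v" if "g \<in> carrier Gt" "v \<in> V" for g v
    using mult[of g "inv\<^bsub>Gt\<^esub> g" v] that one by (simp add: G.r_inv)
  show "continuous_map (gtop Gt) (top_of_set V) (\<lambda>g. \<rho> g v)" if "v \<in> V" for v
    using assms that by (auto simp: twisted_action_def)
qed

lemma continuous_map_action:
  assumes V: "fd_space V" and act: "twisted_action Q V \<rho>"
    and g: "continuous_map X (gtop Gt) g" and a: "continuous_map X (top_of_set V) a"
  shows "continuous_map X (top_of_set V) (\<lambda>x. \<rho> (g x) (a x))"
proof -
  note A = twisted_actionD[OF act]
  have gx: "g x \<in> carrier Gt" "a x \<in> V" if "x \<in> topspace X" for x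
    using continuous_map_image_subset_topspace[OF g] a that
    by (auto simp: continuous_map_in_subtopology)
  have "continuous_map X euclidean (\<lambda>x. \<rho> (g x) (a x))"
  proof (rule continuous_map_real_linear_family[OF V _ _ a])
    show "continuous_map X euclidean (\<lambda>x. \<rho> (g x) v)" if "v \<in> V" for v
      using continuous_map_compose[OF g A(8)[OF that]]
      by (simp add: continuous_map_in_subtopology comp_def)
  qed (use A(7) gx in blast)
  then show ?thesis using gx A(1) by (auto simp: continuous_map_in_subtopology)
qed

subsection \<open>Isomorphism of representations\<close>

lemma twisted_repD:
  assumes "twisted_rep Q E"
  shows "fd_space (rspace E)" "graded_by (rspace E) (reven E) (rodd E)"
    "twisted_action Q (rspace E) (ract E)" "cseq.subspace (rspace E)"
    "\<And>g v. g \<in> carrier Gt \<Longrightarrow> gr g = 1 \<Longrightarrow> v \<in> reven E \<Longrightarrow> ract E g v \<in> reven E"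
    "\<And>g v. g \<in> carrier Gt \<Longrightarrow> gr g = 1 \<Longrightarrow> v \<in> rodd E \<Longrightarrow> ract E g v \<in> rodd E"
    "\<And>g v. g \<in> carrier Gt \<Longrightarrow> gr g = -1 \<Longrightarrow> v \<in> reven E \<Longrightarrow> ract E g v \<in> rodd E"
    "\<And>g v. g \<in> carrier Gt \<Longrightarrow> gr g = -1 \<Longrightarrow> v \<in> rodd E \<Longrightarrow> ract E g v \<in> reven E"
  using assms fd_space_subspace unfolding twisted_rep_def by (auto simp: Pi_iff)

text \<open>An even element commutes with the projections to the two parts, while an odd one
  exchanges them, which reverses the sign of their difference.\<close>

lemma grading_commute:
  assumes E: "twisted_rep Q E" and x: "x \<in> carrier Gt" and v: "v \<in> rspace E"
  shows "ract E x (grading (reven E) (rodd E) v) =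
    cscale (of_int (gr x)) (grading (reven E) (rodd E) (ract E x v))"
proof -
  note ED = twisted_repD[OF E] and R = twisted_actionD[OF twisted_repD(3)[OF E]]
  note g = ED(2) and g' = graded_by_commute[OF ED(2)]
  note p = gproj_both[OF g v]
  let ?p = "gproj (reven E) (rodd E)" and ?n = "gproj (rodd E) (reven E)" and ?\<rho> = "ract E"
  have "?\<rho> x (?p v) = ?\<rho> x (?p v - ?n v) + ?\<rho> x (?n v)"
    using R(2)[OF x subspaceD(4)[OF ED(4) p(2) p(4)] p(4)] by (simp del: plus_fun_apply)
  then have *: "?\<rho> x (grading (reven E) (rodd E) v) = ?\<rho> x (?p v) - ?\<rho> x (?n v)"
    by (simp add: grading_def)
  show ?thesis
  proof (cases "gr x = 1")
    case True
    have "?p (?\<rho> x v) = ?\<rho> x (?p v)" "?n (?\<rho> x v) = ?\<rho> x (?n v)"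
      using ED(5,6)[OF x True] R(2)[OF x]
      by (intro gproj_map[OF g g v] gproj_map[OF g' g' v]; blast)+
    then show ?thesis using True * by (simp add: grading_def)
  next
    case False
    then have m: "gr x = -1" using signs(2)[OF x] by auto
    have "?n (?\<rho> x v) = ?\<rho> x (?p v)" "?p (?\<rho> x v) = ?\<rho> x (?n v)"
      using ED(7,8)[OF x m] R(2)[OF x]
      by (intro gproj_map[OF g g' v] gproj_map[OF g' g v]; blast)+
    then show ?thesis using m * by (simp add: grading_def)
  qed
qed

lemma rep_iso_refl: "twisted_rep Q E \<Longrightarrow> rep_iso Q E E"
  unfolding rep_iso_def by (rule exI[of _ "\<lambda>v. v"]) (auto simp: linear_iso_on_def clinear_on_def bij_betw_def)

lemma rep_iso_trans:
  assumes "rep_iso Q E F" "rep_iso Q F K"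
  shows "rep_iso Q E K"
proof -
  obtain f g where f: "linear_iso_on (rspace E) (rspace F) f"
      "f \<in> reven E \<rightarrow> reven F" "f \<in> rodd E \<rightarrow> rodd F"
      "\<And>x v. x \<in> carrier Gt \<Longrightarrow> v \<in> rspace E \<Longrightarrow> f (ract E x v) = ract F x (f v)"
    and g: "linear_iso_on (rspace F) (rspace K) g"
      "g \<in> reven F \<rightarrow> reven K" "g \<in> rodd F \<rightarrow> rodd K"
      "\<And>x v. x \<in> carrier Gt \<Longrightarrow> v \<in> rspace F \<Longrightarrow> g (ract F x v) = ract K x (g v)"
    using assms unfolding rep_iso_def by metis
  have "f v \<in> rspace F" if "v \<in> rspace E" for v using f(1) that by (auto simp: linear_iso_on_def clinear_on_def)
  then show ?thesis
    unfolding rep_iso_def using linear_iso_on_compose[OF f(1) g(1)] f g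
    by (intro exI[of _ "\<lambda>v. g (f v)"]) (auto simp: Pi_iff)
qed

text \<open>An isomorphism is asked only to map even to even and odd to odd vectors. Its inverse
  does the same, because \<open>f\<close> commutes with the projections of the two gradings and is
  injective.\<close>

lemma rep_iso_sym:
  assumes E: "twisted_rep Q E" and F: "twisted_rep Q F" and "rep_iso Q E F"
  shows "rep_iso Q F E"
proof -
  obtain f where f: "linear_iso_on (rspace E) (rspace F) f"
      "f \<in> reven E \<rightarrow> reven F" "f \<in> rodd E \<rightarrow> rodd F"
      "\<And>x v. x \<in> carrier Gt \<Longrightarrow> v \<in> rspace E \<Longrightarrow> f (ract E x v) = ract F x (f v)"
    using assms unfolding rep_iso_def by metis
  note ED = twisted_repD[OF E] and FD = twisted_repD[OF F]
  let ?g = "inv_into (rspace E) f"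
  have g: "linear_iso_on (rspace F) (rspace E) ?g" by (rule clinear_on_inv_into[OF f(1) ED(4)])
  have lin: "clinear_on (rspace E) (rspace F) f" and bij: "bij_betw f (rspace E) (rspace F)"
    using f(1) by (auto simp: linear_iso_on_def)
  have inv: "?g (f v) = v" if "v \<in> rspace E" for v using bij that by (simp add: bij_betw_inv_into_left)
  have gF: "?g w \<in> rspace E" "f (?g w) = w" if "w \<in> rspace F" for w
    using bij that by (auto simp: bij_betw_inv_into_right intro: bij_betwE[OF bij_betw_inv_into[OF bij], rule_format])
  have grade: "?g w \<in> A" if w: "w \<in> A'" and gE: "graded_by (rspace E) A B" and gF': "graded_by (rspace F) A' B'"
    and fA: "f \<in> A \<rightarrow> A'" and fB: "f \<in> B \<rightarrow> B'" for w A B A' B'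
  proof -
    have wF: "w \<in> rspace F" using w graded_byD[OF gF'] by blast
    have "gproj A' B' (f (?g w)) = f (gproj A B (?g w))"
      by (rule gproj_map[OF gE gF' gF(1)[OF wF]]) (use clinear_onD(2)[OF lin] fA fB in blast)+
    then have "w = f (gproj A B (?g w))" using gproj_id(1)[OF gF' w] gF(2)[OF wF] by simp
    moreover have "gproj A B (?g w) \<in> A" by (rule gproj_mem[OF gE gF(1)[OF wF]])
    ultimately show ?thesis using inv graded_byD(4)[OF gE] by (metis subsetD)
  qed
  show ?thesis
    unfolding rep_iso_def
  proof (intro exI[of _ ?g] conjI ballI)
    show "?g \<in> reven F \<rightarrow> reven E" using grade[OF _ ED(2) FD(2) f(2,3)] by blast
    show "?g \<in> rodd F \<rightarrow> rodd E"
      using grade[OF _ graded_by_commute[OF ED(2)] graded_by_commute[OF FD(2)] f(3,2)] by blast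
    fix x w assume x: "x \<in> carrier Gt" and w: "w \<in> rspace F"
    show "?g (ract F x w) = ract E x (?g w)"
      using f(4)[OF x gF(1)[OF w]] gF[OF w] inv[of "ract E x (?g w)"] twisted_actionD(1)[OF ED(3) x] by metis
  qed (rule g)
qed

subsection \<open>Gapped systems\<close>

lemma gapped_systemD:
  assumes "gapped_system Q S"
  shows "fd_space (sspace S)" "inner_product_on (sspace S) (sinner S)"
    "linear_iso_on (sspace S) (sspace S) (sham S)"
    "\<And>v w. v \<in> sspace S \<Longrightarrow> w \<in> sspace S \<Longrightarrow> sinner S (sham S v) w = sinner S v (sham S w)"
    "twisted_action Q (sspace S) (sact S)"
    "\<And>g v w. g \<in> carrier Gt \<Longrightarrow> v \<in> sspace S \<Longrightarrow> w \<in> sspace S \<Longrightarrow>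
      sinner S (sact S g v) (sact S g w) = twist (ph g) (sinner S v w)"
    "\<And>g v. g \<in> carrier Gt \<Longrightarrow> v \<in> sspace S \<Longrightarrow>
      sact S g (sham S v) = cscale (of_int (gr g)) (sham S (sact S g v))"
    "cseq.subspace (sspace S)" "sesquilinear_on (sspace S) (sspace S) (sinner S)"
  using assms signs(1) fd_space_subspace inner_product_onD(1) unfolding gapped_system_def twist_def by (auto, metis)

lemma gapped_selfadjoint:
  assumes "gapped_system Q S"
  shows "selfadjoint (sspace S) (sinner S) (sham S)"
  using gapped_systemD[OF assms] by unfold_locales (auto simp: linear_iso_on_def)

lemma gapped_graded:
  assumes "gapped_system Q S"
  shows "graded_by (sspace S) (pos_space S) (neg_space S)"
  unfolding pos_space_eig neg_space_eig using gapped_systemD(3)[OF assms]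
  by (intro selfadjoint.eig_span_graded[OF gapped_selfadjoint[OF assms]])
    (auto simp: linear_iso_on_def bij_betw_def)

text \<open>Since \<open>g\<close> commutes with the Hamiltonian up to the sign \<open>gr g\<close>,
  it multiplies eigenvalues by that sign. Antilinearity does no harm, as the eigenvalues are
  real.\<close>

lemma gapped_action_eig_span:
  assumes S: "gapped_system Q S" and g: "g \<in> carrier Gt"
    and v: "v \<in> eig_span (sspace S) (sham S) P" and PR: "\<And>l. P l \<Longrightarrow> R (of_int (gr g) * l)"
  shows "sact S g v \<in> eig_span (sspace S) (sham S) R"
proof -
  note SG = gapped_systemD[OF S]
  note A = twisted_actionD[OF SG(5)]
  have e: "sham S (sact S g w) = cscale (of_real (of_int (gr g))) (sact S g (sham S w))" if w: "w \<in> sspace S" for w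
    using SG(7)[OF g w] signs(2)[OF g] by auto
  show ?thesis
    by (rule eig_span_map[OF SG(8), where f = "sact S g" and \<theta> = "twist (ph g)" and k = "of_int (gr g)"])
      (use A(1-3)[OF g] e PR v in \<open>auto simp del: plus_fun_apply\<close>)
qed

lemma twisted_rep_rep_of:
  assumes S: "gapped_system Q S"
  shows "twisted_rep Q (rep_of S)"
  unfolding twisted_rep_def rep_of_simps
  using gapped_systemD[OF S] gapped_graded[OF S]
    gapped_action_eig_span[OF S]
  by (auto simp: pos_space_eig neg_space_eig)

lemma system_iso_imp_rep_iso:
  assumes S: "gapped_system Q S" and "system_iso Q S T"
  shows "rep_iso Q (rep_of S) (rep_of T)"
proof -
  obtain f where f: "linear_iso_on (sspace S) (sspace T) f"
    "\<forall>v\<in>sspace S. f (sham S v) = sham T (f v)"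
    "\<forall>g\<in>carrier (qext Q). \<forall>v\<in>sspace S. f (sact S g v) = sact T g (f v)"
    using assms(2) unfolding system_iso_def by blast
  have lin: "clinear_on (sspace S) (sspace T) f" using f(1) by (simp add: linear_iso_on_def)
  have "f v \<in> eig_span (sspace T) (sham T) P" if "v \<in> eig_span (sspace S) (sham S) P" for v P
    using f(2) that
    by (intro eig_span_clinear[OF lin gapped_systemD(8)[OF S]]) auto
  then show ?thesis
    unfolding rep_iso_def rep_of_simps pos_space_eig neg_space_eig using f
    by (intro exI[of _ f]) auto
qed

end

subsection \<open>Averaging over the extension\<close>

context qm
begin

text \<open>The projection to the base is a proper map, as its fibres are cosets of the circle.\<close>

lemma compact_ext:
  assumes comp: "compact_space (gtop (qbase Q))"
  shows "compact_space (gtop Gt)"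
proof -
  interpret G: group Gt by (rule group_Gt)
  let ?p = "qproj Q" and ?K = "kernel Gt (qbase Q) (qproj Q)"
  have hom: "?p \<in> hom Gt (qbase Q)" and quot: "quotient_map (gtop Gt) (gtop (qbase Q)) ?p"
    and emb: "embedding_map (top_of_set (sphere 0 1)) (gtop Gt) (qincl Q)"
    and ker: "qincl Q ` carrier circle_group = ?K"
    and contm: "continuous_map (prod_topology (gtop Gt) (gtop Gt)) (gtop Gt) (\<lambda>(x, y). x \<otimes>\<^bsub>Gt\<^esub> y)"
    using ext top_group by (auto simp: extended_qm_class_def topological_group_def)
  interpret p: group_hom Gt "qbase Q" ?p
    using hom base_top_group group_Gt
    by (auto simp: group_hom_def group_hom_axioms_def topological_group_def)
  have topB: "topspace (gtop (qbase Q)) = carrier (qbase Q)"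
    using base_top_group by (simp add: topological_group_def)
  have "compactin (top_of_set (sphere 0 1)) (sphere (0::complex) 1)"
    by (simp add: compactin_subtopology)
  then have "compactin (gtop Gt) (qincl Q ` sphere 0 1)"
    using emb by (meson image_compactin embedding_map_def homeomorphic_imp_continuous_map continuous_map_in_subtopology)
  then have K: "compactin (gtop Gt) ?K" using ker by (simp add: circle_group_def)
  have Kc: "k \<in> carrier Gt" "?p k = \<one>\<^bsub>qbase Q\<^esub>" if "k \<in> ?K" for k
    using that by (auto simp: kernel_def)
  have coset: "inv\<^bsub>Gt\<^esub> x \<otimes>\<^bsub>Gt\<^esub> y \<in> ?K" if "x \<in> carrier Gt" "y \<in> carrier Gt" "?p x = ?p y" for x y
    using that by (simp add: kernel_def)
  have xy: "x \<otimes>\<^bsub>Gt\<^esub> (inv\<^bsub>Gt\<^esub> x \<otimes>\<^bsub>Gt\<^esub> y) = y" if "x \<in> carrier Gt" "y \<in> carrier Gt" for x y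
    using that by (simp add: G.m_assoc[symmetric])
  have px: "?p (x \<otimes>\<^bsub>Gt\<^esub> k) = ?p x" if "x \<in> carrier Gt" "k \<in> ?K" for x k
    using that Kc[OF that(2)] by simp
  have fibre: "compactin (gtop Gt) {x \<in> topspace (gtop Gt). ?p x = y}" for y
  proof (cases "\<exists>g\<in>carrier Gt. ?p g = y")
    case True
    then obtain g where g: "g \<in> carrier Gt" "?p g = y" by blast
    have "continuous_map (gtop Gt) (gtop Gt) ((\<lambda>(x, y). x \<otimes>\<^bsub>Gt\<^esub> y) \<circ> (\<lambda>k. (g, k)))"
      by (rule continuous_map_compose[OF _ contm]) (use g in \<open>auto intro: continuous_map_pairedI\<close>)
    then have "compactin (gtop Gt) ((\<lambda>k. g \<otimes>\<^bsub>Gt\<^esub> k) ` ?K)"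
      using image_compactin[OF K] by (simp add: comp_def)
    moreover have "(\<lambda>k. g \<otimes>\<^bsub>Gt\<^esub> k) ` ?K = {x \<in> topspace (gtop Gt). ?p x = y}"
    proof (intro equalityI subsetI)
      fix x assume "x \<in> {x \<in> topspace (gtop Gt). ?p x = y}"
      then show "x \<in> (\<lambda>k. g \<otimes>\<^bsub>Gt\<^esub> k) ` ?K"
        using g xy[OF g(1), of x] coset[OF g(1), of x] by (intro image_eqI[of _ _ "inv\<^bsub>Gt\<^esub> g \<otimes>\<^bsub>Gt\<^esub> x"]) auto
    qed (use g px[OF g(1)] Kc in auto)
    ultimately show ?thesis by simp
  next
    case False
    then have "{x \<in> topspace (gtop Gt). ?p x = y} = {}" by auto
    then show ?thesis using compactin_empty by metis
  qed
  have "closed_map (gtop Gt) (gtop (qbase Q)) ?p"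
    unfolding closed_map_def
  proof (intro allI impI)
    fix C assume C: "closedin (gtop Gt) C"
    define D where "D = {x \<in> topspace (gtop Gt). ?p x \<in> ?p ` C}"
    have Cc: "C \<subseteq> carrier Gt" using closedin_subset[OF C] by simp
    \<comment> \<open>The open set of pairs whose product avoids \<open>C\<close>. A point
      \<open>x\<close> lies outside the saturation \<open>D\<close> of \<open>C\<close> exactly when
      \<open>W\<close> contains all pairs of \<open>x\<close> with an element of the kernel. As the
      kernel is compact, the tube lemma makes the complement of \<open>D\<close> open.\<close>
    define W where "W = {z \<in> topspace (prod_topology (gtop Gt) (gtop Gt)).
      (\<lambda>(x, y). x \<otimes>\<^bsub>Gt\<^esub> y) z \<in> topspace (gtop Gt) - C}"
    have W: "openin (prod_topology (gtop Gt) (gtop Gt)) W"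
      unfolding W_def by (rule openin_continuous_map_preimage[OF contm]) (use C in blast)
    have "openin (gtop Gt) (topspace (gtop Gt) - D)"
    proof (subst openin_subopen, intro ballI)
      fix x assume "x \<in> topspace (gtop Gt) - D"
      then have x: "x \<in> carrier Gt" "?p x \<notin> ?p ` C" by (auto simp: D_def)
      have "{x} \<times> ?K \<subseteq> W"
      proof
        fix z assume "z \<in> {x} \<times> ?K"
        then obtain k where "z = (x, k)" "k \<in> ?K" by auto
        then show "z \<in> W" using x px[OF x(1), of k] Kc[of k] by (auto simp: W_def image_iff)
      qed
      then obtain U N where UN: "openin (gtop Gt) U" "x \<in> U" "?K \<subseteq> N" "U \<times> N \<subseteq> W"
        using tube_lemma_right[OF W K, of x] x by (metis topspace_Gt)
      have "u \<notin> D" if u: "u \<in> U" for u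
      proof
        assume "u \<in> D"
        then obtain c where c: "u \<in> carrier Gt" "c \<in> C" "?p u = ?p c" by (auto simp: D_def)
        then have "(u, inv\<^bsub>Gt\<^esub> u \<otimes>\<^bsub>Gt\<^esub> c) \<in> W" using UN u coset[of u c] Cc by blast
        then show False using c xy[of u c] Cc by (auto simp: W_def)
      qed
      then show "\<exists>T. openin (gtop Gt) T \<and> x \<in> T \<and> T \<subseteq> topspace (gtop Gt) - D"
        using UN openin_subset[OF UN(1)] by blast
    qed
    then have "closedin (gtop Gt) D" by (simp add: closedin_def D_def Collect_restrict)
    moreover have "?p ` C \<subseteq> topspace (gtop (qbase Q))" using Cc by (auto simp: topB)
    ultimately show "closedin (gtop (qbase Q)) (?p ` C)"
      using quot unfolding quotient_map_closedin D_def by blast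
  qed
  then have "proper_map (gtop Gt) (gtop (qbase Q)) ?p"
    using fibre by (simp add: proper_map_def)
  then have "compactin (gtop Gt) {x \<in> topspace (gtop Gt). ?p x \<in> topspace (gtop (qbase Q))}"
    using compactin_proper_map_preimage comp compact_space_def by blast
  moreover have "{x \<in> topspace (gtop Gt). ?p x \<in> topspace (gtop (qbase Q))} = topspace (gtop Gt)"
    by (auto simp: topB)
  ultimately show ?thesis by (simp add: compact_space_def)
qed

end

text \<open>Existence is the finite intersection property of the sublevel sets. That these be closed
  is exactly what a supremum of continuous functions provides. Uniqueness comes from strictness,
  since two minimizers would admit a point below both.\<close>

lemma strictly_convex_minimizer:
  fixes K :: "('j \<Rightarrow> complex) set" and q :: "('j \<Rightarrow> complex) \<Rightarrow> real"
  assumes K: "compact K" "K \<noteq> {}" and lsc: "\<And>a. closed {h \<in> K. q h \<le> a}"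
    and strict: "\<And>h h'. h \<in> K \<Longrightarrow> h' \<in> K \<Longrightarrow> h \<noteq> h' \<Longrightarrow> \<exists>k\<in>K. q k < max (q h) (q h')"
  obtains h where "h \<in> K" "\<And>k. k \<in> K \<Longrightarrow> q k \<le> q h \<Longrightarrow> k = h"
proof -
  let ?F = "(\<lambda>k. {h \<in> K. q h \<le> q k}) ` K"
  have "K \<inter> \<Inter>?F \<noteq> {}"
  proof (rule compact_imp_fip[OF K(1)])
    show "closed T" if "T \<in> ?F" for T using lsc that by auto
    fix F' assume F': "finite F'" "F' \<subseteq> ?F"
    then obtain K' where K': "K' \<subseteq> K" "finite K'" "F' = (\<lambda>k. {h \<in> K. q h \<le> q k}) ` K'"
      using finite_subset_image[OF F'] by blast
    show "K \<inter> \<Inter>F' \<noteq> {}"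
    proof (cases "K' = {}")
      case True
      then show ?thesis using K' K(2) by simp
    next
      case False
      then have "Min (q ` K') \<in> q ` K'" using K'(2) by (intro Min_in) auto
      then obtain h where h: "h \<in> K'" "q h = Min (q ` K')" by force
      then have "q h \<le> q k" if "k \<in> K'" for k using K'(2) that by simp
      then have "h \<in> K \<inter> \<Inter>F'" using h K' by auto
      then show ?thesis by blast
    qed
  qed
  then obtain h where h: "h \<in> K" "\<And>k. k \<in> K \<Longrightarrow> q h \<le> q k" by auto
  have "k = h" if k: "k \<in> K" "q k \<le> q h" for k
  proof (rule ccontr)
    assume "k \<noteq> h"
    then obtain m where "m \<in> K" "q m < max (q k) (q h)" using strict[OF k(1) h(1)] by blast
    then show False using h(2)[of m] k(2) by simp
  qed
  then show ?thesis using that h by blast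
qed

text \<open>The subtracted term is the gain at a midpoint, the source of strict convexity for sums
  of squares.\<close>

lemma parallelogram_cmod:
  fixes a b :: complex
  shows "(cmod ((a + b) / 2))\<^sup>2 = ((cmod a)\<^sup>2 + (cmod b)\<^sup>2) / 2 - (cmod (a - b))\<^sup>2 / 4"
  unfolding cmod_power2 by (simp add: power2_eq_square field_simps)

section \<open>Invariant sesquilinear forms\<close>

context qm
begin

text \<open>Instead of Haar measure, use the unique minimizer of a strictly convex invariant
  function on the compact convex set of all forms whose real part is bounded below by the
  infimum over the orbit of the given form.\<close>

lemma invariant_form:
  assumes comp: "compact_space (gtop Gt)" and V: "fd_space V" and W: "fd_space W"
    and \<rho>: "twisted_action Q V \<rho>" and \<sigma>: "twisted_action Q W \<sigma>" and h0: "sesquilinear_on V W h0"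
  obtains h where "sesquilinear_on V W h"
    "\<And>g v w. g \<in> carrier Gt \<Longrightarrow> v \<in> V \<Longrightarrow> w \<in> W \<Longrightarrow> h (\<rho> g v) (\<sigma> g w) = twist (ph g) (h v w)"
    "\<And>v w a. v \<in> V \<Longrightarrow> w \<in> W \<Longrightarrow> (\<And>g. g \<in> carrier Gt \<Longrightarrow> a \<le> Re (h0 (\<rho> g v) (\<sigma> g w))) \<Longrightarrow> a \<le> Re (h v w)"
proof -
  interpret G: group Gt by (rule group_Gt)
  note R = twisted_actionD[OF \<rho>] and S = twisted_actionD[OF \<sigma>]
  have subV: "cseq.subspace V" and subW: "cseq.subspace W" using V W by (auto intro: fd_space_subspace)
  note VD = subspaceD[OF subV] and WD = subspaceD[OF subW]
  obtain I b J c where b: "reduced_basis V I b" and c: "reduced_basis W J c"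
    using reduced_basis_exists V W by metis
  note B = reduced_basisD[OF b] and C = reduced_basisD[OF c]
  have cont: "continuous_map (gtop Gt) euclidean (\<lambda>g. h (\<rho> g v) (\<sigma> g w))"
    if "sesquilinear_on V W h" "v \<in> V" "w \<in> W" for h v w
    using continuous_map_sesquilinear[OF V W that(1) R(8) S(8)] that by blast
  have bound: "\<exists>m. \<forall>g\<in>carrier Gt. cmod (h (\<rho> g v) (\<sigma> g w)) \<le> m"
    if "sesquilinear_on V W h" "v \<in> V" "w \<in> W" for h v w
  proof -
    have "compact ((\<lambda>g. h (\<rho> g v) (\<sigma> g w)) ` topspace (gtop Gt))"
      using image_compactin[OF comp[unfolded compact_space_def] cont[OF that]] by simp
    then have "bounded ((\<lambda>g. h (\<rho> g v) (\<sigma> g w)) ` carrier Gt)"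
      by (simp add: compact_imp_bounded)
    then show ?thesis by (auto simp: bounded_iff)
  qed
  \<comment> \<open>When \<open>g\<close> acts antilinearly, the translated form is conjugated in
    both slots; \<open>twist\<close> makes it sesquilinear again.\<close>
  have twisted: "sesquilinear_on V W (\<lambda>v w. twist (ph g) (h (\<rho> g v) (\<sigma> g w)))"
    if h: "sesquilinear_on V W h" and g: "g \<in> carrier Gt" for h g
    unfolding sesquilinear_on_def
    by (simp add: R(1-3)[OF g] S(1-3)[OF g] sesquilinear_onD[OF h] del: plus_fun_apply)
  \<comment> \<open>Forms are viewed as functions on all pairs of sequences, extended by zero, so
    that \<open>K\<close> sits in a product of copies of the complex numbers. The last condition
    says that \<open>Re (F (v, w))\<close> is at least the infimum of \<open>Re h0\<close> along the
    orbit.\<close>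
  define K where "K = {F :: vec \<times> vec \<Rightarrow> complex.
      (\<forall>v w. v \<notin> V \<or> w \<notin> W \<longrightarrow> F (v, w) = 0) \<and> sesquilinear_on V W (\<lambda>v w. F (v, w)) \<and>
      (\<forall>v w a. v \<in> V \<longrightarrow> w \<in> W \<longrightarrow> (\<forall>g\<in>carrier Gt. a \<le> Re (h0 (\<rho> g v) (\<sigma> g w))) \<longrightarrow> a \<le> Re (F (v, w)))}"
  have ap: "continuous_on UNIV (\<lambda>F. (F :: vec \<times> vec \<Rightarrow> complex) j)" for j
    by (rule continuous_on_product_then_coordinatewise) (rule continuous_on_id)
  have "closed K"
    unfolding K_def sesquilinear_on_def Ball_def
    by (intro closed_Collect_all closed_Collect_imp closed_Collect_conj closed_Collect_eq
        closed_Collect_le open_Collect_const continuous_intros ap)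
  define m where "m v w = (SOME m. \<forall>g\<in>carrier Gt. cmod (h0 (\<rho> g v) (\<sigma> g w)) \<le> m)" for v w
  have m: "cmod (h0 (\<rho> g v) (\<sigma> g w)) \<le> m v w" if "g \<in> carrier Gt" "v \<in> V" "w \<in> W" for g v w
    using someI_ex[OF bound[OF h0 that(2,3)]] that(1) unfolding m_def by blast
  have lower: "- m v w \<le> Re (F (v, w))" if F: "F \<in> K" and vw: "v \<in> V" "w \<in> W" for F v w
  proof -
    have "- m v w \<le> Re (h0 (\<rho> g v) (\<sigma> g w))" if "g \<in> carrier Gt" for g
      using m[OF that vw] abs_Re_le_cmod[of "h0 (\<rho> g v) (\<sigma> g w)"] by linarith
    then show ?thesis using F vw by (simp add: K_def)
  qed
  \<comment> \<open>Only lower bounds on real parts are at hand. Applied to the multiples of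
    \<open>w\<close> by 1, -1, \<i> and -\<i>, they bound the real and the imaginary part from both
    sides, which gives compactness of \<open>K\<close>.\<close>
  define r where "r v w = \<bar>m v w\<bar> + \<bar>m v (cscale (-1) w)\<bar> + \<bar>m v (cscale \<i> w)\<bar> + \<bar>m v (cscale (-\<i>) w)\<bar>" for v w
  have Kr: "cmod (F (v, w)) \<le> r v w" if F: "F \<in> K" and vw: "v \<in> V" "w \<in> W" for F v w
  proof -
    have sF: "sesquilinear_on V W (\<lambda>v w. F (v, w))" using F by (simp add: K_def)
    have "- m v w \<le> Re (F (v, w))" "- m v (cscale (-1) w) \<le> - Re (F (v, w))"
      "- m v (cscale \<i> w) \<le> - Im (F (v, w))" "- m v (cscale (-\<i>) w) \<le> Im (F (v, w))"
      using lower[OF F vw(1), of "cscale a w" for a] lower[OF F vw]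
        sesquilinear_onD(4)[OF sF vw] WD(3)[OF vw(2)]
      by (metis, metis mult_minus1 minus_complex.simps(1) uminus_complex.simps(1),
          metis Re_i_times, metis Re_i_times mult_minus_left uminus_complex.simps(1) minus_minus)
    then have "\<bar>Re (F (v, w))\<bar> + \<bar>Im (F (v, w))\<bar> \<le> r v w" unfolding r_def by linarith
    then show ?thesis using cmod_le[of "F (v, w)"] by linarith
  qed
  define P where "P = PiE UNIV (\<lambda>(v, w). if v \<in> V \<and> w \<in> W then cball (0::complex) (r v w) else {0})"
  have "compactin (product_topology (\<lambda>i. euclidean) UNIV) P"
    unfolding P_def compactin_PiE by auto
  then have "compact P" by (simp add: euclidean_product_topology)
  moreover have "K \<subseteq> P" using Kr by (auto simp: P_def K_def)
  ultimately have "compact K" using compact_Int_closed[OF _ \<open>closed K\<close>, of P] by (simp add: Int_absorb1)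
  \<comment> \<open>The given form itself obeys the lower bounds, since its orbit contains the value
    at the group identity.\<close>
  have "(\<lambda>(v, w). if v \<in> V \<and> w \<in> W then h0 v w else 0) \<in> K"
  proof -
    have "a \<le> Re (h0 v w)"
      if "v \<in> V" "w \<in> W" "\<forall>g\<in>carrier Gt. a \<le> Re (h0 (\<rho> g v) (\<sigma> g w))" for v w a
      using that R(4)[OF G.one_closed G.one_closed] R(5)[OF G.one_closed, of v] S(5)[OF G.one_closed, of w]
        bspec[OF that(3) G.one_closed] R(1)[OF G.one_closed, of v]
        R(4)[OF G.one_closed G.one_closed, of v] S(4)[OF G.one_closed G.one_closed, of w] by simp
    then show ?thesis using h0 VD WD by (auto simp: K_def sesquilinear_on_def)
  qed
  then have "K \<noteq> {}" by blast
  \<comment> \<open>The squared Hilbert-Schmidt norm of the translate of \<open>F\<close> by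
    \<open>g\<close>. Translating \<open>F\<close> only permutes these numbers, so their supremum
    \<open>q\<close> is invariant.\<close>
  define s where "s g F = (\<Sum>i\<in>I. \<Sum>j\<in>J. (cmod (F (\<rho> g (b i), \<sigma> g (c j))))\<^sup>2)"
    for g and F :: "vec \<times> vec \<Rightarrow> complex"
  define q where "q F = (SUP g\<in>carrier Gt. s g F)" for F
  have sesK: "sesquilinear_on V W (\<lambda>v w. F (v, w))" if "F \<in> K" for F using that by (simp add: K_def)
  have conts: "continuous_map (gtop Gt) euclidean (\<lambda>g. s g F)" if F: "F \<in> K" for F
    unfolding s_def
    by (intro continuous_map_sum B(2) C(2) continuous_map_real_pow continuous_map_norm cont[OF sesK[OF F]] B(3) C(3))
  have comps: "compact ((\<lambda>g. s g F) ` carrier Gt)" if "F \<in> K" for F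
    using image_compactin[OF comp[unfolded compact_space_def] conts[OF that]] by simp
  have bdd: "bdd_above ((\<lambda>g. s g F) ` carrier Gt)" if "F \<in> K" for F
    using compact_imp_bounded[OF comps[OF that]] by (rule bounded_imp_bdd_above)
  have ne: "carrier Gt \<noteq> {}" using G.one_closed by blast
  \<comment> \<open>By compactness the value of \<open>q\<close> at a midpoint is the value of
    \<open>s\<close> at a single \<open>g\<close>, where the parallelogram identity yields a strict
    inequality.\<close>
  have att: "\<exists>g\<in>carrier Gt. q F = s g F" if "F \<in> K" for F
    using compact_attains_sup[OF comps[OF that]] ne bdd[OF that] unfolding q_def
    by (metis (no_types, lifting) cSup_eq_maximum imageE image_is_empty)
  have sq: "s g F \<le> q F" if "F \<in> K" "g \<in> carrier Gt" for g F
    unfolding q_def by (rule cSUP_upper[OF that(2) bdd[OF that(1)]])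
  have lsc: "closed {F \<in> K. q F \<le> a}" for a
  proof -
    have "{F \<in> K. q F \<le> a} = K \<inter> (\<Inter>g\<in>carrier Gt. {F. s g F \<le> a})"
      using cSUP_le_iff[OF ne bdd] by (auto simp: q_def)
    also have "closed \<dots>"
      unfolding s_def by (intro closed_Int \<open>closed K\<close> closed_INT ballI closed_Collect_le continuous_intros ap)
    finally show ?thesis .
  qed
  have strict: "\<exists>k\<in>K. q k < max (q h) (q h')" if h: "h \<in> K" "h' \<in> K" and neq: "h \<noteq> h'" for h h'
  proof -
    let ?k = "\<lambda>j. (h j + h' j) / 2"
    have k: "?k \<in> K"
      unfolding K_def
    proof (intro CollectI conjI allI impI)
      show "sesquilinear_on V W (\<lambda>v w. ?k (v, w))"
        using sesK[OF h(1)] sesK[OF h(2)] unfolding sesquilinear_on_def by (auto simp: field_simps)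
      fix v w a assume *: "v \<in> V" "w \<in> W" "\<forall>g\<in>carrier Gt. a \<le> Re (h0 (\<rho> g v) (\<sigma> g w))"
      then have "a \<le> Re (h (v, w))" "a \<le> Re (h' (v, w))" using h by (auto simp: K_def)
      then show "a \<le> Re (?k (v, w))" by simp
    qed (use h in \<open>auto simp: K_def\<close>)
    then obtain g where g: "g \<in> carrier Gt" "q ?k = s g ?k" using att by blast
    let ?d = "\<lambda>j. h j - h' j"
    have d: "sesquilinear_on V W (\<lambda>v w. ?d (v, w))"
      using sesK[OF h(1)] sesK[OF h(2)] unfolding sesquilinear_on_def by (auto simp: algebra_simps)
    \<comment> \<open>A difference that vanishes on the translated bases vanishes on all translated
      pairs, and these are all pairs because \<open>g\<close> is invertible.\<close>
    have "s g ?d \<noteq> 0"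
    proof
      assume "s g ?d = 0"
      then have 0: "?d (\<rho> g (b i), \<sigma> g (c j)) = 0" if "i \<in> I" "j \<in> J" for i j
        using that B(2) C(2) by (simp add: s_def sum_nonneg_eq_0_iff sum_nonneg)
      have z: "?d (\<rho> g v, \<sigma> g w) = 0" if vw: "v \<in> V" "w \<in> W" for v w
      proof -
        have "twist (ph g) (?d (\<rho> g v, \<sigma> g w)) = 0"
          using sesquilinear_on_expand[OF twisted[OF d g(1)] b c vw] 0 by simp
        then show ?thesis by (metis twist_simps(4,9))
      qed
      have "h (v, w) = h' (v, w)" for v w
      proof (cases "v \<in> V \<and> w \<in> W")
        case True
        then show ?thesis
          using z[of "\<rho> (inv\<^bsub>Gt\<^esub> g) v" "\<sigma> (inv\<^bsub>Gt\<^esub> g) w"] R(1,6) S(1,6) g(1) G.inv_closed by simp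
      next
        case False
        then show ?thesis using h by (auto simp: K_def)
      qed
      then show False using neq by auto
    qed
    moreover have "s g ?d \<ge> 0" by (simp add: s_def sum_nonneg)
    moreover have "s g ?k = (s g h + s g h') / 2 - s g ?d / 4"
      by (simp only: s_def parallelogram_cmod sum.distrib sum_subtractf flip: sum_divide_distrib)
    ultimately have "q ?k < (q h + q h') / 2"
      using g(2) sq[OF h(1) g(1)] sq[OF h(2) g(1)] by argo
    then show ?thesis using k by (intro bexI[of _ ?k]) auto
  qed
  obtain F where F: "F \<in> K" "\<And>k. k \<in> K \<Longrightarrow> q k \<le> q F \<Longrightarrow> k = F"
    using strictly_convex_minimizer[OF \<open>compact K\<close> \<open>K \<noteq> {}\<close> lsc strict] by metis
  have inv: "F (\<rho> g v, \<sigma> g w) = twist (ph g) (F (v, w))"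
    if g: "g \<in> carrier Gt" and vw: "v \<in> V" "w \<in> W" for g v w
  proof -
    \<comment> \<open>The translate of \<open>F\<close> by \<open>g\<close>, with conjugation
      undone. A pair and its translate have the same orbit, so \<open>T\<close> obeys the same lower
      bounds; as \<open>q T \<le> q F\<close>, uniqueness of the minimizer gives
      \<open>T = F\<close>.\<close>
    define T where "T = (\<lambda>(v, w). if v \<in> V \<and> w \<in> W then twist (ph g) (F (\<rho> g v, \<sigma> g w)) else 0)"
    have T: "T \<in> K"
      unfolding K_def
    proof (intro CollectI conjI allI impI)
      show "sesquilinear_on V W (\<lambda>v w. T (v, w))"
        using twisted[OF sesK[OF F(1)] g] VD WD unfolding sesquilinear_on_def T_def by simp
      fix v w a assume *: "v \<in> V" "w \<in> W" "\<forall>g\<in>carrier Gt. a \<le> Re (h0 (\<rho> g v) (\<sigma> g w))"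
      have "a \<le> Re (h0 (\<rho> x (\<rho> g v)) (\<sigma> x (\<sigma> g w)))" if x: "x \<in> carrier Gt" for x
        using *(3) R(4)[OF x g *(1)] S(4)[OF x g *(2)] x g G.m_closed by metis
      then have "a \<le> Re (F (\<rho> g v, \<sigma> g w))"
        using F(1) R(1)[OF g *(1)] S(1)[OF g *(2)] by (simp add: K_def)
      then show "a \<le> Re (T (v, w))" using * by (simp add: T_def)
    qed (auto simp: T_def)
    have "s x T = s (g \<otimes>\<^bsub>Gt\<^esub> x) F" if x: "x \<in> carrier Gt" for x
      unfolding s_def using x g by (intro sum.cong refl) (simp add: T_def R(1,4) S(1,4) B(3) C(3))
    then have "q T \<le> q F"
      unfolding q_def[of T] using sq[OF F(1)] g by (intro cSUP_least[OF ne]) auto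
    then have "T = F" by (rule F(2)[OF T])
    then have "F (v, w) = twist (ph g) (F (\<rho> g v, \<sigma> g w))"
      using vw by (auto simp: T_def dest!: fun_cong[of _ _ "(v, w)"])
    then show ?thesis by simp
  qed
  show ?thesis
    by (rule that[of "\<lambda>v w. F (v, w)"]) (use inv F(1) in \<open>auto simp: K_def\<close>)
qed

text \<open>Strict positivity survives because a continuous positive function on a compact group has
  a positive minimum, which is a lower bound for \<open>Re (h v w)\<close>. Vanishing survives
  because the lower bound 0 holds for all complex multiples of \<open>w\<close> as well.\<close>

lemma invariant_form_pos:
  assumes comp: "compact_space (gtop Gt)" and V: "fd_space V" and W: "fd_space W"
    and \<rho>: "twisted_action Q V \<rho>" and \<sigma>: "twisted_action Q W \<sigma>" and h0: "sesquilinear_on V W h0"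
  obtains h where "sesquilinear_on V W h"
    "\<And>g v w. g \<in> carrier Gt \<Longrightarrow> v \<in> V \<Longrightarrow> w \<in> W \<Longrightarrow> h (\<rho> g v) (\<sigma> g w) = twist (ph g) (h v w)"
    "\<And>v w. v \<in> V \<Longrightarrow> w \<in> W \<Longrightarrow> \<forall>g\<in>carrier Gt. 0 < Re (h0 (\<rho> g v) (\<sigma> g w)) \<Longrightarrow> 0 < Re (h v w)"
    "\<And>v w. v \<in> V \<Longrightarrow> w \<in> W \<Longrightarrow> \<forall>g\<in>carrier Gt. h0 (\<rho> g v) (\<sigma> g w) = 0 \<Longrightarrow> h v w = 0"
proof -
  interpret G: group Gt by (rule group_Gt)
  obtain h where h: "sesquilinear_on V W h"
    "\<And>g v w. g \<in> carrier Gt \<Longrightarrow> v \<in> V \<Longrightarrow> w \<in> W \<Longrightarrow> h (\<rho> g v) (\<sigma> g w) = twist (ph g) (h v w)"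
    and ge: "\<And>v w a. v \<in> V \<Longrightarrow> w \<in> W \<Longrightarrow>
      (\<And>g. g \<in> carrier Gt \<Longrightarrow> a \<le> Re (h0 (\<rho> g v) (\<sigma> g w))) \<Longrightarrow> a \<le> Re (h v w)"
    using invariant_form[OF assms] by metis
  note R = twisted_actionD[OF \<rho>] and S = twisted_actionD[OF \<sigma>]
  note WD = subspaceD[OF fd_space_subspace[OF W]]
  have "0 < Re (h v w)"
    if vw: "v \<in> V" "w \<in> W" and pos: "\<forall>g\<in>carrier Gt. 0 < Re (h0 (\<rho> g v) (\<sigma> g w))" for v w
  proof -
    let ?f = "\<lambda>g. Re (h0 (\<rho> g v) (\<sigma> g w))"
    have "continuous_map (gtop Gt) euclidean ?f"
      by (intro continuous_map_Re continuous_map_sesquilinear[OF V W h0 R(8) S(8)] vw)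
    then have "compact (?f ` carrier Gt)"
      using image_compactin[OF comp[unfolded compact_space_def]] by fastforce
    moreover have "?f ` carrier Gt \<noteq> {}" using G.one_closed by blast
    ultimately obtain g where "g \<in> carrier Gt" "\<And>x. x \<in> carrier Gt \<Longrightarrow> ?f g \<le> ?f x"
      using compact_attains_inf[of "?f ` carrier Gt"] by auto
    then show ?thesis using ge[OF vw, of "?f g"] pos by fastforce
  qed
  moreover have "h v w = 0"
    if vw: "v \<in> V" "w \<in> W" and z: "\<forall>g\<in>carrier Gt. h0 (\<rho> g v) (\<sigma> g w) = 0" for v w
  proof -
    have "h0 (\<rho> g v) (\<sigma> g (cscale a w)) = 0" if g: "g \<in> carrier Gt" for g a
      using sesquilinear_onD(4)[OF h0 R(1)[OF g vw(1)] S(1)[OF g vw(2)]] bspec[OF z g] S(3)[OF g vw(2)] by simp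
    then have "0 \<le> Re (a * h v w)" for a
      using ge[OF vw(1) WD(3)[OF vw(2)], of 0 a] sesquilinear_onD(4)[OF h(1) vw] by simp
    from this[of 1] this[of "-1"] this[of \<i>] this[of "-\<i>"] show ?thesis
      by (simp add: complex_eq_iff)
  qed
  ultimately show ?thesis using that h by blast
qed

subsection \<open>Every twisted representation underlies a gapped system\<close>

text \<open>The inner product has to be invariant and to make the even and odd parts orthogonal. The
  grading operator is then self-adjoint and has these parts as its spectral subspaces.\<close>

lemma rep_of_surj:
  assumes comp: "compact_space (gtop Gt)" and E: "twisted_rep Q E"
  obtains S where "gapped_system Q S" "rep_of S = E"
proof -
  let ?V = "rspace E" and ?A = "reven E" and ?B = "rodd E" and ?\<rho> = "ract E"
  note ED = twisted_repD[OF E]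
  note g = ED(2) and g' = graded_by_commute[OF ED(2)]
  note R = twisted_actionD[OF ED(3)] and VD = subspaceD[OF ED(4)]
  note GD = graded_byD[OF g]
  note AD = subspaceD[OF GD(1)] and BD = subspaceD[OF GD(2)]
  obtain I b where b: "reduced_basis ?V I b" using reduced_basis_exists[OF ED(1)] by auto
  let ?p = "gproj ?A ?B" and ?n = "gproj ?B ?A"
  note pV = gproj_both[OF g]
  note pD = clinear_onD[OF clinear_on_gproj[OF g]] and nD = clinear_onD[OF clinear_on_gproj[OF g']]
  \<comment> \<open>The standard form in pivot entries, taken separately on the even and odd
    components so that these are orthogonal.\<close>
  define h0 where "h0 v w = (\<Sum>i\<in>I. cnj (?p v i) * ?p w i + cnj (?n v i) * ?n w i)" for v w
  have h0: "sesquilinear_on ?V ?V h0"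
    unfolding sesquilinear_on_def h0_def
    by (auto simp: pD nD cscale_apply algebra_simps sum.distrib sum_distrib_left)
  have h0_pos: "0 < Re (h0 v v)" if v: "v \<in> ?V" "v \<noteq> 0" for v
  proof -
    have e: "h0 v v = of_real (\<Sum>i\<in>I. (cmod (?p v i))\<^sup>2 + (cmod (?n v i))\<^sup>2)"
      unfolding h0_def of_real_sum of_real_add complex_norm_square by (simp add: mult.commute)
    obtain i where i: "i \<in> I" "v i \<noteq> 0" using reduced_basis_nonzero[OF b v] by blast
    have "v i = ?p v i + ?n v i" using arg_cong[OF pV(5)[OF v(1)], of "\<lambda>f. f i"] by simp
    then have "?p v i \<noteq> 0 \<or> ?n v i \<noteq> 0" using i by auto
    then have "0 < (cmod (?p v i))\<^sup>2 + (cmod (?n v i))\<^sup>2"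
      by (auto intro: add_pos_nonneg add_nonneg_pos)
    then show ?thesis
      unfolding e using i(1) reduced_basisD(2)[OF b] by (simp, intro sum_pos2[of I i]) auto
  qed
  have h0_orth: "h0 v w = 0" if "v \<in> ?A" "w \<in> ?B" for v w
    unfolding h0_def using that gproj_id[OF g] gproj_id[OF g'] by simp
  have h0_orth': "h0 v w = 0" if "v \<in> ?B" "w \<in> ?A" for v w
    unfolding h0_def using that gproj_id[OF g] gproj_id[OF g'] by simp
  obtain h where h: "sesquilinear_on ?V ?V h"
    and inv: "\<And>x v w. x \<in> carrier Gt \<Longrightarrow> v \<in> ?V \<Longrightarrow> w \<in> ?V \<Longrightarrow> h (?\<rho> x v) (?\<rho> x w) = twist (ph x) (h v w)"
    and pos: "\<And>v w. v \<in> ?V \<Longrightarrow> w \<in> ?V \<Longrightarrow> \<forall>x\<in>carrier Gt. 0 < Re (h0 (?\<rho> x v) (?\<rho> x w)) \<Longrightarrow> 0 < Re (h v w)"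
    and zero: "\<And>v w. v \<in> ?V \<Longrightarrow> w \<in> ?V \<Longrightarrow> \<forall>x\<in>carrier Gt. h0 (?\<rho> x v) (?\<rho> x w) = 0 \<Longrightarrow> h v w = 0"
    by (rule invariant_form_pos[OF comp ED(1,1,3,3) h0 that])
  have h_pos: "0 < Re (h v v)" if v: "v \<in> ?V" "v \<noteq> 0" for v
  proof (rule pos[OF v(1) v(1)], rule ballI)
    fix x assume x: "x \<in> carrier Gt"
    have "?\<rho> x v \<noteq> ?\<rho> x 0" using bij_betw_imp_inj_on[OF R(9)[OF x]] v VD(1) by (metis inj_on_def)
    moreover have "?\<rho> x 0 = 0" using R(3)[OF x VD(1), of 0] by simp
    ultimately show "0 < Re (h0 (?\<rho> x v) (?\<rho> x v))" using h0_pos R(1)[OF x v(1)] by simp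
  qed
  \<comment> \<open>Each group element preserves or exchanges the two parts, so \<open>h0\<close>
    vanishes along the whole orbit of such a pair.\<close>
  have h_orth: "h v w = 0" if "v \<in> ?A \<and> w \<in> ?B \<or> v \<in> ?B \<and> w \<in> ?A" for v w
  proof (rule zero, goal_cases)
    case 3
    show ?case
    proof
      fix x assume x: "x \<in> carrier Gt"
      show "h0 (?\<rho> x v) (?\<rho> x w) = 0"
        using that signs(2)[OF x] ED(5-8)[OF x] h0_orth h0_orth' by metis
    qed
  qed (use that GD in auto)
  note hD = sesquilinear_onD[OF h]
  \<comment> \<open>The averaged form is not known to be hermitian. Symmetrizing it keeps
    invariance, positivity and the orthogonality of the two parts.\<close>
  define ip where "ip v w = h v w + cnj (h w v)" for v w
  define H where "H = grading ?A ?B"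
  have Hlin: "clinear_on ?V ?V H" unfolding H_def by (rule clinear_on_grading[OF g ED(4)])
  note HV = clinear_onD(1)[OF Hlin]
  have HA: "H a = a" if "a \<in> ?A" for a unfolding H_def by (rule grading_hom(1)[OF g that])
  have HB: "H a = - a" if "a \<in> ?B" for a unfolding H_def by (rule grading_hom(2)[OF g that])
  have HH: "H (H v) = v" if v: "v \<in> ?V" for v
    unfolding H_def by (rule grading_involution[OF g ED(4) v])
  have ip: "inner_product_on ?V ip"
    unfolding inner_product_on_def ip_def
    using h_pos by (auto simp: hD algebra_simps complex_cnj_add)
  have sq: "sesquilinear_on ?V ?V ip" by (rule inner_product_onD(1)[OF ip ED(4)])
  have ip_orth: "ip v w = 0" if "v \<in> ?A \<and> w \<in> ?B \<or> v \<in> ?B \<and> w \<in> ?A" for v w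
    unfolding ip_def using h_orth[of v w] h_orth[of w v] that by auto
  have Hsym: "ip (H v) w = ip v (H w)" if v: "v \<in> ?V" and w: "w \<in> ?V" for v w
    unfolding H_def using grading_symmetric[OF g ED(4) sq ip_orth v w] .
  have comm: "?\<rho> x (H v) = cscale (of_int (gr x)) (H (?\<rho> x v))" if x: "x \<in> carrier Gt" and v: "v \<in> ?V" for x v
    unfolding H_def by (rule grading_commute[OF E x v])
  define S where "S = \<lparr>sspace = ?V, sinner = ip, sham = H, sact = ?\<rho>\<rparr>"
  have "bij_betw H ?V ?V" by (rule bij_betw_byWitness[where f' = H]) (use HV HH in auto)
  moreover have "ip (?\<rho> x v) (?\<rho> x w) = twist (ph x) (ip v w)"
    if "x \<in> carrier Gt" "v \<in> ?V" "w \<in> ?V" for x v w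
    using inv that by (simp add: ip_def)
  ultimately have S: "gapped_system Q S"
    unfolding gapped_system_def S_def using ED(1,3) ip Hlin Hsym comm
    by (auto simp: linear_iso_on_def twist_def)
  \<comment> \<open>The two inclusions suffice, since nested gradings of one space coincide.\<close>
  have "?A \<subseteq> pos_space S"
    unfolding pos_space_def using HA GD(4)
    by (auto simp: S_def intro!: cseq.span_base exI[of _ "1::real"])
  moreover have "?B \<subseteq> neg_space S"
    unfolding neg_space_def using HB GD(5)
    by (auto simp: S_def intro!: cseq.span_base exI[of _ "-1::real"])
  moreover have "graded_by ?V (pos_space S) (neg_space S)" using gapped_graded[OF S] by (simp add: S_def)
  ultimately have "pos_space S = ?A" "neg_space S = ?B" using graded_by_eq[OF g] by blast+
  then show ?thesis using S that[of S] by (simp add: rep_of_def S_def)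
qed

subsection \<open>Deformation invariance\<close>

lemma sgn_space_graded:
  assumes S: "gapped_system Q S" and e: "e = 1 \<or> e = -1"
  shows "graded_by (sspace S) (sgn_space S e) (sgn_space S (-e))"
  using gapped_graded[OF S] graded_by_commute[OF gapped_graded[OF S]] e
  by (auto simp: sgn_space_simps)

lemma sgn_space_definite:
  assumes S: "gapped_system Q S" and e: "e = 1 \<or> e = -1" and v: "v \<in> sgn_space S e" "v \<noteq> 0"
  shows "e * Re (sinner S v (sham S v)) > 0"
proof -
  interpret selfadjoint "sspace S" "sinner S" "sham S" by (rule gapped_selfadjoint[OF S])
  show ?thesis
    using e eig_span_pos eig_span_neg v
    by (auto simp: sgn_space_simps pos_space_eig neg_space_eig)
qed

lemma sgn_space_orthogonal:
  assumes S: "gapped_system Q S" and v: "v \<in> sgn_space S e" "w \<in> sgn_space S (-e)"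
  shows "sinner S v w = 0"
proof -
  interpret selfadjoint "sspace S" "sinner S" "sham S" by (rule gapped_selfadjoint[OF S])
  show ?thesis
    by (rule eig_span_orthogonal[OF _ v[unfolded sgn_space_def]]) auto
qed

lemma sgn_space_action:
  assumes S: "gapped_system Q S" and e: "e = 1 \<or> e = -1" and x: "x \<in> carrier Gt"
    and v: "v \<in> sgn_space S e"
  shows "sact S x v \<in> sgn_space S (of_int (gr x) * e)"
  unfolding sgn_space_def
  by (rule gapped_action_eig_span[OF S x v[unfolded sgn_space_def]])
    (use signs(2)[OF x] in auto)

lemma sgn_projD:
  assumes S: "gapped_system Q S" and e: "e = 1 \<or> e = -1"
  shows "clinear_on (sspace S) (sspace S) (sgn_proj S e)"
    "\<And>v. v \<in> sspace S \<Longrightarrow> sgn_proj S e v \<in> sgn_space S e"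
    "\<And>v. v \<in> sspace S \<Longrightarrow> sgn_proj S e v \<in> sspace S"
    "\<And>v. v \<in> sspace S \<Longrightarrow> sgn_proj S e v + sgn_proj S (-e) v = v"
    "\<And>v. v \<in> sgn_space S e \<Longrightarrow> sgn_proj S e v = v"
    "\<And>v. v \<in> sgn_space S (-e) \<Longrightarrow> sgn_proj S e v = 0"
    "\<And>x v. x \<in> carrier Gt \<Longrightarrow> v \<in> sspace S \<Longrightarrow>
      sgn_proj S (of_int (gr x) * e) (sact S x v) = sact S x (sgn_proj S e v)"
    "sgn_space S e \<subseteq> sspace S"
proof -
  have e': "- e = 1 \<or> - e = -1" using e by auto
  note g = sgn_space_graded[OF S e]
  note A = twisted_actionD[OF gapped_systemD(5)[OF S]]
  show "clinear_on (sspace S) (sspace S) (sgn_proj S e)"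
    using clinear_on_gproj[OF g] graded_byD(4)[OF g] by (auto simp: clinear_on_def sgn_proj_def)
  show "\<And>v. v \<in> sspace S \<Longrightarrow> sgn_proj S e v \<in> sgn_space S e"
    "\<And>v. v \<in> sspace S \<Longrightarrow> sgn_proj S e v \<in> sspace S"
    using gproj_mem[OF g] graded_byD(4)[OF g] by (auto simp: sgn_proj_def)
  show "\<And>v. v \<in> sspace S \<Longrightarrow> sgn_proj S e v + sgn_proj S (-e) v = v"
    using gproj_commute[OF g] by (simp add: sgn_proj_def)
  show "\<And>v. v \<in> sgn_space S e \<Longrightarrow> sgn_proj S e v = v" "\<And>v. v \<in> sgn_space S (-e) \<Longrightarrow> sgn_proj S e v = 0"
    using gproj_id[OF g] by (simp_all add: sgn_proj_def)
  show "sgn_space S e \<subseteq> sspace S" by (rule graded_byD(4)[OF g])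
  fix x v assume x: "x \<in> carrier Gt" and v: "v \<in> sspace S"
  have ce: "of_int (gr x) * e = 1 \<or> of_int (gr x) * e = -1" using e signs(2)[OF x] by auto
  show "sgn_proj S (of_int (gr x) * e) (sact S x v) = sact S x (sgn_proj S e v)"
    unfolding sgn_proj_def
    by (rule gproj_map[OF g sgn_space_graded[OF S ce] v])
      (use A(2)[OF x] sgn_space_action[OF S e x] sgn_space_action[OF S e' x] in \<open>auto simp del: plus_fun_apply\<close>)
qed

text \<open>If a (not necessarily equivariant) linear isomorphism pairs the spectral subspaces
  positively along whole orbits, the invariant form obtained from it is nondegenerate on them.\<close>

lemma rep_iso_if_orbits_positive:
  assumes comp: "compact_space (gtop Gt)" and S: "gapped_system Q S" and T: "gapped_system Q T"
    and \<Psi>: "linear_iso_on (sspace S) (sspace T) \<Psi>"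
    and pos: "\<And>e v x. e = 1 \<or> e = -1 \<Longrightarrow> v \<in> sgn_space S e \<Longrightarrow> v \<noteq> 0 \<Longrightarrow> x \<in> carrier Gt \<Longrightarrow>
      0 < Re (sinner T (\<Psi> (sact S x v)) (sact T x (sgn_proj T e (\<Psi> v))))"
  shows "rep_iso Q (rep_of S) (rep_of T)"
proof -
  interpret G: group Gt by (rule group_Gt)
  let ?V = "sspace S" and ?W = "sspace T" and ?ip = "sinner T"
  note SG = gapped_systemD[OF S] and TG = gapped_systemD[OF T]
  have subV: "cseq.subspace ?V" and subW: "cseq.subspace ?W"
    using SG(1) TG(1) by (auto intro: fd_space_subspace)
  note VD = subspaceD[OF subV] and WD = subspaceD[OF subW]
  note R = twisted_actionD[OF SG(5)] and A = twisted_actionD[OF TG(5)]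
  note sq = TG(9)
  note sqD = sesquilinear_onD[OF sq]
  have \<Psi>lin: "clinear_on ?V ?W \<Psi>" using \<Psi> by (simp add: linear_iso_on_def)
  note \<Psi>D = clinear_onD[OF \<Psi>lin]
  have h0: "sesquilinear_on ?V ?W (\<lambda>v w. ?ip (\<Psi> v) w)"
    unfolding sesquilinear_on_def by (simp add: \<Psi>D sqD)
  obtain h where h: "sesquilinear_on ?V ?W h"
    and inv: "\<And>g v w. g \<in> carrier Gt \<Longrightarrow> v \<in> ?V \<Longrightarrow> w \<in> ?W \<Longrightarrow> h (sact S g v) (sact T g w) = twist (ph g) (h v w)"
    and hpos: "\<And>v w. v \<in> ?V \<Longrightarrow> w \<in> ?W \<Longrightarrow>
      \<forall>g\<in>carrier Gt. 0 < Re (?ip (\<Psi> (sact S g v)) (sact T g w)) \<Longrightarrow> 0 < Re (h v w)"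
    by (rule invariant_form_pos[OF comp SG(1) TG(1) SG(5) TG(5) h0 that])
  note hD = sesquilinear_onD[OF h]
  let ?s = "sgn_proj S" and ?t = "sgn_proj T"
  \<comment> \<open>The part of \<open>h\<close> that is block diagonal for the two gradings.
    Dropping the mixed blocks makes the resulting map even, and invariance persists because a group
    element fixes or exchanges the two remaining blocks.\<close>
  define k where "k v w = h (?s 1 v) (?t 1 w) + h (?s (-1) v) (?t (-1) w)" for v w
  have sV: "clinear_on ?V ?V (?s e)" and tW: "clinear_on ?W ?W (?t e)" if "e = 1 \<or> e = -1" for e
    using sgn_projD(1)[OF S that] sgn_projD(1)[OF T that] .
  note s1 = clinear_onD[OF sV[of 1]] clinear_onD[OF sV[of "-1"]]
  note t1 = clinear_onD[OF tW[of 1]] clinear_onD[OF tW[of "-1"]]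
  have k: "sesquilinear_on ?V ?W k"
    unfolding sesquilinear_on_def k_def by (simp add: s1 t1 hD algebra_simps)
  note kD = sesquilinear_onD[OF k]
  have kinv: "k (sact S x v) (sact T x w) = twist (ph x) (k v w)"
    if x: "x \<in> carrier Gt" and v: "v \<in> ?V" and w: "w \<in> ?W" for x v w
  proof -
    have "h (?s (of_int (gr x) * e) (sact S x v)) (?t (of_int (gr x) * e) (sact T x w)) =
        twist (ph x) (h (?s e v) (?t e w))" if e: "e = 1 \<or> e = -1" for e
      using sgn_projD(7)[OF S e x v] sgn_projD(7)[OF T e x w] inv[OF x]
        sgn_projD(3)[OF S e v] sgn_projD(3)[OF T e w] by simp
    from this[of 1] this[of "-1"] show ?thesis
      using signs(2)[OF x] by (auto simp: k_def)
  qed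
  \<comment> \<open>The conjugate of \<open>k v w\<close> is conjugate linear in \<open>w\<close>,
    as the Riesz representation asks, and linear in \<open>v\<close>, so that \<open>B\<close> comes
    out linear.\<close>
  have "\<exists>u\<in>?W. \<forall>w\<in>?W. ?ip w u = cnj (k v w)" if v: "v \<in> ?V" for v
    by (rule riesz_representation[OF TG(1) TG(2)]) (use v in \<open>simp_all add: kD\<close>)
  then obtain B where B: "\<And>v. v \<in> ?V \<Longrightarrow> B v \<in> ?W" "\<And>v w. v \<in> ?V \<Longrightarrow> w \<in> ?W \<Longrightarrow> ?ip w (B v) = cnj (k v w)"
    by metis
  have Buniq: "B v = u" if "v \<in> ?V" "u \<in> ?W" "\<And>w. w \<in> ?W \<Longrightarrow> ?ip w u = cnj (k v w)" for v u
    using that B by (intro inner_product_unique[OF TG(2) subW]) auto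
  have Blin: "clinear_on ?V ?W B"
    unfolding clinear_on_def
    by (intro conjI ballI allI funcsetI Buniq) (simp_all add: B VD WD kD sqD)
  \<comment> \<open>Positivity along orbits enters here, with \<open>?t e (\<Psi> v)\<close> as the
    test vector that a nonzero \<open>v\<close> of sign \<open>e\<close> cannot annihilate.\<close>
  have nz: "v = 0" if v: "v \<in> ?V" and e: "e = 1 \<or> e = -1" "v \<in> sgn_space S e" and z: "\<And>w. w \<in> ?W \<Longrightarrow> h v (?t e w) = 0" for v e
  proof (rule ccontr)
    assume "v \<noteq> 0"
    then have "0 < Re (h v (?t e (\<Psi> v)))"
      using v sgn_projD(3)[OF T e(1)] \<Psi>D(1) pos[OF e] by (intro hpos) auto
    then show False using z[OF \<Psi>D(1)[OF v]] by simp
  qed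
  have Binj: "inj_on B ?V"
  proof (rule clinear_on_inj[OF Blin subV])
    fix v assume v: "v \<in> ?V" "B v = 0"
    have k0: "k v w = 0" if "w \<in> ?W" for w
      using B(2)[OF v(1) that] v(2) sesquilinear_on_0(1)[OF sq subW subW that] by simp
    have "?s e v = 0" if e: "e = 1 \<or> e = -1" for e
    proof (rule nz[OF _ e])
      show "?s e v \<in> ?V" "?s e v \<in> sgn_space S e" using sgn_projD(2,3)[OF S e v(1)] by auto
      fix w assume w: "w \<in> ?W"
      have te: "?t e w \<in> ?W" "?t e w \<in> sgn_space T e" using sgn_projD(2,3)[OF T e w] by auto
      have e': "- e = 1 \<or> - e = -1" using e by auto
      have "?t e (?t e w) = ?t e w" "?t (-e) (?t e w) = 0"
        using sgn_projD(5)[OF T e te(2)] sgn_projD(6)[OF T e', of "?t e w"] te(2) by simp_all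
      then have "k v (?t e w) = h (?s e v) (?t e w)"
        using e sesquilinear_on_0(1)[OF h subV subW sgn_projD(3)[OF S e' v(1)]] by (auto simp: k_def)
      then show "h (?s e v) (?t e w) = 0" using k0[OF te(1)] by simp
    qed
    from this[of 1] this[of "-1"] show "v = 0" using sgn_projD(4)[OF S _ v(1), of 1] by simp
  qed
  \<comment> \<open>Here \<open>\<Psi>\<close> compares dimensions: \<open>B\<close> followed by the
    inverse of \<open>\<Psi>\<close> is an injective endomorphism, hence onto.\<close>
  have "B ` ?V = ?W"
  proof -
    let ?i = "inv_into ?V \<Psi>"
    have i: "linear_iso_on ?W ?V ?i" by (rule clinear_on_inv_into[OF \<Psi> subV])
    then have il: "clinear_on ?W ?V ?i" "inj_on ?i ?W" by (auto simp: linear_iso_on_def bij_betw_def)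
    have "inj_on (\<lambda>v. ?i (B v)) ?V"
      using il(2) Binj B(1) by (auto simp: inj_on_def)
    then have s: "(\<lambda>v. ?i (B v)) ` ?V = ?V"
      by (rule clinear_on_inj_surj[OF SG(1) clinear_on_compose[OF Blin il(1)]])
    have "w \<in> B ` ?V" if w: "w \<in> ?W" for w
    proof -
      obtain v where v: "v \<in> ?V" "?i (B v) = ?i w" using clinear_onD(1)[OF il(1) w] s by force
      then show ?thesis using inj_onD[OF il(2) v(2) B(1)[OF v(1)] w] by blast
    qed
    then show ?thesis using B(1) by blast
  qed
  then have Biso: "linear_iso_on ?V ?W B" using Blin Binj by (simp add: linear_iso_on_def bij_betw_def)
  have Beq: "B (sact S x v) = sact T x (B v)" if x: "x \<in> carrier Gt" and v: "v \<in> ?V" for x v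
  proof (rule Buniq)
    fix w assume w: "w \<in> ?W"
    define w' where "w' = sact T (inv\<^bsub>Gt\<^esub> x) w"
    have w': "w' \<in> ?W" "w = sact T x w'"
      using A(1)[OF G.inv_closed[OF x] w] A(6)[OF x w] by (auto simp: w'_def)
    show "?ip w (sact T x (B v)) = cnj (k (sact S x v) w)"
      unfolding w'(2) kinv[OF x v w'(1)] TG(6)[OF x w'(1) B(1)[OF v]] B(2)[OF v w'(1)] by simp
  qed (use R(1)[OF x v] A(1)[OF x B(1)[OF v]] in auto)
  \<comment> \<open>The component of \<open>B v\<close> of the opposite sign is orthogonal to
    itself, as the mixed blocks of \<open>k\<close> vanish and the spectral subspaces of
    \<open>T\<close> are orthogonal.\<close>
  have Bgr: "B v \<in> sgn_space T e" if e: "e = 1 \<or> e = -1" and v: "v \<in> sgn_space S e" for e v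
  proof -
    have e': "- e = 1 \<or> - e = -1" using e by auto
    have vV: "v \<in> ?V" using sgn_projD(8)[OF S e] v by blast
    let ?n = "?t (-e) (B v)"
    have n: "?n \<in> ?W" "?n \<in> sgn_space T (-e)" using sgn_projD(2,3)[OF T e' B(1)[OF vV]] by auto
    have p: "?t e (B v) \<in> ?W" "?t e (B v) \<in> sgn_space T e" using sgn_projD(2,3)[OF T e B(1)[OF vV]] by auto
    have "?s (-e) v = 0" using sgn_projD(6)[OF S e'] v by simp
    moreover have "?t e ?n = 0" using sgn_projD(6)[OF T e n(2)] .
    ultimately have "k v ?n = 0"
      using e sesquilinear_on_0[OF h subV subW] sgn_projD(3)[OF S _ vV] sgn_projD(3)[OF T _ n(1)]
      by (auto simp: k_def)
    then have "?ip ?n (B v) = 0" using B(2)[OF vV n(1)] by simp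
    moreover have "?ip ?n (?t e (B v)) = 0"
      by (rule sgn_space_orthogonal[OF T n(2)]) (use p in simp)
    moreover have "?ip ?n (B v) = ?ip ?n (?t e (B v)) + ?ip ?n ?n"
      using sqD(3)[OF n(1) p(1) n(1)] sgn_projD(4)[OF T e B(1)[OF vV]] by simp
    ultimately have "?n = 0" using inner_product_onD(4)[OF TG(2) subW n(1)] by simp
    then show ?thesis using sgn_projD(4)[OF T e B(1)[OF vV]] p by simp
  qed
  show ?thesis
    unfolding rep_iso_def rep_of_simps
    using Biso Beq Bgr[of 1] Bgr[of "-1"] by (intro exI[of _ B]) (auto simp: sgn_space_simps)
qed

lemma system_familyD:
  assumes "system_family Q F T"
  shows "\<And>t. t \<in> {0..1} \<Longrightarrow> gapped_system Q (F t)" "topspace T = Sigma {0..1} (\<lambda>t. sspace (F t))"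
    "continuous_map (subtopology (prod_topology T T) {(x, y). fst x = fst y}) euclidean
       (\<lambda>(x, y). sinner (F (fst x)) (snd x) (snd y))"
    "continuous_map T T (\<lambda>(t, v). (t, sham (F t) v))"
    "continuous_map (prod_topology (gtop (qext Q)) T) T (\<lambda>(g, (t, v)). (t, sact (F t) g v))"
    "\<And>t. t \<in> {0..1} \<Longrightarrow> \<exists>U W \<Phi>. openin (top_of_set {0..1}) U \<and> t \<in> U \<and> fd_space W \<and>
        (\<forall>s\<in>U. linear_iso_on W (sspace (F s)) (\<Phi> s)) \<and>
        homeomorphic_map (prod_topology (top_of_set U) (top_of_set W))
          (subtopology T (Sigma U (\<lambda>t. sspace (F t)))) (\<lambda>(s, w). (s, \<Phi> s w))"
  using assms unfolding system_family_def hermitian_bundle_def by blast+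

text \<open>At parameter \<open>t\<close> itself the first alternative only fails on the opposite spectral
  subspace, where the second one holds; the tube lemma then spreads this to a neighbourhood.\<close>

lemma orbits_positive_near:
  assumes comp: "compact_space (gtop Gt)" and F: "system_family Q F T"
    and t: "t \<in> {0..1}" and e: "e = 1 \<or> e = -1"
    and U: "openin (top_of_set {0..1}) U" "t \<in> U" and W: "fd_space W"
    and \<Phi>: "\<And>s. s \<in> U \<Longrightarrow> linear_iso_on W (sspace (F s)) (\<Phi> s)"
    and hm: "homeomorphic_map (prod_topology (top_of_set U) (top_of_set W))
          (subtopology T (Sigma U (\<lambda>t. sspace (F t)))) (\<lambda>(s, w). (s, \<Phi> s w))"
  obtains N where "openin (top_of_set {0..1}) N" "t \<in> N" "N \<subseteq> U"
    "\<And>s v g. s \<in> N \<Longrightarrow> v \<in> sgn_space (F s) e \<Longrightarrow> v \<noteq> 0 \<Longrightarrow> g \<in> carrier Gt \<Longrightarrow>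
      0 < Re (sinner (F t) (\<Phi> t (inv_into W (\<Phi> s) (sact (F s) g v)))
        (sact (F t) g (sgn_proj (F t) e (\<Phi> t (inv_into W (\<Phi> s) v)))))"
proof -
  note FD = system_familyD[OF F]
  have U01: "s \<in> {0..1}" if "s \<in> U" for s using openin_subset[OF U(1)] that by auto
  note Ft = FD(1)[OF t]
  note tG = gapped_systemD[OF Ft]
  note subW = fd_space_subspace[OF W]
  obtain I b where b: "reduced_basis W I b" using reduced_basis_exists[OF W] by auto
  define S where "S = unit_sphere W I"
  have SW: "x \<in> W" "x \<noteq> 0" if "x \<in> S" for x using unit_sphere_nonzero that S_def by blast+
  have compS: "compact_space (top_of_set S)"
    using compact_unit_sphere[OF b] unfolding S_def
    by (simp add: compactin_subtopology compact_space_def)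
  define V where "V s = sspace (F s)" for s
  have \<Phi>lin: "clinear_on W (V s) (\<Phi> s)" and \<Phi>bij: "bij_betw (\<Phi> s) W (V s)" if "s \<in> U" for s
    using \<Phi>[OF that] by (auto simp: linear_iso_on_def V_def)
  \<comment> \<open>Parameters, group elements and unit vectors of the model fibre. The last two
    factors are compact, as the tube lemma will require.\<close>
  define Z where "Z = prod_topology (top_of_set U) (prod_topology (gtop Gt) (top_of_set S))"
  have topZ: "topspace Z = U \<times> carrier Gt \<times> S" by (simp add: Z_def)
  have zs: "continuous_map Z (top_of_set U) fst"
    and zg: "continuous_map Z (gtop Gt) (\<lambda>z. fst (snd z))"
    and zx': "continuous_map Z (top_of_set S) (\<lambda>z. snd (snd z))"
    unfolding Z_def
    using continuous_map_compose[OF continuous_map_snd continuous_map_fst]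
      continuous_map_compose[OF continuous_map_snd continuous_map_snd]
    by (auto simp: comp_def continuous_map_fst)
  have zx: "continuous_map Z (top_of_set W) (\<lambda>z. snd (snd z))"
    using zx' SW by (auto simp: continuous_map_in_subtopology)
  let ?XT = "subtopology T (Sigma U (\<lambda>t. sspace (F t)))"
  let ?XW = "prod_topology (top_of_set U) (top_of_set W)"
  obtain k where hk: "homeomorphic_maps ?XW ?XT (\<lambda>(s, w). (s, \<Phi> s w)) k"
    using hm unfolding homeomorphic_map_maps by blast
  have k: "continuous_map ?XT ?XW k" "\<And>y. y \<in> topspace ?XT \<Longrightarrow> (\<lambda>(s, w). (s, \<Phi> s w)) (k y) = y"
    and hmc: "continuous_map ?XW ?XT (\<lambda>(s, w). (s, \<Phi> s w))"
    using hk unfolding homeomorphic_maps_def by blast+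
  have topXT: "topspace ?XT = Sigma U V"
    using FD(2) U01 by (auto simp: V_def)
  define a where "a z = (fst z, \<Phi> (fst z) (snd (snd z)))" for z :: "real \<times> 'h \<times> vec"
  have a: "continuous_map Z ?XT a"
    using continuous_map_compose[OF continuous_map_pairedI[OF zs zx] hmc]
    by (simp add: comp_def a_def[abs_def])
  then have aT: "continuous_map Z T a" by (simp add: continuous_map_in_subtopology)
  define c where "c z = (fst z, sact (F (fst z)) (fst (snd z)) (\<Phi> (fst z) (snd (snd z))))" for z :: "real \<times> 'h \<times> vec"
  have c: "continuous_map Z T c"
    using continuous_map_compose[OF continuous_map_pairedI[OF zg aT] FD(5)]
    by (simp add: comp_def a_def c_def[abs_def])
  have aV: "\<Phi> (fst z) (snd (snd z)) \<in> V (fst z)" if "z \<in> topspace Z" for z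
    using that SW(1) clinear_onD(1)[OF \<Phi>lin] by (auto simp: topZ)
  have cV: "sact (F (fst z)) (fst (snd z)) (\<Phi> (fst z) (snd (snd z))) \<in> V (fst z)" if z: "z \<in> topspace Z" for z
    using twisted_actionD(1)[OF gapped_systemD(5)[OF FD(1)]] aV[OF z] z U01 by (auto simp: topZ V_def)
  have cXT: "continuous_map Z ?XT c"
    using c cV by (auto simp: continuous_map_in_subtopology c_def topZ V_def)
  \<comment> \<open>The translate of a vector at the parameter \<open>s\<close>, in coordinates of
    the model fibre. It is continuous since the trivialization has the continuous inverse
    \<open>k\<close>, and it can be moved to the fibre at \<open>t\<close>.\<close>
  define y where "y z = snd (k (c z))" for z
  have y: "continuous_map Z (top_of_set W) y"
    using continuous_map_compose[OF continuous_map_compose[OF cXT k(1)] continuous_map_snd]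
    by (simp add: comp_def y_def[abs_def])
  have y_eq: "y z = inv_into W (\<Phi> (fst z)) (sact (F (fst z)) (fst (snd z)) (\<Phi> (fst z) (snd (snd z))))"
    if z: "z \<in> topspace Z" for z
  proof -
    have "c z \<in> topspace ?XT" using continuous_map_image_subset_topspace[OF cXT] z by blast
    then have "(fst (k (c z)), \<Phi> (fst (k (c z))) (y z)) = c z" using k(2)[of "c z"] by (simp add: y_def case_prod_unfold)
    then have e: "\<Phi> (fst z) (y z) = sact (F (fst z)) (fst (snd z)) (\<Phi> (fst z) (snd (snd z)))" by (auto simp: c_def)
    have yW: "y z \<in> W" using y z by (auto simp: continuous_map_in_subtopology)
    have inj: "inj_on (\<Phi> (fst z)) W" using \<Phi>bij[of "fst z"] z by (auto simp: topZ bij_betw_def)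
    show ?thesis using inv_into_f_f[OF inj yW] e by simp
  qed
  have t1: "continuous_map Z (top_of_set (V t)) (\<lambda>z. \<Phi> t (y z))"
    by (rule continuous_map_clinear[OF W \<Phi>lin[OF U(2)] y])
  have "continuous_map Z (top_of_set (V t)) (\<lambda>z. sgn_proj (F t) e (\<Phi> t (snd (snd z))))"
    unfolding V_def
    by (rule continuous_map_clinear[OF tG(1) sgn_projD(1)[OF Ft e]
          continuous_map_clinear[OF W \<Phi>lin[OF U(2), unfolded V_def] zx]])
  then have t2: "continuous_map Z (top_of_set (V t))
      (\<lambda>z. sact (F t) (fst (snd z)) (sgn_proj (F t) e (\<Phi> t (snd (snd z)))))"
    using continuous_map_action[OF tG(1) tG(5) zg] unfolding V_def by blast
  define f1 where "f1 z = Re (sinner (F t) (\<Phi> t (y z))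
      (sact (F t) (fst (snd z)) (sgn_proj (F t) e (\<Phi> t (snd (snd z))))))" for z
  have f1: "continuous_map Z euclidean f1"
    unfolding f1_def using t1 t2 unfolding V_def
    by (intro continuous_map_Re continuous_map_sesquilinear[OF tG(1) tG(1)
          tG(9)])
  define f2 where "f2 z = e * Re (sinner (F (fst z)) (\<Phi> (fst z) (snd (snd z)))
      (sham (F (fst z)) (\<Phi> (fst z) (snd (snd z)))))" for z :: "real \<times> 'h \<times> vec"
  have f2: "continuous_map Z euclidean f2"
  proof -
    have ha: "continuous_map Z T (\<lambda>z. (fst z, sham (F (fst z)) (\<Phi> (fst z) (snd (snd z)))))"
      using continuous_map_compose[OF aT FD(4)] by (simp add: comp_def a_def)
    have "continuous_map Z (subtopology (prod_topology T T) {(x, y). fst x = fst y})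
        (\<lambda>z. (a z, (fst z, sham (F (fst z)) (\<Phi> (fst z) (snd (snd z))))))"
      unfolding continuous_map_in_subtopology
      by (intro conjI continuous_map_pairedI aT ha) (auto simp: a_def)
    from continuous_map_compose[OF this FD(3)]
    have "continuous_map Z euclidean (\<lambda>z. sinner (F (fst z)) (\<Phi> (fst z) (snd (snd z)))
      (sham (F (fst z)) (\<Phi> (fst z) (snd (snd z)))))" by (simp add: comp_def a_def)
    then show ?thesis
      unfolding f2_def by (intro continuous_map_real_mult continuous_map_Re) auto
  qed
  \<comment> \<open>For a nonzero vector in the spectral subspace of sign \<open>e\<close> at the
    parameter \<open>s\<close>, the signed energy \<open>f2\<close> is positive, so membership in
    \<open>O1\<close> leaves only \<open>f1 > 0\<close>. The definition involves a spectral
    projection at \<open>t\<close> alone, which does not vary.\<close>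
  define O1 where "O1 = {z \<in> topspace Z. f1 z \<in> {0<..}} \<union> {z \<in> topspace Z. f2 z \<in> {..<0}}"
  have O1: "openin Z O1"
    unfolding O1_def by (intro openin_Un openin_continuous_map_preimage[OF f1] openin_continuous_map_preimage[OF f2]) auto
  have sub: "{t} \<times> (carrier Gt \<times> S) \<subseteq> O1"
  proof
    fix z assume "z \<in> {t} \<times> (carrier Gt \<times> S)"
    then obtain g x where z: "z = (t, g, x)" and g: "g \<in> carrier Gt" and x: "x \<in> S" by auto
    have zZ: "z \<in> topspace Z" using z g x U(2) by (simp add: topZ)
    let ?v = "\<Phi> t x" and ?p = "sgn_proj (F t)"
    have v: "?v \<in> sspace (F t)" using aV[OF zZ] by (simp add: z V_def)
    have e': "- e = 1 \<or> - e = -1" using e by auto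
    have p: "?p e ?v \<in> sspace (F t)" "?p (-e) ?v \<in> sspace (F t)" "?p e ?v + ?p (-e) ?v = ?v"
      "?p e ?v \<in> sgn_space (F t) e" "?p (-e) ?v \<in> sgn_space (F t) (-e)"
      using sgn_projD(2-4)[OF Ft e v] sgn_projD(2-4)[OF Ft e' v] by auto
    have "\<Phi> t (y z) = sact (F t) g ?v"
      using y_eq[OF zZ] cV[OF zZ] \<Phi>bij[OF U(2)] by (simp add: z bij_betw_inv_into_right)
    \<comment> \<open>At the parameter \<open>t\<close> both vectors are translated by
      \<open>g\<close> in the same fibre, which changes the pairing only by \<open>twist\<close> and
      keeps its real part.\<close>
    then have "f1 z = Re (sinner (F t) ?v (?p e ?v))"
      using tG(6)[OF g v p(1)] by (simp add: f1_def z)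
    also have "\<dots> = Re (sinner (F t) (?p e ?v) (?p e ?v))"
      using sesquilinear_onD(1)[OF tG(9) p(1) p(2) p(1)]
        sgn_space_orthogonal[OF Ft p(5), of "?p e ?v"] p(3,4) by simp
    finally have f1z: "f1 z = Re (sinner (F t) (?p e ?v) (?p e ?v))" .
    show "z \<in> O1"
    proof (cases "?p e ?v = 0")
      case False
      then have "f1 z > 0" using inner_product_onD(3)[OF tG(2) tG(8) p(1)] f1z by simp
      then show ?thesis using zZ by (simp add: O1_def)
    next
      case True
      then have "?v \<in> sgn_space (F t) (-e)" using p(3,5) by simp
      moreover have "?v \<noteq> 0"
        using \<Phi>bij[OF U(2)] SW[OF x] clinear_on_0[OF \<Phi>lin[OF U(2)] subW] subspaceD(1)[OF subW]
        by (metis bij_betw_imp_inj_on inj_onD)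
      ultimately have "f2 z < 0" using sgn_space_definite[OF Ft e', of ?v] by (simp add: f2_def z)
      then show ?thesis using zZ by (simp add: O1_def)
    qed
  qed
  have "compactin (prod_topology (gtop Gt) (top_of_set S)) (carrier Gt \<times> S)"
    using compactin_Times[of "gtop Gt" "top_of_set S" "carrier Gt" S] comp compS
    by (simp add: compact_space_def)
  then obtain N N' where N: "openin (top_of_set U) N" "t \<in> N" "carrier Gt \<times> S \<subseteq> N'" "N \<times> N' \<subseteq> O1"
    using tube_lemma_right[OF O1[unfolded Z_def]] U(2) sub by (metis topspace_euclidean_subtopology)
  show ?thesis
  proof (rule that)
    show "openin (top_of_set {0..1}) N" using openin_trans N(1) U(1) by blast
    show "t \<in> N" by fact
    show NU: "N \<subseteq> U" using openin_subset[OF N(1)] by simp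
    fix s v g assume s: "s \<in> N" and v: "v \<in> sgn_space (F s) e" "v \<noteq> 0" and g: "g \<in> carrier Gt"
    have sU: "s \<in> U" using s NU by blast
    note Fs = FD(1)[OF U01[OF sU]]
    note sG = gapped_systemD[OF Fs]
    note As = twisted_actionD[OF sG(5)] and At = twisted_actionD[OF tG(5)]
    have vV: "v \<in> sspace (F s)" using sgn_projD(8)[OF Fs e] v by blast
    let ?i = "inv_into W (\<Phi> s)"
    have i: "linear_iso_on (sspace (F s)) W ?i" by (rule clinear_on_inv_into[OF \<Phi>[OF sU] subW])
    then have il: "clinear_on (sspace (F s)) W ?i" by (simp add: linear_iso_on_def)
    note iD = clinear_onD[OF il] and PtD = clinear_onD[OF \<Phi>lin[OF U(2), unfolded V_def]]
      and PsD = clinear_onD[OF \<Phi>lin[OF sU, unfolded V_def]]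
    have \<Phi>i: "\<Phi> s (?i v) = v" using \<Phi>bij[OF sU] vV by (simp add: bij_betw_inv_into_right V_def)
    then have "?i v \<noteq> 0" using v clinear_on_0[OF \<Phi>lin[OF sU] subW] by auto
    \<comment> \<open>Both vectors in the pairing scale with \<open>v\<close>, so it suffices that
      the coordinates of \<open>v\<close> point in a direction on the unit sphere.\<close>
    then obtain r x where r: "r > 0" and x: "x \<in> S" and ix: "?i v = cscale (of_real r) x"
      using unit_sphere_scale[OF b iD(1)[OF vV]] unfolding S_def by metis
    define u where "u = \<Phi> s x"
    have xW: "x \<in> W" using SW[OF x] by blast
    have u: "u \<in> sspace (F s)" "?i u = x" "v = cscale (of_real r) u"
      using PsD(1)[OF xW] \<Phi>bij[OF sU] xW \<Phi>i PsD(3)[OF xW] ix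
      by (auto simp: u_def bij_betw_inv_into_left)
    have "u = cscale (of_real (1 / r)) v" using u(3) r by simp
    then have us: "u \<in> sgn_space (F s) e"
      using v(1) subspaceD(3)[OF graded_byD(1)[OF sgn_space_graded[OF Fs e]]] by metis
    have "u \<noteq> 0" using u v(2) by auto
    then have "e * Re (sinner (F s) u (sham (F s) u)) > 0" by (rule sgn_space_definite[OF Fs e us])
    moreover have "(s, g, x) \<in> O1" using N(3,4) s g x by blast
    ultimately have "f1 (s, g, x) > 0" and sZ: "(s, g, x) \<in> topspace Z" by (auto simp: O1_def f2_def u_def)
    then have p: "0 < Re (sinner (F t) (\<Phi> t (?i (sact (F s) g u)))
        (sact (F t) g (sgn_proj (F t) e (\<Phi> t x))))"
      using y_eq[OF sZ] by (simp add: f1_def u_def)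
    have 1: "\<Phi> t (?i (sact (F s) g v)) = cscale (of_real r) (\<Phi> t (?i (sact (F s) g u)))"
      using As(3)[OF g u(1), of "of_real r"] As(1)[OF g u(1)] by (simp add: u(3) iD PtD)
    have m1: "\<Phi> t (?i (sact (F s) g u)) \<in> sspace (F t)"
      using As(1)[OF g u(1)] by (simp add: iD PtD)
    have m2: "sgn_proj (F t) e (\<Phi> t x) \<in> sspace (F t)"
      using sgn_projD(3)[OF Ft e PtD(1)[OF xW]] .
    have 2: "sact (F t) g (sgn_proj (F t) e (\<Phi> t (?i v))) = cscale (of_real r) (sact (F t) g (sgn_proj (F t) e (\<Phi> t x)))"
      using At(3)[OF g m2, of "of_real r"] clinear_onD(3)[OF sgn_projD(1)[OF Ft e] PtD(1)[OF xW], of "of_real r"]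
      by (simp add: ix PtD(3)[OF xW])
    note sq = sesquilinear_onD[OF tG(9)]
    have "sinner (F t) (\<Phi> t (?i (sact (F s) g v))) (sact (F t) g (sgn_proj (F t) e (\<Phi> t (?i v)))) =
      of_real (r * r) * sinner (F t) (\<Phi> t (?i (sact (F s) g u))) (sact (F t) g (sgn_proj (F t) e (\<Phi> t x)))"
      unfolding 1 2 using m1 At(1)[OF g m2] subspaceD(3)[OF tG(8)] by (simp add: sq)
    then show "0 < Re (sinner (F t) (\<Phi> t (?i (sact (F s) g v))) (sact (F t) g (sgn_proj (F t) e (\<Phi> t (?i v)))))"
      using p r by (simp del: of_real_mult)
  qed
qed

text \<open>The linear isomorphism between nearby fibres is transport through the model fibre of a
  local trivialization. The neighbourhoods for the two signs are intersected.\<close>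

lemma family_locally_constant:
  assumes comp: "compact_space (gtop Gt)" and F: "system_family Q F T" and t: "t \<in> {0..1}"
  shows "\<exists>N. openin (top_of_set {0..1}) N \<and> t \<in> N \<and> (\<forall>s\<in>N. rep_iso Q (rep_of (F t)) (rep_of (F s)))"
proof -
  note FD = system_familyD[OF F]
  obtain U W \<Phi> where U: "openin (top_of_set {0..1}) U" "t \<in> U" and W: "fd_space W"
    and \<Phi>: "\<And>s. s \<in> U \<Longrightarrow> linear_iso_on W (sspace (F s)) (\<Phi> s)"
    and hm: "homeomorphic_map (prod_topology (top_of_set U) (top_of_set W))
          (subtopology T (Sigma U (\<lambda>t. sspace (F t)))) (\<lambda>(s, w). (s, \<Phi> s w))"
    using FD(6)[OF t] by blast
  define P where "P e s \<longleftrightarrow> (\<forall>v g. v \<in> sgn_space (F s) e \<longrightarrow> v \<noteq> 0 \<longrightarrow> g \<in> carrier Gt \<longrightarrow>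
      0 < Re (sinner (F t) (\<Phi> t (inv_into W (\<Phi> s) (sact (F s) g v)))
        (sact (F t) g (sgn_proj (F t) e (\<Phi> t (inv_into W (\<Phi> s) v))))))" for e s
  have ex: "\<exists>N. openin (top_of_set {0..1}) N \<and> t \<in> N \<and> N \<subseteq> U \<and> (\<forall>s\<in>N. P e s)" if e: "e = 1 \<or> e = -1" for e
    by (rule orbits_positive_near[OF comp F t e U W \<Phi> hm]) (auto simp: P_def)
  obtain N1 where N1: "openin (top_of_set {0..1}) N1" "t \<in> N1" "N1 \<subseteq> U" "\<forall>s\<in>N1. P 1 s"
    using ex[of 1] by auto
  obtain N2 where N2: "openin (top_of_set {0..1}) N2" "t \<in> N2" "\<forall>s\<in>N2. P (-1) s"
    using ex[of "-1"] by auto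
  have "rep_iso Q (rep_of (F t)) (rep_of (F s))" if s: "s \<in> N1 \<inter> N2" for s
  proof -
    have sU: "s \<in> U" "s \<in> {0..1}" using s N1(3) openin_subset[OF U(1)] by auto
    note Fs = FD(1)[OF sU(2)] and Ft = FD(1)[OF t]
    have \<Psi>: "linear_iso_on (sspace (F s)) (sspace (F t)) (\<lambda>v. \<Phi> t (inv_into W (\<Phi> s) v))"
      by (rule linear_iso_on_compose[OF clinear_on_inv_into[OF \<Phi>[OF sU(1)] fd_space_subspace[OF W]] \<Phi>[OF U(2)]])
    have "rep_iso Q (rep_of (F s)) (rep_of (F t))"
      by (rule rep_iso_if_orbits_positive[OF comp Fs Ft \<Psi>]) (use s N1(4) N2(3) in \<open>auto simp: P_def\<close>)
    then show ?thesis by (rule rep_iso_sym[OF twisted_rep_rep_of[OF Fs] twisted_rep_rep_of[OF Ft]])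
  qed
  then show ?thesis using N1 N2 by (intro exI[of _ "N1 \<inter> N2"]) auto
qed

text \<open>A locally constant isomorphism class is constant on the connected interval; the
  isomorphisms at both ends then connect the given systems.\<close>

lemma same_phase_imp_rep_iso:
  assumes comp: "compact_space (gtop Gt)" and S: "gapped_system Q S" and S': "gapped_system Q S'"
    and "same_phase Q S S'"
  shows "rep_iso Q (rep_of S) (rep_of S')"
proof -
  obtain F T where F: "system_family Q F T" and i0: "system_iso Q S (F 0)" and i1: "system_iso Q S' (F 1)"
    using assms(4) unfolding same_phase_def by blast
  note FD = system_familyD[OF F]
  have rep: "twisted_rep Q (rep_of (F t))" if "t \<in> {0..1}" for t by (rule twisted_rep_rep_of[OF FD(1)[OF that]])
  have "rep_iso Q (rep_of (F 0)) (rep_of (F 1))"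
  proof (rule connected_equivalence_relation[of "{0..1::real}" 0 1 "\<lambda>a b. rep_iso Q (rep_of (F a)) (rep_of (F b))"])
    show "connected {0..1::real}" by simp
    show "rep_iso Q (rep_of (F b)) (rep_of (F a))"
      if "rep_iso Q (rep_of (F a)) (rep_of (F b))" "a \<in> {0..1}" "b \<in> {0..1}" for a b
      using rep_iso_sym[OF rep[OF that(2)] rep[OF that(3)] that(1)] .
    show "rep_iso Q (rep_of (F a)) (rep_of (F d))"
      if "rep_iso Q (rep_of (F a)) (rep_of (F b))" "rep_iso Q (rep_of (F b)) (rep_of (F d))" for a b d
      using rep_iso_trans[OF that] .
    show "\<exists>N. openin (top_of_set {0..1}) N \<and> a \<in> N \<and> (\<forall>x\<in>N. rep_iso Q (rep_of (F a)) (rep_of (F x)))"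
      if "a \<in> {0..1}" for a
      using family_locally_constant[OF comp F that] .
  qed auto
  moreover have "rep_iso Q (rep_of S) (rep_of (F 0))" by (rule system_iso_imp_rep_iso[OF S i0])
  moreover have "rep_iso Q (rep_of (F 1)) (rep_of S')"
    using system_iso_imp_rep_iso[OF S' i1] rep_iso_sym[OF twisted_rep_rep_of[OF S'] rep[of 1]] by simp
  ultimately show ?thesis using rep_iso_trans by blast
qed

subsection \<open>Systems with isomorphic representations are in the same phase\<close>

text \<open>The path flattens the first Hamiltonian to the grading operator, then interpolates the
  inner products, and then unflattens to the second Hamiltonian.\<close>

lemma same_phase_flattening:
  assumes S: "gapped_system Q S" and T: "gapped_system Q T" and sp: "sspace T = sspace S"
    and act: "sact T = sact S" and pos: "pos_space T = pos_space S" and neg: "neg_space T = neg_space S"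
  shows "same_phase Q S T"
proof -
  let ?V = "sspace S" and ?\<rho> = "sact S" and ?\<epsilon> = "grading (pos_space S) (neg_space S)"
  note SG = gapped_systemD[OF S] and TG = gapped_systemD[OF T, unfolded sp act]
  note subV = SG(8)
  note VD = subspaceD[OF subV]
  note g = gapped_graded[OF S]
  note R = twisted_actionD[OF SG(5)]
  note sq0 = SG(9) and sq1 = inner_product_onD(1)[OF TG(2) subV]
  note q0 = sesquilinear_onD[OF sq0] and q1 = sesquilinear_onD[OF sq1]
  interpret SS: selfadjoint ?V "sinner S" "sham S" by (rule gapped_selfadjoint[OF S])
  interpret TT: selfadjoint ?V "sinner T" "sham T" using gapped_selfadjoint[OF T] by (simp add: sp)
  have sgnT: "sgn_space T e = sgn_space S e" if "e = 1 \<or> e = -1" for e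
    using that pos neg by (auto simp: sgn_space_simps)
  have H0lin: "clinear_on ?V ?V (sham S)" and H1lin: "clinear_on ?V ?V (sham T)"
    using SG(3) TG(3) by (auto simp: linear_iso_on_def)
  have \<epsilon>lin: "clinear_on ?V ?V ?\<epsilon>" by (rule clinear_on_grading[OF g subV])
  note H0 = clinear_onD[OF H0lin] and H1 = clinear_onD[OF H1lin] and \<epsilon> = clinear_onD[OF \<epsilon>lin]
  \<comment> \<open>The two systems share their spectral subspaces, which are therefore orthogonal
    for both inner products.\<close>
  have \<epsilon>sym0: "sinner S (?\<epsilon> v) x = sinner S v (?\<epsilon> x)" and \<epsilon>sym1: "sinner T (?\<epsilon> v) x = sinner T v (?\<epsilon> x)"
    if "v \<in> ?V" "x \<in> ?V" for v x
    using that sgn_space_orthogonal[OF S, of _ 1] sgn_space_orthogonal[OF S, of _ "-1"]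
      sgn_space_orthogonal[OF T, of _ 1] sgn_space_orthogonal[OF T, of _ "-1"] pos neg
    by (auto intro!: grading_symmetric[OF g subV sq0] grading_symmetric[OF g subV sq1] simp: sgn_space_simps)
  have \<epsilon>comm: "?\<rho> x (?\<epsilon> v) = cscale (of_int (gr x)) (?\<epsilon> (?\<rho> x v))" if "x \<in> carrier Gt" "v \<in> ?V" for x v
    using grading_commute[OF twisted_rep_rep_of[OF S]] that by simp
  \<comment> \<open>The weight \<open>u\<close> of the first Hamiltonian lives on the first third of
    the interval and the weight \<open>w\<close> of the second on the last third. The inner product
    moves with \<open>a\<close> in the middle third, where only the grading operator is
    left.\<close>
  define a u w where "a t = max 0 (min 1 (3 * t - 1))" and "u t = max 0 (1 - 3 * t)" and "w t = max 0 (3 * t - 2)" for t :: real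
  have w01: "0 \<le> a t" "a t \<le> 1" "0 \<le> u t" "0 \<le> w t" "u t \<noteq> 0 \<Longrightarrow> a t = 0" "w t \<noteq> 0 \<Longrightarrow> a t = 1" for t
    by (auto simp: a_def u_def w_def)
  have uw: "u t + w t \<le> 1" if "t \<in> {0..1}" for t using that by (auto simp: u_def w_def)
  define ip where "ip t v x = of_real (1 - a t) * sinner S v x + of_real (a t) * sinner T v x" for t v x
  define H where "H t v = cscale (of_real (u t)) (sham S v) + cscale (of_real (w t)) (sham T v) +
    cscale (of_real (1 - u t - w t)) (?\<epsilon> v)" for t v
  define F where "F t = \<lparr>sspace = ?V, sinner = ip t, sham = H t, sact = ?\<rho>\<rparr>" for t
  have HV: "H t v \<in> ?V" if "v \<in> ?V" for t v
    unfolding H_def by (intro VD H0(1) H1(1) \<epsilon>(1) that)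
  have Hlin: "clinear_on ?V ?V (H t)" for t
    unfolding clinear_on_def
  proof (intro conjI ballI allI funcsetI)
    show "H t (v + x) = H t v + H t x" if "v \<in> ?V" "x \<in> ?V" for v x
      using that by (simp add: H_def H0 H1 \<epsilon> cseq.scale_right_distrib ac_simps del: plus_fun_apply)
    show "H t (cscale b v) = cscale b (H t v)" if "v \<in> ?V" for v b
      using that by (simp add: H_def H0 H1 \<epsilon> cseq.scale_right_distrib mult.commute del: plus_fun_apply)
  qed (rule HV)
  have ipp: "inner_product_on ?V (ip t)" for t
    unfolding inner_product_on_def
  proof (intro conjI ballI allI impI)
    show "ip t v (x + y) = ip t v x + ip t v y" if "v \<in> ?V" "x \<in> ?V" "y \<in> ?V" for v x y
      using that by (simp add: ip_def q0 q1 algebra_simps)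
    show "ip t v (cscale b x) = b * ip t v x" if "v \<in> ?V" "x \<in> ?V" for v x b
      using that by (simp add: ip_def q0 q1 algebra_simps)
    show "ip t x v = cnj (ip t v x)" if "v \<in> ?V" "x \<in> ?V" for v x
      using inner_product_onD(2)[OF SG(2) subV that] inner_product_onD(2)[OF TG(2) subV that]
      by (simp add: ip_def)
    show "Re (ip t v v) > 0" if v: "v \<in> ?V" "v \<noteq> 0" for v
    proof -
      have "Re (sinner S v v) > 0" "Re (sinner T v v) > 0"
        using inner_product_onD(3)[OF SG(2) subV v] inner_product_onD(3)[OF TG(2) subV v] .
      then have "(1 - a t) * Re (sinner S v v) + a t * Re (sinner T v v) > 0"
        using w01(1,2)[of t] by (cases "a t = 0") (auto intro: add_nonneg_pos)
      then show ?thesis by (simp add: ip_def)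
    qed
  qed
  have sq: "sesquilinear_on ?V ?V (ip t)" for t by (rule inner_product_onD(1)[OF ipp subV])
  note q = sesquilinear_onD[OF sq]
  \<comment> \<open>Each Hamiltonian is known to be self-adjoint for its own inner product, and it
    has nonzero weight only while that inner product is the current one.\<close>
  have uip: "of_real (u t) * ip t v x = of_real (u t) * sinner S v x" for t v x
    using w01(5)[of t] by (cases "u t = 0") (auto simp: ip_def)
  have wip: "of_real (w t) * ip t v x = of_real (w t) * sinner T v x" for t v x
    using w01(6)[of t] by (cases "w t = 0") (auto simp: ip_def)
  have ipH: "ip t v (H t x) = of_real (u t) * sinner S v (sham S x) + of_real (w t) * sinner T v (sham T x)
      + of_real (1 - u t - w t) * ip t v (?\<epsilon> x)" if "v \<in> ?V" "x \<in> ?V" for t v x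
    unfolding H_def using that VD H0(1) H1(1) \<epsilon>(1) by (simp add: q uip wip del: plus_fun_apply)
  have Hip: "ip t (H t v) x = of_real (u t) * sinner S (sham S v) x + of_real (w t) * sinner T (sham T v) x
      + of_real (1 - u t - w t) * ip t (?\<epsilon> v) x" if "v \<in> ?V" "x \<in> ?V" for t v x
    unfolding H_def using that VD H0(1) H1(1) \<epsilon>(1) by (simp add: q uip wip del: plus_fun_apply)
  have Hsym: "ip t (H t v) x = ip t v (H t x)" if v: "v \<in> ?V" "x \<in> ?V" for t v x
    unfolding ipH[OF v] Hip[OF v] using SG(4)[OF v] TG(4)[OF v] \<epsilon>sym0[OF v] \<epsilon>sym1[OF v] by (simp add: ip_def)
  have Hsgn: "H t v \<in> sgn_space S e" if e: "e = 1 \<or> e = -1" and v: "v \<in> sgn_space S e" for t e v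
  proof -
    note E = subspaceD[OF graded_byD(1)[OF sgn_space_graded[OF S e]]]
    have "sham S v \<in> sgn_space S e" using v SS.eig_span_invariant by (simp add: sgn_space_def)
    moreover have "sham T v \<in> sgn_space S e"
      using v TT.eig_span_invariant unfolding sgnT[OF e, symmetric] by (simp add: sgn_space_def sp)
    moreover have "?\<epsilon> v \<in> sgn_space S e"
      using e v grading_hom[OF g] E(3)[of v "-1"] by (auto simp: sgn_space_simps)
    ultimately show ?thesis unfolding H_def by (intro E)
  qed
  \<comment> \<open>The two Hamiltonians and the grading operator are definite of the same sign on
    each common spectral subspace, hence so is their convex combination. As the subspaces are
    preserved, this keeps \<open>H t\<close> injective.\<close>
  have Hdef: "e * Re (ip t v (H t v)) > 0"
    if t: "t \<in> {0..1}" and e: "e = 1 \<or> e = -1" and v: "v \<in> sgn_space S e" "v \<noteq> 0" for t e v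
  proof -
    have vV: "v \<in> ?V" using v sgn_projD(8)[OF S e] by blast
    have "e * Re (sinner S v (sham S v)) > 0" by (rule sgn_space_definite[OF S e v])
    moreover have "e * Re (sinner T v (sham T v)) > 0"
      using sgn_space_definite[OF T e] v sgnT[OF e] by simp
    moreover have "e * Re (ip t v (?\<epsilon> v)) > 0"
    proof -
      have "?\<epsilon> v = cscale (of_real e) v" using e v grading_hom[OF g] by (auto simp: sgn_space_simps)
      then have "e * Re (ip t v (?\<epsilon> v)) = Re (ip t v v)" using e vV by (auto simp: q)
      then show ?thesis using inner_product_onD(3)[OF ipp subV vV v(2)] by simp
    qed
    moreover have "e * Re (ip t v (H t v)) = u t * (e * Re (sinner S v (sham S v))) +
       w t * (e * Re (sinner T v (sham T v))) + (1 - u t - w t) * (e * Re (ip t v (?\<epsilon> v)))"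
      unfolding ipH[OF vV vV] by (simp add: algebra_simps)
    moreover have "0 < u * x + w * y + (1 - u - w) * z"
      if "0 < x" "0 < y" "0 < z" "0 \<le> u" "0 \<le> w" "u + w \<le> 1" for x y z u w :: real
    proof (cases "u + w = 1")
      case True
      then have "(1 - u - w) * z = 0" by simp
      moreover have "0 < u * x + w * y"
        using that True by (cases "u = 0") (auto intro: add_pos_nonneg)
      ultimately show ?thesis by linarith
    next
      case False
      then show ?thesis using that by (intro add_nonneg_pos add_nonneg_nonneg mult_nonneg_nonneg) auto
    qed
    ultimately show ?thesis using w01(3,4)[of t] uw[OF t] by simp
  qed
  have Hiso: "linear_iso_on ?V ?V (H t)" if t: "t \<in> {0..1}" for t
  proof -
    have "inj_on (H t) ?V"
    proof (rule clinear_on_inj[OF Hlin subV])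
      fix v assume v: "v \<in> ?V" "H t v = 0"
      let ?p = "sgn_proj S 1 v" and ?n = "sgn_proj S (-1) v"
      have pn: "?p \<in> sgn_space S 1" "?n \<in> sgn_space S (-1)" "?p \<in> ?V" "?n \<in> ?V" "?p + ?n = v"
        using sgn_projD(2,3)[OF S _ v(1)] sgn_projD(4)[OF S _ v(1), of 1] by auto
      have m: "H t ?p \<in> sgn_space S 1" "H t ?n \<in> sgn_space S (-1)" using Hsgn pn by auto
      have "H t ?p + H t ?n = 0 + 0" using clinear_onD(2)[OF Hlin pn(3,4)] pn(5) v(2) by simp
      then have 0: "H t ?p = 0" "H t ?n = 0"
        using graded_by_unique[OF sgn_space_graded[OF S, of 1] m(1) _ m(2), of 0 0]
          subspaceD(1) graded_byD(1,2)[OF sgn_space_graded[OF S, of 1]] by auto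
      have "?p = 0"
        using Hdef[OF t _ pn(1)] 0 sesquilinear_on_0(1)[OF sq subV subV pn(3)] by force
      moreover have "?n = 0"
        using Hdef[OF t _ pn(2)] 0 sesquilinear_on_0(1)[OF sq subV subV pn(4)] by force
      ultimately show "v = 0" using pn(5) by simp
    qed
    then show ?thesis
      using clinear_on_inj_surj[OF SG(1) Hlin] Hlin by (simp add: linear_iso_on_def bij_betw_def)
  qed
  have comm: "?\<rho> x (H t v) = cscale (of_int (gr x)) (H t (?\<rho> x v))" if x: "x \<in> carrier Gt" and v: "v \<in> ?V" for x t v
  proof -
    have "?\<rho> x (H t v) = cscale (of_real (u t)) (?\<rho> x (sham S v)) + cscale (of_real (w t)) (?\<rho> x (sham T v)) +
      cscale (of_real (1 - u t - w t)) (?\<rho> x (?\<epsilon> v))"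
      unfolding H_def using R(2,3)[OF x] VD H0(1)[OF v] H1(1)[OF v] \<epsilon>(1)[OF v]
      by (simp del: plus_fun_apply of_real_diff)
    also have "\<dots> = cscale (of_int (gr x)) (H t (?\<rho> x v))"
      unfolding H_def SG(7)[OF x v] TG(7)[OF x v] \<epsilon>comm[OF x v]
      by (simp add: cseq.scale_right_distrib mult.commute del: plus_fun_apply)
    finally show ?thesis .
  qed
  have unit: "ip t (?\<rho> x v) (?\<rho> x y) = twist (ph x) (ip t v y)"
    if x: "x \<in> carrier Gt" and "v \<in> ?V" "y \<in> ?V" for x t v y
    unfolding ip_def using SG(6)[OF that] TG(6)[OF that] by (simp del: of_real_diff)
  have gapped: "gapped_system Q (F t)" if t: "t \<in> {0..1}" for t
    unfolding gapped_system_def F_def using SG(1,5) ipp Hiso[OF t] Hsym unit comm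
    by (auto simp: twist_def)
  \<comment> \<open>The bundle is trivial and the action is constant along the path; only the metric
    and the Hamiltonian move.\<close>
  define X where "X = prod_topology (top_of_set {0..1::real}) (top_of_set ?V)"
  have topX: "topspace X = {0..1} \<times> ?V" by (simp add: X_def)
  have Xt': "continuous_map X (top_of_set {0..1}) fst" and Xv: "continuous_map X (top_of_set ?V) snd"
    unfolding X_def by (rule continuous_map_fst continuous_map_snd)+
  have Xt: "continuous_map X euclidean fst" by (rule continuous_map_into_fulltopology[OF Xt'])
  have wcont: "continuous_map Y euclidean (\<lambda>y. complex_of_real (f (s y)))"
    if "continuous_map Y euclidean s" "continuous_on UNIV f" for Y :: "'y topology" and s f
    using continuous_map_compose[OF that(1), of euclidean f] that(2)
    by (intro continuous_map_complex_of_real) (simp add: comp_def)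
  have ca: "continuous_on UNIV a" "continuous_on UNIV (\<lambda>t. 1 - a t)" "continuous_on UNIV u" "continuous_on UNIV w"
    "continuous_on UNIV (\<lambda>t. 1 - u t - w t)"
    unfolding a_def u_def w_def by (intro continuous_intros)+
  have herm: "hermitian_bundle (\<lambda>t. ?V) ip X"
    unfolding hermitian_bundle_def
  proof (intro conjI ballI)
    fix t :: real assume t: "t \<in> {0..1}"
    have "(\<lambda>(s, x). (s, x)) = (id :: real \<times> vec \<Rightarrow> _)" by auto
    moreover have "subtopology X (Sigma {0..1} (\<lambda>t. ?V)) = X"
      using subtopology_topspace[of X] unfolding topX .
    ultimately have "homeomorphic_map (prod_topology (top_of_set {0..1}) (top_of_set ?V))
       (subtopology X (Sigma {0..1} (\<lambda>t. ?V))) (\<lambda>(s, x). (s, x))"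
      by (simp only: homeomorphic_map_id X_def[symmetric])
    then show "\<exists>U W \<Phi>. openin (top_of_set {0..1}) U \<and> t \<in> U \<and> fd_space W \<and>
        (\<forall>s\<in>U. linear_iso_on W ?V (\<Phi> s)) \<and>
        homeomorphic_map (prod_topology (top_of_set U) (top_of_set W)) (subtopology X (Sigma U (\<lambda>t. ?V)))
          (\<lambda>(s, w). (s, \<Phi> s w))"
      using t SG(1) by (intro exI[of _ "{0..1}"] exI[of _ ?V] exI[of _ "\<lambda>s x. x"])
        (auto simp: linear_iso_on_def clinear_on_def bij_betw_def)
  next
    let ?Y = "subtopology (prod_topology X X) {(x, y). fst x = fst y}"
    have 1: "continuous_map ?Y X fst" "continuous_map ?Y X snd"
      by (auto intro: continuous_map_from_subtopology continuous_map_fst continuous_map_snd)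
    note c1 = continuous_map_compose[OF 1(1) Xt, unfolded comp_def]
      and c2 = continuous_map_compose[OF 1(1) Xv, unfolded comp_def]
      and c3 = continuous_map_compose[OF 1(2) Xv, unfolded comp_def]
    have "continuous_map ?Y euclidean (\<lambda>z. ip (fst (fst z)) (snd (fst z)) (snd (snd z)))"
      unfolding ip_def
      by (intro continuous_map_add continuous_map_complex_mult wcont[OF c1] ca
          continuous_map_sesquilinear[OF SG(1) SG(1) sq0 c2 c3] continuous_map_sesquilinear[OF SG(1) SG(1) sq1 c2 c3])
    then show "continuous_map ?Y euclidean (\<lambda>(x, y). ip (fst x) (snd x) (snd y))"
      by (simp add: case_prod_unfold)
  qed (use SG(1) ipp topX Xt' in auto)
  have contH: "continuous_map X X (\<lambda>(t, v). (t, H t v))"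
  proof -
    have "continuous_map X euclidean (\<lambda>z. H (fst z) (snd z))"
      unfolding H_def
      using continuous_map_clinear[OF SG(1) H0lin Xv] continuous_map_clinear[OF SG(1) H1lin Xv]
        continuous_map_clinear[OF SG(1) \<epsilon>lin Xv]
      by (intro continuous_map_vec_add continuous_map_cscale wcont[OF Xt] ca)
        (auto simp: continuous_map_in_subtopology)
    then have "continuous_map X (top_of_set ?V) (\<lambda>z. H (fst z) (snd z))"
      using HV by (auto simp: continuous_map_in_subtopology topX)
    from continuous_map_pairedI[OF Xt' this]
    have "continuous_map X X (\<lambda>z. (fst z, H (fst z) (snd z)))" by (simp only: X_def[symmetric])
    then show ?thesis by (simp add: case_prod_unfold)
  qed
  have conta: "continuous_map (prod_topology (gtop Gt) X) X (\<lambda>(g, (t, v)). (t, ?\<rho> g v))"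
  proof -
    let ?Y = "prod_topology (gtop Gt) X"
    note s = continuous_map_snd[of "gtop Gt" X]
    note c1 = continuous_map_compose[OF s Xt', unfolded comp_def]
      and c2 = continuous_map_compose[OF s Xv, unfolded comp_def]
    have "continuous_map ?Y (top_of_set ?V) (\<lambda>z. ?\<rho> (fst z) (snd (snd z)))"
      by (rule continuous_map_action[OF SG(1) SG(5) continuous_map_fst c2])
    from continuous_map_pairedI[OF c1 this]
    have "continuous_map ?Y X (\<lambda>z. (fst (snd z), ?\<rho> (fst z) (snd (snd z))))"
      by (simp only: X_def[symmetric])
    then show ?thesis by (simp add: case_prod_unfold)
  qed
  have "system_family Q F X"
    unfolding system_family_def using gapped herm contH conta by (simp add: F_def)
  moreover have id: "linear_iso_on ?V ?V (\<lambda>v. v)" by (auto simp: linear_iso_on_def clinear_on_def bij_betw_def)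
  moreover have "a 0 = 0" "u 0 = 1" "w 0 = 0" "a 1 = 1" "u 1 = 0" "w 1 = 1" by (simp_all add: a_def u_def w_def)
  ultimately show ?thesis
    unfolding same_phase_def system_iso_def
    by (intro exI[of _ F] exI[of _ X] conjI exI[of _ "\<lambda>v. v"])
      (simp_all add: F_def ip_def H_def sp act)
qed

text \<open>The system \<open>S'\<close> is pulled back along the isomorphism to a system
  \<open>T\<close> on the space of \<open>S\<close>. Equivariance makes its action that of
  \<open>S\<close>, and evenness makes its spectral subspaces those of \<open>S\<close>, so the
  flattening path applies.\<close>

lemma rep_iso_imp_same_phase:
  assumes S: "gapped_system Q S" and S': "gapped_system Q S'" and iso: "rep_iso Q (rep_of S) (rep_of S')"
  shows "same_phase Q S S'"
proof -
  let ?V = "sspace S" and ?V' = "sspace S'"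
  obtain f where f: "linear_iso_on ?V ?V' f" and fp: "f \<in> pos_space S \<rightarrow> pos_space S'"
      and fn: "f \<in> neg_space S \<rightarrow> neg_space S'"
      and feq: "\<And>x v. x \<in> carrier Gt \<Longrightarrow> v \<in> ?V \<Longrightarrow> f (sact S x v) = sact S' x (f v)"
    using iso unfolding rep_iso_def rep_of_simps by blast
  note SG = gapped_systemD[OF S] and SG' = gapped_systemD[OF S']
  note subV = SG(8) and subV' = SG'(8)
  note VD = subspaceD[OF subV]
  note R = twisted_actionD[OF SG(5)] and R' = twisted_actionD[OF SG'(5)]
  define i where "i = inv_into ?V f"
  have iiso: "linear_iso_on ?V' ?V i" unfolding i_def by (rule clinear_on_inv_into[OF f subV])
  have flin: "clinear_on ?V ?V' f" and fbij: "bij_betw f ?V ?V'" and ilin: "clinear_on ?V' ?V i"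
    using f iiso by (auto simp: linear_iso_on_def)
  note fD = clinear_onD[OF flin] and iD = clinear_onD[OF ilin]
  have fi: "f (i v) = v" if "v \<in> ?V'" for v unfolding i_def using fbij that by (simp add: bij_betw_inv_into_right)
  have if_id: "i (f v) = v" if "v \<in> ?V" for v unfolding i_def using fbij that by (simp add: bij_betw_inv_into_left)
  have ieq: "i (sact S' x v) = sact S x (i v)" if "x \<in> carrier Gt" "v \<in> ?V'" for x v
    using feq[OF that(1) iD(1)[OF that(2)]] fi[OF that(2)] if_id[OF R(1)[OF that(1) iD(1)[OF that(2)]]] by simp
  have Hlin': "clinear_on ?V' ?V' (sham S')" using SG'(3) by (simp add: linear_iso_on_def)
  note H' = clinear_onD[OF Hlin']
  define T where "T = \<lparr>sspace = ?V, sinner = (\<lambda>v w. sinner S' (f v) (f w)),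
    sham = (\<lambda>v. i (sham S' (f v))), sact = sact S\<rparr>"
  have T: "gapped_system Q T"
    unfolding gapped_system_def T_def gapped.simps
  proof (intro conjI ballI)
    show "inner_product_on ?V (\<lambda>v w. sinner S' (f v) (f w))"
      unfolding inner_product_on_def
    proof (intro conjI ballI allI impI)
      note q = sesquilinear_onD[OF SG'(9)]
      show "sinner S' (f v) (f (w + x)) = sinner S' (f v) (f w) + sinner S' (f v) (f x)"
        if "v \<in> ?V" "w \<in> ?V" "x \<in> ?V" for v w x using that by (simp add: fD q)
      show "sinner S' (f v) (f (cscale b w)) = b * sinner S' (f v) (f w)"
        if "v \<in> ?V" "w \<in> ?V" for v w b using that by (simp add: fD q)
      show "sinner S' (f w) (f v) = cnj (sinner S' (f v) (f w))" if "v \<in> ?V" "w \<in> ?V" for v w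
        using inner_product_onD(2)[OF SG'(2) subV' fD(1)[OF that(1)] fD(1)[OF that(2)]] .
      show "0 < Re (sinner S' (f v) (f v))" if "v \<in> ?V" "v \<noteq> 0" for v
      proof (rule inner_product_onD(3)[OF SG'(2) subV' fD(1)[OF that(1)]])
        show "f v \<noteq> 0" using if_id[OF that(1)] that(2) clinear_on_0[OF ilin subV'] by auto
      qed
    qed
    show "linear_iso_on ?V ?V (\<lambda>v. i (sham S' (f v)))"
      by (rule linear_iso_on_compose[OF linear_iso_on_compose[OF f SG'(3)] iiso])
    fix v w assume v: "v \<in> ?V" and w: "w \<in> ?V"
    show "sinner S' (f (i (sham S' (f v)))) (f w) = sinner S' (f v) (f (i (sham S' (f w))))"
      using SG'(4)[OF fD(1)[OF v] fD(1)[OF w]] by (simp add: fi H' fD v w)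
    fix x assume x: "x \<in> carrier Gt"
    show "ph x = 1 \<longrightarrow> sinner S' (f (sact S x v)) (f (sact S x w)) = sinner S' (f v) (f w)"
      "ph x = -1 \<longrightarrow> sinner S' (f (sact S x v)) (f (sact S x w)) = cnj (sinner S' (f v) (f w))"
      using SG'(6)[OF x fD(1)[OF v] fD(1)[OF w]] by (auto simp: feq[OF x] v w twist_def)
  next
    fix x v assume x: "x \<in> carrier Gt" and v: "v \<in> ?V"
    have "sact S x (i (sham S' (f v))) = i (sact S' x (sham S' (f v)))" using ieq x v H' fD by simp
    also have "\<dots> = cscale (of_int (gr x)) (i (sham S' (sact S' x (f v))))"
      using SG'(7)[OF x fD(1)[OF v]] iD(3) H'(1) R'(1)[OF x fD(1)[OF v]] by simp
    finally show "sact S x (i (sham S' (f v))) = cscale (of_int (gr x)) (i (sham S' (f (sact S x v))))"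
      using feq[OF x v] by simp
  qed (use SG in auto)
  have Tiso: "system_iso Q S' T"
    unfolding system_iso_def T_def gapped.simps using iiso fi ieq by (intro exI[of _ i]) auto
  have sub: "v \<in> eig_span ?V (sham T) P" if "v \<in> ?V" "f v \<in> eig_span ?V' (sham S') P" for v P
    using eig_span_clinear[OF ilin subV' _ that(2), of "sham T"] if_id[OF that(1)] fi by (simp add: T_def)
  have gS: "graded_by ?V (pos_space S) (neg_space S)" and gT: "graded_by ?V (pos_space T) (neg_space T)"
    using gapped_graded[OF S] gapped_graded[OF T] by (auto simp: T_def)
  \<comment> \<open>One inclusion for each sign is enough, as both systems grade the same
    space.\<close>
  have pT: "pos_space S \<subseteq> pos_space T"
  proof
    fix v assume "v \<in> pos_space S"
    then have "v \<in> ?V" "f v \<in> pos_space S'" using fp graded_byD(4)[OF gS] by blast+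
    then show "v \<in> pos_space T" using sub[of v "\<lambda>l. l > 0"] by (simp add: pos_space_eig T_def)
  qed
  have nT: "neg_space S \<subseteq> neg_space T"
  proof
    fix v assume "v \<in> neg_space S"
    then have "v \<in> ?V" "f v \<in> neg_space S'" using fn graded_byD(5)[OF gS] by blast+
    then show "v \<in> neg_space T" using sub[of v "\<lambda>l. l < 0"] by (simp add: neg_space_eig T_def)
  qed
  have "same_phase Q S T"
    using graded_by_eq[OF gS gT pT nT] by (intro same_phase_flattening[OF S T]) (auto simp: T_def)
  then obtain F X where F: "system_family Q F X" "system_iso Q S (F 0)" "system_iso Q T (F 1)"
    unfolding same_phase_def by blast
  \<comment> \<open>The pulled back system at the end of the path is exchanged for \<open>S'\<close>
    by composing isomorphisms.\<close>
  have "system_iso Q S' (F 1)"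
  proof -
    obtain h where h: "linear_iso_on (sspace T) (sspace (F 1)) h"
      "\<forall>v\<in>sspace T. \<forall>w\<in>sspace T. sinner (F 1) (h v) (h w) = sinner T v w"
      "\<forall>v\<in>sspace T. h (sham T v) = sham (F 1) (h v)"
      "\<forall>g\<in>carrier Gt. \<forall>v\<in>sspace T. h (sact T g v) = sact (F 1) g (h v)"
      using F(3) unfolding system_iso_def by blast
    obtain k where k: "linear_iso_on ?V' (sspace T) k"
      "\<forall>v\<in>?V'. \<forall>w\<in>?V'. sinner T (k v) (k w) = sinner S' v w"
      "\<forall>v\<in>?V'. k (sham S' v) = sham T (k v)"
      "\<forall>g\<in>carrier Gt. \<forall>v\<in>?V'. k (sact S' g v) = sact T g (k v)"
      using Tiso unfolding system_iso_def by blast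
    have "k v \<in> sspace T" if "v \<in> ?V'" for v using k(1) that by (auto simp: linear_iso_on_def clinear_on_def)
    then show ?thesis
      unfolding system_iso_def using linear_iso_on_compose[OF k(1) h(1)] h k
      by (intro exI[of _ "\<lambda>v. h (k v)"]) auto
  qed
  then show ?thesis using F unfolding same_phase_def by blast
qed

end

subsection \<open>Direct sums\<close>

lemma part_interleave [simp]: "part1 (v \<boxplus> w) = v" "part2 (v \<boxplus> w) = w" "part1 x \<boxplus> part2 x = x"
  by (auto simp: part1_def part2_def interleave_def fun_eq_iff)

lemma part_linear:
  "part1 (x + y) = part1 x + part1 y" "part2 (x + y) = part2 x + part2 y"
  "part1 (cscale a x) = cscale a (part1 x)" "part2 (cscale a x) = cscale a (part2 x)"
  "part1 0 = 0" "part2 0 = 0"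
  by (auto simp: part1_def part2_def fun_eq_iff cscale_apply)

lemma interleave_linear:
  "(v + v') \<boxplus> (w + w') = (v \<boxplus> w) + (v' \<boxplus> w')" "cscale a v \<boxplus> cscale a w = cscale a (v \<boxplus> w)" "0 \<boxplus> 0 = 0"
  by (auto simp: interleave_def fun_eq_iff cscale_apply)

lemma vec_parts_eqI: "part1 x = part1 y \<Longrightarrow> part2 x = part2 y \<Longrightarrow> x = y"
  by (metis part_interleave(3))

lemma mem_space_sum: "x \<in> space_sum V W \<longleftrightarrow> part1 x \<in> V \<and> part2 x \<in> W"
proof
  assume "part1 x \<in> V \<and> part2 x \<in> W"
  then have "part1 x \<boxplus> part2 x \<in> space_sum V W" unfolding space_sum_def by blast
  then show "x \<in> space_sum V W" by simp
qed (auto simp: space_sum_def)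

lemma part_op_sum: "part1 (op_sum f g x) = f (part1 x)" "part2 (op_sum f g x) = g (part2 x)"
  by (simp_all add: op_sum_def)

lemma subspace_space_sum:
  assumes "cseq.subspace V" "cseq.subspace W" shows "cseq.subspace (space_sum V W)"
  using subspaceD[OF assms(1)] subspaceD[OF assms(2)]
  by (intro cseq.subspaceI) (auto simp: mem_space_sum part_linear simp del: plus_fun_apply)

text \<open>Generators of the summands are placed in the even and in the odd entries; this yields
  finite dimension of the sum.\<close>

lemma space_sum_span:
  "space_sum (cseq.span B) (cseq.span C) = cseq.span ((\<lambda>v. v \<boxplus> 0) ` B \<union> (\<lambda>w. 0 \<boxplus> w) ` C)"
  (is "_ = cseq.span ?D")
proof (intro equalityI subsetI)
  fix x assume x: "x \<in> space_sum (cseq.span B) (cseq.span C)"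
  have 1: "(v + v') \<boxplus> 0 = (v \<boxplus> 0) + (v' \<boxplus> 0)" "0 \<boxplus> (v + v') = (0 \<boxplus> v) + (0 \<boxplus> v')"
    "cscale a v \<boxplus> 0 = cscale a (v \<boxplus> 0)" "0 \<boxplus> cscale a v = cscale a (0 \<boxplus> v)" for v v' a
    using interleave_linear(1)[of v v' 0 0] interleave_linear(1)[of 0 0 v v']
      interleave_linear(2)[of a v 0] interleave_linear(2)[of a 0 v] by simp_all
  have "cseq.span B \<subseteq> {v. v \<boxplus> 0 \<in> cseq.span ?D}"
    by (intro cseq.span_minimal cseq.subspaceI)
      (auto simp: 1 interleave_linear(3) intro: cseq.span_base cseq.span_add cseq.span_scale cseq.span_zero
        simp del: plus_fun_apply)
  moreover have "cseq.span C \<subseteq> {v. 0 \<boxplus> v \<in> cseq.span ?D}"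
    by (intro cseq.span_minimal cseq.subspaceI)
      (auto simp: 1 interleave_linear(3) intro: cseq.span_base cseq.span_add cseq.span_scale cseq.span_zero
        simp del: plus_fun_apply)
  ultimately have "(part1 x \<boxplus> 0) + (0 \<boxplus> part2 x) \<in> cseq.span ?D"
    using x by (intro cseq.span_add) (auto simp: mem_space_sum)
  then show "x \<in> cseq.span ?D" by (simp flip: interleave_linear(1))
next
  have "cseq.span ?D \<subseteq> space_sum (cseq.span B) (cseq.span C)"
    by (intro cseq.span_minimal subspace_space_sum cseq.subspace_span)
      (auto simp: mem_space_sum cseq.span_base cseq.span_zero)
  then show "x \<in> space_sum (cseq.span B) (cseq.span C)" if "x \<in> cseq.span ?D" for x using that by blast
qed

lemma fd_space_sum:
  assumes "fd_space V" "fd_space W" shows "fd_space (space_sum V W)"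
proof -
  obtain B C where "finite B" "V = cseq.span B" "finite C" "W = cseq.span C"
    using assms by (auto simp: fd_space_def)
  then show ?thesis
    unfolding fd_space_def
    by (intro exI[of _ "(\<lambda>v. v \<boxplus> 0) ` B \<union> (\<lambda>w. 0 \<boxplus> w) ` C"]) (simp add: space_sum_span)
qed

lemma bij_betw_op_sum:
  assumes "bij_betw f V V'" "bij_betw g W W'"
  shows "bij_betw (op_sum f g) (space_sum V W) (space_sum V' W')"
proof (rule bij_betw_byWitness[where f' = "op_sum (inv_into V f) (inv_into W g)"])
  note f = bij_betw_inv_into_left[OF assms(1)] bij_betw_inv_into_right[OF assms(1)]
    bij_betwE[OF assms(1)] bij_betwE[OF bij_betw_inv_into[OF assms(1)]]
  note g = bij_betw_inv_into_left[OF assms(2)] bij_betw_inv_into_right[OF assms(2)]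
    bij_betwE[OF assms(2)] bij_betwE[OF bij_betw_inv_into[OF assms(2)]]
  show "\<forall>x\<in>space_sum V W. op_sum (inv_into V f) (inv_into W g) (op_sum f g x) = x"
    by (auto simp: mem_space_sum op_sum_def f g)
  show "\<forall>x\<in>space_sum V' W'. op_sum f g (op_sum (inv_into V f) (inv_into W g) x) = x"
    by (auto simp: mem_space_sum op_sum_def f g)
  show "op_sum f g ` space_sum V W \<subseteq> space_sum V' W'" using f g by (auto simp: mem_space_sum part_op_sum)
  show "op_sum (inv_into V f) (inv_into W g) ` space_sum V' W' \<subseteq> space_sum V W"
    using f g by (auto simp: mem_space_sum part_op_sum)
qed

lemma clinear_on_op_sum:
  assumes "clinear_on V V' f" "clinear_on W W' g"
  shows "clinear_on (space_sum V W) (space_sum V' W') (op_sum f g)"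
  unfolding clinear_on_def using clinear_onD[OF assms(1)] clinear_onD[OF assms(2)]
  by (auto simp: mem_space_sum part_op_sum)
    (simp_all add: op_sum_def mem_space_sum part_linear interleave_linear del: plus_fun_apply)

lemma antilinear_on_op_sum:
  assumes "antilinear_on V V' f" "antilinear_on W W' g"
  shows "antilinear_on (space_sum V W) (space_sum V' W') (op_sum f g)"
  unfolding antilinear_on_def using antilinear_onD[OF assms(1)] antilinear_onD[OF assms(2)]
  by (auto simp: mem_space_sum part_op_sum)
    (simp_all add: op_sum_def mem_space_sum part_linear interleave_linear del: plus_fun_apply)

lemma linear_iso_on_op_sum:
  "linear_iso_on V V' f \<Longrightarrow> linear_iso_on W W' g \<Longrightarrow>
    linear_iso_on (space_sum V W) (space_sum V' W') (op_sum f g)"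
  by (simp add: linear_iso_on_def clinear_on_op_sum bij_betw_op_sum)

text \<open>The projections to the summands and the inclusions of the summands intertwine the
  operators and therefore respect eigenvectors; each pair yields one inclusion.\<close>

lemma eig_span_sum:
  assumes V: "cseq.subspace V" and W: "cseq.subspace W"
    and f: "clinear_on V V f" and g: "clinear_on W W g"
  shows "eig_span (space_sum V W) (op_sum f g) P = space_sum (eig_span V f P) (eig_span W g P)"
proof (intro equalityI subsetI)
  let ?X = "space_sum V W" and ?H = "op_sum f g"
  note f0 = clinear_on_0[OF f V] and g0 = clinear_on_0[OF g W] and X = subspace_space_sum[OF V W]
  have p: "clinear_on ?X V part1" "clinear_on ?X W part2"
    by (auto simp: clinear_on_def mem_space_sum part_linear)
  have 1: "cscale a (v \<boxplus> 0) = cscale a v \<boxplus> 0" "cscale a (0 \<boxplus> v) = 0 \<boxplus> cscale a v"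
    "(v + w) \<boxplus> 0 = (v \<boxplus> 0) + (w \<boxplus> 0)" "0 \<boxplus> (v + w) = (0 \<boxplus> v) + (0 \<boxplus> w)" for a v w
    using interleave_linear(2)[of a v 0] interleave_linear(2)[of a 0 v]
      interleave_linear(1)[of v w 0 0] interleave_linear(1)[of 0 0 v w] by simp_all
  have i: "clinear_on V ?X (\<lambda>v. v \<boxplus> 0)" "clinear_on W ?X (\<lambda>w. 0 \<boxplus> w)"
    using subspaceD(1)[OF V] subspaceD(1)[OF W] by (auto simp: clinear_on_def mem_space_sum 1)
  show "x \<in> space_sum (eig_span V f P) (eig_span W g P)" if "x \<in> eig_span ?X ?H P" for x
    unfolding mem_space_sum
    using eig_span_clinear[OF p(1) X _ that, of f] eig_span_clinear[OF p(2) X _ that, of g]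
    by (simp add: part_op_sum)
  fix x assume "x \<in> space_sum (eig_span V f P) (eig_span W g P)"
  then have "part1 x \<boxplus> 0 \<in> eig_span ?X ?H P" "0 \<boxplus> part2 x \<in> eig_span ?X ?H P"
    using eig_span_clinear[OF i(1) V, of f ?H] eig_span_clinear[OF i(2) W, of g ?H]
    by (auto simp: mem_space_sum op_sum_def f0 g0)
  then have "(part1 x \<boxplus> 0) + (0 \<boxplus> part2 x) \<in> eig_span ?X ?H P"
    unfolding eig_span_def by (rule cseq.span_add)
  then show "x \<in> eig_span ?X ?H P" by (simp flip: interleave_linear(1))
qed

context qm
begin

lemma twisted_action_sum:
  assumes \<rho>: "twisted_action Q V \<rho>" and \<sigma>: "twisted_action Q W \<sigma>"
  shows "twisted_action Q (space_sum V W) (\<lambda>g. op_sum (\<rho> g) (\<sigma> g))"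
  unfolding twisted_action_def
proof (intro conjI ballI impI)
  note R = twisted_actionD[OF \<rho>] and S = twisted_actionD[OF \<sigma>]
  fix g assume g: "g \<in> carrier Gt"
  show "bij_betw (op_sum (\<rho> g) (\<sigma> g)) (space_sum V W) (space_sum V W)"
    by (rule bij_betw_op_sum[OF R(9)[OF g] S(9)[OF g]])
  show "clinear_on (space_sum V W) (space_sum V W) (op_sum (\<rho> g) (\<sigma> g))" if "ph g = 1"
    using \<rho> \<sigma> g that by (intro clinear_on_op_sum) (auto simp: twisted_action_def)
  show "antilinear_on (space_sum V W) (space_sum V W) (op_sum (\<rho> g) (\<sigma> g))" if "ph g = -1"
    using \<rho> \<sigma> g that by (intro antilinear_on_op_sum) (auto simp: twisted_action_def)
  fix h x assume "h \<in> carrier Gt" "x \<in> space_sum V W"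
  then show "op_sum (\<rho> (g \<otimes>\<^bsub>Gt\<^esub> h)) (\<sigma> (g \<otimes>\<^bsub>Gt\<^esub> h)) x = op_sum (\<rho> g) (\<sigma> g) (op_sum (\<rho> h) (\<sigma> h) x)"
    using R(4)[OF g] S(4)[OF g] by (auto simp: mem_space_sum op_sum_def)
next
  note R = twisted_actionD[OF \<rho>] and S = twisted_actionD[OF \<sigma>]
  fix x assume x: "x \<in> space_sum V W"
  have "continuous_map (gtop Gt) euclidean (\<lambda>g. op_sum (\<rho> g) (\<sigma> g) x i)" for i
    using continuous_map_vec_apply[OF R(8), of "part1 x" "i div 2"]
      continuous_map_vec_apply[OF S(8), of "part2 x" "i div 2"] x
    by (cases "even i") (auto simp: op_sum_def interleave_def mem_space_sum)
  then have "continuous_map (gtop Gt) euclidean (\<lambda>g. op_sum (\<rho> g) (\<sigma> g) x)"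
    by (simp add: continuous_map_vec_iff)
  then show "continuous_map (gtop Gt) (top_of_set (space_sum V W)) (\<lambda>g. op_sum (\<rho> g) (\<sigma> g) x)"
    using R(1) S(1) x by (auto simp: continuous_map_in_subtopology mem_space_sum part_op_sum)
next
  fix z x assume "z \<in> carrier circle_group" "x \<in> space_sum V W"
  then show "op_sum (\<rho> (qincl Q z)) (\<sigma> (qincl Q z)) x = cscale z x"
    using \<rho> \<sigma> by (auto simp: twisted_action_def mem_space_sum op_sum_def interleave_linear)
qed

lemma gapped_system_sum:
  assumes S: "gapped_system Q S" and T: "gapped_system Q T"
  shows "gapped_system Q (system_sum S T)"
  unfolding gapped_system_def system_sum_def gapped.simps
proof (intro conjI ballI)
  note SG = gapped_systemD[OF S] and TG = gapped_systemD[OF T]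
  note subV = SG(8) and subW = TG(8)
  note VD = subspaceD[OF subV] and WD = subspaceD[OF subW]
  note qs = sesquilinear_onD[OF SG(9)]
    and qt = sesquilinear_onD[OF TG(9)]
  let ?X = "space_sum (sspace S) (sspace T)"
  let ?ip = "\<lambda>x y. sinner S (part1 x) (part1 y) + sinner T (part2 x) (part2 y)"
  show "fd_space ?X" by (rule fd_space_sum[OF SG(1) TG(1)])
  show "inner_product_on ?X ?ip"
    unfolding inner_product_on_def
  proof (intro conjI ballI allI impI)
    show "?ip v (x + y) = ?ip v x + ?ip v y" if "v \<in> ?X" "x \<in> ?X" "y \<in> ?X" for v x y
      using that by (simp add: mem_space_sum part_linear qs qt)
    show "?ip v (cscale b x) = b * ?ip v x" if "v \<in> ?X" "x \<in> ?X" for v x b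
      using that by (simp add: mem_space_sum part_linear qs qt algebra_simps)
    show "?ip x v = cnj (?ip v x)" if "v \<in> ?X" "x \<in> ?X" for v x
      using that inner_product_onD(2)[OF SG(2) subV, of "part1 v" "part1 x"]
        inner_product_onD(2)[OF TG(2) subW, of "part2 v" "part2 x"] by (simp add: mem_space_sum)
    show "0 < Re (?ip v v)" if v: "v \<in> ?X" "v \<noteq> 0" for v
    proof -
      have "part1 v \<noteq> 0 \<or> part2 v \<noteq> 0" using v(2) vec_parts_eqI[of v 0] by (auto simp: part_linear)
      moreover have "0 < Re (sinner S (part1 v) (part1 v)) \<or> part1 v = 0"
        "0 < Re (sinner T (part2 v) (part2 v)) \<or> part2 v = 0"
        using inner_product_onD(3)[OF SG(2) subV] inner_product_onD(3)[OF TG(2) subW] v(1)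
        by (auto simp: mem_space_sum)
      moreover have "sinner S 0 0 = 0" "sinner T 0 0 = 0"
        using sesquilinear_on_0(1)[OF SG(9) subV subV VD(1)]
          sesquilinear_on_0(1)[OF TG(9) subW subW WD(1)] .
      ultimately show ?thesis by auto
    qed
  qed
  show "linear_iso_on ?X ?X (op_sum (sham S) (sham T))" by (rule linear_iso_on_op_sum[OF SG(3) TG(3)])
  show "twisted_action Q ?X (\<lambda>g. op_sum (sact S g) (sact T g))" by (rule twisted_action_sum[OF SG(5) TG(5)])
  fix v w assume "v \<in> ?X" "w \<in> ?X"
  then have vw: "part1 v \<in> sspace S" "part1 w \<in> sspace S" "part2 v \<in> sspace T" "part2 w \<in> sspace T"
    by (auto simp: mem_space_sum)
  show "?ip (op_sum (sham S) (sham T) v) w = ?ip v (op_sum (sham S) (sham T) w)"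
    using SG(4)[OF vw(1,2)] TG(4)[OF vw(3,4)] by (simp add: part_op_sum)
  fix x assume x: "x \<in> carrier Gt"
  show "ph x = 1 \<longrightarrow> ?ip (op_sum (sact S x) (sact T x) v) (op_sum (sact S x) (sact T x) w) = ?ip v w"
    "ph x = -1 \<longrightarrow> ?ip (op_sum (sact S x) (sact T x) v) (op_sum (sact S x) (sact T x) w) = cnj (?ip v w)"
    using SG(6)[OF x vw(1,2)] TG(6)[OF x vw(3,4)] by (auto simp: part_op_sum twist_def)
next
  note SG = gapped_systemD[OF S] and TG = gapped_systemD[OF T]
  fix x v assume "x \<in> carrier Gt" "v \<in> space_sum (sspace S) (sspace T)"
  then show "op_sum (sact S x) (sact T x) (op_sum (sham S) (sham T) v) =
      cscale (of_int (gr x)) (op_sum (sham S) (sham T) (op_sum (sact S x) (sact T x) v))"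
    using SG(7) TG(7) by (auto simp: op_sum_def mem_space_sum interleave_linear)
qed

text \<open>Both sums interleave sequences in the same way, so this is an equality and the map on
  classes is additive without a choice of isomorphisms.\<close>

lemma rep_of_sum:
  assumes S: "gapped_system Q S" and T: "gapped_system Q T"
  shows "rep_of (system_sum S T) = rep_sum (rep_of S) (rep_of T)"
proof -
  note SG = gapped_systemD[OF S] and TG = gapped_systemD[OF T]
  have "clinear_on (sspace S) (sspace S) (sham S)" "clinear_on (sspace T) (sspace T) (sham T)"
    using SG(3) TG(3) by (auto simp: linear_iso_on_def)
  from eig_span_sum[OF SG(8) TG(8) this] show ?thesis
    by (simp add: rep_of_def rep_sum_def pos_space_eig neg_space_eig) (simp add: system_sum_def)
qed

lemma rep_iso_sum:
  assumes "rep_iso Q E E'" "rep_iso Q F F'"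
  shows "rep_iso Q (rep_sum E F) (rep_sum E' F')"
proof -
  obtain f where f: "linear_iso_on (rspace E) (rspace E') f"
      "f \<in> reven E \<rightarrow> reven E'" "f \<in> rodd E \<rightarrow> rodd E'"
      "\<forall>g\<in>carrier Gt. \<forall>v\<in>rspace E. f (ract E g v) = ract E' g (f v)"
    using assms(1) unfolding rep_iso_def by blast
  obtain k where k: "linear_iso_on (rspace F) (rspace F') k"
      "k \<in> reven F \<rightarrow> reven F'" "k \<in> rodd F \<rightarrow> rodd F'"
      "\<forall>g\<in>carrier Gt. \<forall>v\<in>rspace F. k (ract F g v) = ract F' g (k v)"
    using assms(2) unfolding rep_iso_def by blast
  show ?thesis
    unfolding rep_iso_def rep_sum_def graded_rep.simps
    using linear_iso_on_op_sum[OF f(1) k(1)] f(2-4) k(2-4)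
    by (intro exI[of _ "op_sum f k"])
      (auto simp: mem_space_sum op_sum_def Pi_iff)
qed

end

subsection \<open>Monoids of classes\<close>

text \<open>The map is onto and \<open>r\<close> is the pullback of \<open>s\<close>, so images of
  saturated sets are saturated. This is the situation of \<open>rep_of\<close>, which identifies
  many systems.\<close>

lemma image_Image_class:
  assumes "f ` X = Y" "r \<subseteq> X \<times> X" "s \<subseteq> Y \<times> Y"
    and "\<And>x y. x \<in> X \<Longrightarrow> y \<in> X \<Longrightarrow> (x, y) \<in> r \<longleftrightarrow> (f x, f y) \<in> s" and "Z \<subseteq> X"
  shows "f ` (r `` Z) = s `` (f ` Z)"
proof (intro equalityI subsetI)
  fix y assume "y \<in> f ` (r `` Z)"
  then obtain z x where "z \<in> Z" "(z, x) \<in> r" "y = f x" by blast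
  then show "y \<in> s `` (f ` Z)" using assms by blast
next
  fix y assume "y \<in> s `` (f ` Z)"
  then obtain z where z: "z \<in> Z" "(f z, y) \<in> s" by blast
  then obtain x where "x \<in> X" "y = f x" using assms(1,3) by blast
  then show "y \<in> f ` (r `` Z)" using z assms(4,5) by blast
qed

text \<open>Although \<open>f\<close> may identify elements of \<open>X\<close>, it is injective on
  classes, because a class of \<open>r\<close> is the full preimage of a class of
  \<open>s\<close>.\<close>

lemma class_monoid_iso:
  assumes f: "f ` X = Y" and add: "\<And>a b. a \<in> X \<Longrightarrow> b \<in> X \<Longrightarrow> add a b \<in> X"
    and hom: "\<And>a b. a \<in> X \<Longrightarrow> b \<in> X \<Longrightarrow> f (add a b) = add' (f a) (f b)"
    and r: "r \<subseteq> X \<times> X" and s: "s \<subseteq> Y \<times> Y"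
    and rs: "\<And>x y. x \<in> X \<Longrightarrow> y \<in> X \<Longrightarrow> (x, y) \<in> r \<longleftrightarrow> (f x, f y) \<in> s"
  shows "(`) f \<in> iso (class_monoid X add e r) (class_monoid Y add' e' s)"
proof -
  note im = image_Image_class[OF f r s rs]
  have sub: "A \<subseteq> X" if "A \<in> X // r" for A using that r by (auto simp: quotient_def)
  have cl: "f ` (r `` {x}) = s `` {f x}" if "x \<in> X" for x using im[of "{x}"] that by simp
  have "f ` A \<in> Y // s" if "A \<in> X // r" for A
  proof -
    obtain x where "x \<in> X" "A = r `` {x}" using \<open>A \<in> X // r\<close> by (rule quotientE)
    then show ?thesis using cl f by (auto intro: quotientI)
  qed
  moreover have "f ` (r `` {add a b |a b. a \<in> A \<and> b \<in> B}) =
      s `` {add' a b |a b. a \<in> f ` A \<and> b \<in> f ` B}" if "A \<in> X // r" "B \<in> X // r" for A B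
  proof -
    have "f ` {add a b |a b. a \<in> A \<and> b \<in> B} = {add' a b |a b. a \<in> f ` A \<and> b \<in> f ` B}" (is "?L = ?R")
    proof (intro equalityI subsetI)
      show "y \<in> ?R" if "y \<in> ?L" for y
        using that hom sub[OF \<open>A \<in> X // r\<close>] sub[OF \<open>B \<in> X // r\<close>] by blast
      fix y assume "y \<in> ?R"
      then obtain a b where ab: "a \<in> A" "b \<in> B" "y = add' (f a) (f b)" by blast
      then have "y = f (add a b)" using hom sub[OF \<open>A \<in> X // r\<close>] sub[OF \<open>B \<in> X // r\<close>] by (simp add: subset_iff)
      then show "y \<in> ?L" using ab by blast
    qed
    moreover have "{add a b |a b. a \<in> A \<and> b \<in> B} \<subseteq> X"
      using add sub[OF that(1)] sub[OF that(2)] by blast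
    ultimately show ?thesis using im[of "{add a b |a b. a \<in> A \<and> b \<in> B}"] by simp
  qed
  moreover have "inj_on ((`) f) (X // r)"
  proof (rule inj_onI)
    fix A B assume "A \<in> X // r" "B \<in> X // r" and eq: "f ` A = f ` B"
    then obtain x y where x: "x \<in> X" "A = r `` {x}" and y: "y \<in> X" "B = r `` {y}" by (meson quotientE)
    have pre: "r `` {x} = {z \<in> X. f z \<in> s `` {f x}}" if "x \<in> X" for x using rs[OF that] r by auto
    show "A = B" using eq cl x y pre by metis
  qed
  moreover have "Y // s \<subseteq> (`) f ` (X // r)"
  proof
    fix B assume "B \<in> Y // s"
    then obtain y where "y \<in> Y" "B = s `` {y}" by (rule quotientE)
    then obtain x where x: "x \<in> X" "B = s `` {f x}" using f by blast
    then have "B = f ` (r `` {x})" using cl by simp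
    then show "B \<in> (`) f ` (X // r)" using quotientI[OF x(1)] by blast
  qed
  ultimately show ?thesis
    by (auto simp: iso_def hom_def class_monoid_def bij_betw_def)
qed

text \<open>The product is defined as the \<open>r\<close>-image of a set of sums; compatibility of
  \<open>add\<close> with \<open>r\<close> makes this image a single class.\<close>

lemma class_monoid_closed:
  assumes r: "equiv X r" and add: "\<And>a b. a \<in> X \<Longrightarrow> b \<in> X \<Longrightarrow> add a b \<in> X"
    and cong: "\<And>a a' b b'. (a, a') \<in> r \<Longrightarrow> (b, b') \<in> r \<Longrightarrow> (add a b, add a' b') \<in> r"
    and AB: "A \<in> carrier (class_monoid X add e r)" "B \<in> carrier (class_monoid X add e r)"
  shows "A \<otimes>\<^bsub>class_monoid X add e r\<^esub> B \<in> carrier (class_monoid X add e r)"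
proof -
  obtain a b where ab: "a \<in> X" "A = r `` {a}" "b \<in> X" "B = r `` {b}"
    using AB unfolding class_monoid_def by (auto elim!: quotientE)
  have "r `` {add a b |a b. a \<in> A \<and> b \<in> B} = r `` {add a b}"
  proof
    show "r `` {add a b |a b. a \<in> A \<and> b \<in> B} \<subseteq> r `` {add a b}"
    proof
      fix y assume "y \<in> r `` {add a b |a b. a \<in> A \<and> b \<in> B}"
      then obtain a' b' where "(a, a') \<in> r" "(b, b') \<in> r" "(add a' b', y) \<in> r" using ab by blast
      then show "y \<in> r `` {add a b}" using cong equivE[OF r] by (meson Image_singleton_iff transD)
    qed
    have "a \<in> A" "b \<in> B" using ab equiv_class_self[OF r] by auto
    then show "r `` {add a b} \<subseteq> r `` {add a b |a b. a \<in> A \<and> b \<in> B}" by blast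
  qed
  then show ?thesis using quotientI[OF add[OF ab(1,3)], of r] by (simp add: class_monoid_def)
qed

text \<open>The relation is given by equations in \<open>M\<close>. Sums stay in the carrier, where
  \<open>F\<close> is injective, so the equations hold in \<open>M\<close> exactly when they hold in
  \<open>M'\<close>, and the isomorphism of class monoids applies to \<open>F\<close>.\<close>

lemma quotient_monoid_iso:
  assumes F: "F \<in> iso M M'" and closed: "\<And>a b. a \<in> carrier M \<Longrightarrow> b \<in> carrier M \<Longrightarrow> a \<otimes>\<^bsub>M\<^esub> b \<in> carrier M"
    and N: "N \<subseteq> carrier M"
  shows "(`) F \<in> iso (quotient_monoid M N) (quotient_monoid M' (F ` N))"
proof -
  have bij: "F ` carrier M = carrier M'" and inj: "inj_on F (carrier M)"
    and hom: "\<And>a b. a \<in> carrier M \<Longrightarrow> b \<in> carrier M \<Longrightarrow> F (a \<otimes>\<^bsub>M\<^esub> b) = F a \<otimes>\<^bsub>M'\<^esub> F b"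
    using F by (auto simp: iso_def hom_def bij_betw_def)
  have "(\<exists>n\<in>N. \<exists>n'\<in>N. m \<otimes>\<^bsub>M\<^esub> n = m' \<otimes>\<^bsub>M\<^esub> n') \<longleftrightarrow>
      (\<exists>n\<in>F ` N. \<exists>n'\<in>F ` N. F m \<otimes>\<^bsub>M'\<^esub> n = F m' \<otimes>\<^bsub>M'\<^esub> n')" if "m \<in> carrier M" "m' \<in> carrier M" for m m'
  proof -
    have "m \<otimes>\<^bsub>M\<^esub> n = m' \<otimes>\<^bsub>M\<^esub> n' \<longleftrightarrow> F m \<otimes>\<^bsub>M'\<^esub> F n = F m' \<otimes>\<^bsub>M'\<^esub> F n'" if "n \<in> N" "n' \<in> N" for n n'
      using inj_on_eq_iff[OF inj closed closed, of m n m' n'] hom[of m n] hom[of m' n'] N that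
        \<open>m \<in> carrier M\<close> \<open>m' \<in> carrier M\<close> by auto
    then show ?thesis by blast
  qed
  then show ?thesis
    unfolding quotient_monoid_def using bij
    by (intro class_monoid_iso closed hom) auto
qed

subsection \<open>The isomorphism\<close>

context qm
begin

lemma phase_rel_iff:
  assumes comp: "compact_space (gtop Gt)" and S: "gapped_system Q S" and T: "gapped_system Q T"
  shows "(S, T) \<in> phase_rel Q \<longleftrightarrow> (rep_of S, rep_of T) \<in> rep_rel Q"
  using same_phase_imp_rep_iso[OF comp S T] rep_iso_imp_same_phase[OF S T]
    twisted_rep_rep_of[OF S] twisted_rep_rep_of[OF T] S T
  by (auto simp: phase_rel_def rep_rel_def)

text \<open>Elements of the two monoids are sets of classes, hence the twofold image under
  \<open>rep_of\<close>.\<close>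

lemma RTP_Z_iso:
  assumes comp: "compact_space (gtop Gt)"
  shows "(`) ((`) rep_of) \<in> iso (RTP_Z Q) (twisted_K Q)"
proof -
  let ?X = "{S. gapped_system Q S}" and ?Y = "{E. twisted_rep Q E}"
  note iff = phase_rel_iff[OF comp]
  have img: "rep_of ` ?X = ?Y"
  proof (intro equalityI subsetI)
    show "E \<in> rep_of ` ?X" if "E \<in> ?Y" for E using rep_of_surj[OF comp, of E] that by blast
  qed (auto intro: twisted_rep_rep_of)
  have r: "phase_rel Q \<subseteq> ?X \<times> ?X" and s: "rep_rel Q \<subseteq> ?Y \<times> ?Y" by (auto simp: phase_rel_def rep_rel_def)
  \<comment> \<open>That being in the same phase is an equivalence relation is read off from
    isomorphism of representations, instead of by reversing and concatenating families.\<close>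
  have equiv: "equiv ?X (phase_rel Q)"
  proof (rule equivI)
    show "phase_rel Q \<subseteq> ?X \<times> ?X" by (rule r)
    show "refl_on ?X (phase_rel Q)"
      using rep_iso_refl twisted_rep_rep_of iff by (auto intro!: refl_onI simp: rep_rel_def)
    show "sym (phase_rel Q)"
    proof (rule symI)
      fix S T assume *: "(S, T) \<in> phase_rel Q"
      then have "gapped_system Q S" "gapped_system Q T" using r by auto
      then show "(T, S) \<in> phase_rel Q"
        using * iff rep_iso_sym[of "rep_of S" "rep_of T"] by (simp add: rep_rel_def)
    qed
    show "trans (phase_rel Q)"
    proof (rule transI)
      fix S T K assume *: "(S, T) \<in> phase_rel Q" "(T, K) \<in> phase_rel Q"
      then have "gapped_system Q S" "gapped_system Q T" "gapped_system Q K" using r by auto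
      then show "(S, K) \<in> phase_rel Q"
        using * iff rep_iso_trans[of "rep_of S" "rep_of T" "rep_of K"] by (simp add: rep_rel_def)
    qed
  qed
  have TP: "(`) rep_of \<in> iso (TP_Z Q) (Rep_s Q)"
    unfolding TP_Z_def Rep_s_def
    by (rule class_monoid_iso[OF img _ _ r s]) (auto simp: gapped_system_sum rep_of_sum iff)
  have closed: "A \<otimes>\<^bsub>TP_Z Q\<^esub> B \<in> carrier (TP_Z Q)"
    if "A \<in> carrier (TP_Z Q)" "B \<in> carrier (TP_Z Q)" for A B
    using that unfolding TP_Z_def
  proof (rule class_monoid_closed[OF equiv, rotated 2])
    fix S S' T T' assume *: "(S, S') \<in> phase_rel Q" "(T, T') \<in> phase_rel Q"
    then have g: "gapped_system Q S" "gapped_system Q S'" "gapped_system Q T" "gapped_system Q T'" using r by auto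
    then show "(system_sum S T, system_sum S' T') \<in> phase_rel Q"
      using * iff gapped_system_sum rep_of_sum rep_iso_sum twisted_rep_rep_of[OF gapped_system_sum]
      by (simp add: rep_rel_def)
  qed (auto simp: gapped_system_sum)
  have cl: "rep_of ` (phase_rel Q `` {S}) = rep_rel Q `` {rep_of S}" if "gapped_system Q S" for S
    using image_Image_class[OF img r s, of "{S}"] that iff by simp
  \<comment> \<open>Both notions of triviality ask for the same odd symmetry of data that
    \<open>rep_of\<close> retains.\<close>
  have tr: "topologically_trivial Q S \<longleftrightarrow> rep_trivial Q (rep_of S)" for S
    by (simp add: topologically_trivial_def rep_trivial_def)
  have "Triv_s Q = (`) rep_of ` trivial_phases Q"
  proof (intro equalityI subsetI)
    fix A assume "A \<in> Triv_s Q"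
    then obtain E where E: "twisted_rep Q E" "rep_trivial Q E" "A = rep_rel Q `` {E}" by (auto simp: Triv_s_def)
    obtain S where S: "gapped_system Q S" "rep_of S = E" by (rule rep_of_surj[OF comp E(1)])
    then have "A = rep_of ` (phase_rel Q `` {S})" "phase_rel Q `` {S} \<in> trivial_phases Q"
      using E cl[OF S(1)] tr[of S] by (auto simp: trivial_phases_def)
    then show "A \<in> (`) rep_of ` trivial_phases Q" by blast
  next
    fix A assume "A \<in> (`) rep_of ` trivial_phases Q"
    then obtain S where S: "gapped_system Q S" "topologically_trivial Q S" "A = rep_of ` (phase_rel Q `` {S})"
      by (auto simp: trivial_phases_def)
    then show "A \<in> Triv_s Q"
      unfolding Triv_s_def using cl[OF S(1)] tr[of S] twisted_rep_rep_of[OF S(1)] by blast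
  qed
  moreover have "trivial_phases Q \<subseteq> carrier (TP_Z Q)"
    by (auto simp: trivial_phases_def TP_Z_def class_monoid_def intro: quotientI)
  ultimately show ?thesis
    unfolding RTP_Z_def twisted_K_def using quotient_monoid_iso[OF TP closed] by simp
qed

end

theorem theorem8p6:
  fixes Q :: "('g, 'h) qm_class"
  assumes "extended_qm_class Q"
    and "compact_space (gtop (qbase Q))"
  shows "RTP_Z Q \<cong> twisted_K Q"
proof -
  interpret qm Q using assms(1) by unfold_locales
  show ?thesis using RTP_Z_iso[OF compact_ext[OF assms(2)]] unfolding is_iso_def by blast
qed

end
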